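(* Let $K$ be an algebraically closed field and let $\mathbb{X}$ be a weighted projective line over $K$ with weight sequence $(p_1,\dots,p_t)$, $t\ge 2$. Let $Q_{T_{\mathrm{sq}}(\mathbb{X})}$ be the Gabriel quiver of the endomorphism algebra, in the cluster category $\mathcal{C}_{\mathbb{X}}$, of the cluster-tilting object $T_{\mathrm{sq}}(\mathbb{X})$. Then $Q_{T_{\mathrm{sq}}(\mathbb{X})}$ is of finite mutation type if and only if $\mathbb{X}$ is of domestic type or of tubular type.
   Context: **Quivers and mutation.** A quiver means a finite quiver without loops and without 2-cycles. For a vertex $k$ of a quiver $Q$, the mutation $\mu_k(Q)$ is obtained by: (i) for each subquiver $i\to k\to j$ (i.e. each pair of such arrows) adding a new arrow $i\to j$; (ii) reversing all arrows with source or target $k$; (iii) removing the arrows of a maximal set of pairwise disjoint 2-cycles. $\mathrm{Mut}(Q)$ is the set of all quivers (up to isomorphism) obtained from $Q$ by finite sequences of mutations; $Q$ is of finite mutation type if $\mathrm{Mut}(Q)$ is finite. **Weighted projective lines.** A weighted projective line $\mathbb{X}$ over $K$ is given by a sequence $(p_1,\dots,p_t)$ ($t\ge2$) of positive integers (weights) and a sequence $(\lambda_1,\dots,\lambda_t)$ of pairwise distinct points of $\mathbb{P}_1(K)$, normalized so that $\lambda_1=\infty$, $\lambda_2=0$. Let $\mathbb{L}$ be the abelian group generated by $\vec x_1,\dots,\vec x_t$ with relations $p_1\vec x_1=\cdots=p_t\vec x_t=:\vec c$. Let $S=K[X_1,\dots,X_t]/(X_i^{p_i}-X_2^{p_2}+\lambda_iX_1^{p_1}: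 3\le i\le t)$, $\mathbb{L}$-graded by $\deg X_i=\vec x_i$. The category $\mathrm{coh}\,\mathbb{X}$ is the quotient of the category of finitely generated $\mathbb{L}$-graded $S$-modules by the Serre subcategory of those of finite length; $\mathcal{O}$ is the image of $S$ and $\mathcal{O}(\vec x)$ its grading shift by $\vec x\in\mathbb{L}$. The cluster category $\mathcal{C}_{\mathbb{X}}$ is the orbit category of $\mathcal{D}^b(\mathrm{coh}\,\mathbb{X})$ by $\tau^{-1}\circ\Sigma$, where $\Sigma$ is the suspension and $\tau$ the Auslander–Reiten translation. The type of $\mathbb{X}$ is determined by its genus $g_{\mathbb{X}}=1+\frac12\big((t-2)p-\sum_{i=1}^t\frac{p}{p_i}\big)$, $p=\mathrm{lcm}(p_1,\dots,p_t)$: domestic if $g_{\mathbb{X}}<1$, tubular if $g_{\mathbb{X}}=1$, wild if $g_{\mathbb{X}}>1$. **The quiver.** For each $i$ with $p_i\ge2$, let $S_i$ be the unique simple object of the rank-$p_i$ tube of finite length sheaves at $\lambda_i$ with $\mathrm{Hom}(\mathcal{O},S_i)\ne0$, and let $S_i^{[j]}$ ($1\le j\le p_i-1$) be the indecomposable object of that tube of length $j$ with top $S_i$. $T_{\mathrm{sq}}(\mathbb{X})$ is the direct sum of $\mathcal{O}$, $\mathcal{O}(\vec c)$ and the $S_i^{[j]}$ for $1\le i\le t$, $1\le j\le p_i-1$; it is a basic cluster-tilting object of $\mathcal{C}_{\mathbb{X}}$. Its quiver $Q_{T_{\mathrm{sq}}(\mathbb{X})}$ (the Gabriel quiver of $\mathrm{End}_{\mathcal{C}_{\mathbb{X}}}(T_{\mathrm{sq}}(\mathbb{X}))$)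 has these summands as vertices, and its arrows are: two arrows $\mathcal{O}\to\mathcal{O}(\vec c)$; and for each $i$ with $p_i\ge2$, one arrow $\mathcal{O}(\vec c)\to S_i^{[p_i-1]}$, one arrow $S_i^{[p_i-1]}\to\mathcal{O}$, and the arrows $S_i^{[p_i-1]}\to S_i^{[p_i-2]}\to\cdots\to S_i^{[2]}\to S_i^{[1]}$. *)

theory Defs
  imports Complex_Main "HOL-Computational_Algebra.Polynomial"
begin

section \<open>Quivers and mutation\<close>

text \<open>
  A quiver is recorded by its vertex set and by the number of arrows \<open>arrows Q i j\<close>
  from \<open>i\<close> to \<open>j\<close>, which determines it up to renaming the arrows.
\<close>

record 'v quiver =
  vertices :: "'v set"
  arrows :: "'v \<Rightarrow> 'v \<Rightarrow> nat"

definition is_quiver :: "'v quiver \<Rightarrow> bool" where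
  "is_quiver Q \<longleftrightarrow>
     finite (vertices Q) \<and>
     (\<forall>i j. arrows Q i j \<noteq> 0 \<longrightarrow> i \<in> vertices Q \<and> j \<in> vertices Q) \<and>
     (\<forall>i. arrows Q i i = 0) \<and>
     (\<forall>i j. arrows Q i j = 0 \<or> arrows Q j i = 0)"

definition add_composites :: "'v \<Rightarrow> 'v quiver \<Rightarrow> 'v quiver" where
  "add_composites k Q =
     Q\<lparr>arrows := \<lambda>i j. arrows Q i j + arrows Q i k * arrows Q k j\<rparr>"

definition reverse_at :: "'v \<Rightarrow> 'v quiver \<Rightarrow> 'v quiver" where
  "reverse_at k Q =
     Q\<lparr>arrows := \<lambda>i j. if i = k \<or> j = k then arrows Q j i else arrows Q i j\<rparr>"

text \<open>
  A maximal set of pairwise disjoint 2-cycles between \<open>i\<close> and \<open>j\<close> consists of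
  \<open>min (arrows Q i j) (arrows Q j i)\<close> pairs of arrows.
\<close>

definition cancel_2cycles :: "'v quiver \<Rightarrow> 'v quiver" where
  "cancel_2cycles Q =
     Q\<lparr>arrows := \<lambda>i j. arrows Q i j - min (arrows Q i j) (arrows Q j i)\<rparr>"

definition mutate :: "'v \<Rightarrow> 'v quiver \<Rightarrow> 'v quiver" where
  "mutate k Q = cancel_2cycles (reverse_at k (add_composites k Q))"

definition mutation_step :: "'v quiver \<Rightarrow> 'v quiver \<Rightarrow> bool" where
  "mutation_step Q R \<longleftrightarrow> (\<exists>k\<in>vertices Q. R = mutate k Q)"

definition quiver_iso :: "'v quiver \<Rightarrow> 'v quiver \<Rightarrow> bool" where
  "quiver_iso Q R \<longleftrightarrow>
     (\<exists>f. bij_betw f (vertices Q) (vertices R) \<and>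
          (\<forall>i\<in>vertices Q. \<forall>j\<in>vertices Q. arrows R (f i) (f j) = arrows Q i j))"

definition Mut :: "'v quiver \<Rightarrow> 'v quiver set set" where
  "Mut Q = {R. mutation_step\<^sup>*\<^sup>* Q R} // {(R, R'). quiver_iso R R'}"

definition finite_mutation_type :: "'v quiver \<Rightarrow> bool" where
  "finite_mutation_type Q \<longleftrightarrow> finite (Mut Q)"

lemma is_quiver_mutate:
  assumes "is_quiver Q"
  shows "is_quiver (mutate k Q)"
proof -
  let ?M = "arrows (reverse_at k (add_composites k Q))"
  have arr: "arrows (mutate k Q) i j = ?M i j - min (?M i j) (?M j i)" for i j
    by (simp add: mutate_def cancel_2cycles_def)
  have verts: "vertices (mutate k Q) = vertices Q"
    by (simp add: mutate_def cancel_2cycles_def reverse_at_def add_composites_def)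
  have supp: "i \<in> vertices Q \<and> j \<in> vertices Q" if "arrows Q i j \<noteq> 0" for i j
    using assms that by (simp add: is_quiver_def)
  have "i \<in> vertices Q \<and> j \<in> vertices Q" if "?M i j \<noteq> 0" for i j
  proof -
    from that have "arrows Q i j \<noteq> 0 \<or> arrows Q j i \<noteq> 0 \<or>
        (arrows Q i k \<noteq> 0 \<and> arrows Q k j \<noteq> 0) \<or> (arrows Q j k \<noteq> 0 \<and> arrows Q k i \<noteq> 0)"
      by (auto simp add: reverse_at_def add_composites_def split: if_splits)
    with supp show ?thesis by blast
  qed
  then have "i \<in> vertices Q \<and> j \<in> vertices Q" if "arrows (mutate k Q) i j \<noteq> 0" for i j
    using that unfolding arr by (metis diff_0_eq_0)
  moreover have "arrows (mutate k Q) i i = 0" for i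
    by (simp add: arr)
  moreover have "arrows (mutate k Q) i j = 0 \<or> arrows (mutate k Q) j i = 0" for i j
    unfolding arr by linarith
  moreover have "finite (vertices Q)"
    using assms by (simp add: is_quiver_def)
  ultimately show ?thesis
    by (simp add: is_quiver_def verts)
qed

lemma equiv_quiver_iso: "equiv UNIV {(R, R'). quiver_iso (R :: 'v quiver) R'}"
proof (rule equivI)
  show "{(R, R'). quiver_iso R R'} \<subseteq> UNIV \<times> UNIV" by simp
  show "refl {(R, R'). quiver_iso (R :: 'v quiver) R'}"
    by (auto simp: refl_on_def quiver_iso_def intro!: exI[of _ id])
  show "sym {(R, R'). quiver_iso (R :: 'v quiver) R'}"
  proof (rule symI, simp)
    fix Q R :: "'v quiver" assume "quiver_iso Q R"
    then obtain f where f: "bij_betw f (vertices Q) (vertices R)"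
      "\<forall>i\<in>vertices Q. \<forall>j\<in>vertices Q. arrows R (f i) (f j) = arrows Q i j"
      by (auto simp: quiver_iso_def)
    let ?g = "inv_into (vertices Q) f"
    have "arrows Q (?g i) (?g j) = arrows R i j" if "i \<in> vertices R" "j \<in> vertices R" for i j
    proof -
      have "?g i \<in> vertices Q" "?g j \<in> vertices Q" "f (?g i) = i" "f (?g j) = j"
        using that f(1) by (simp_all add: bij_betw_def inv_into_into f_inv_into_f)
      then show ?thesis using f(2) by force
    qed
    then show "quiver_iso R Q"
      unfolding quiver_iso_def using bij_betw_inv_into[OF f(1)] by (intro exI[of _ ?g]) simp
  qed
  show "trans {(R, R'). quiver_iso (R :: 'v quiver) R'}"
  proof (rule transI, simp)
    fix Q R S :: "'v quiver" assume "quiver_iso Q R" "quiver_iso R S"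
    then obtain f g where
      f: "bij_betw f (vertices Q) (vertices R)"
         "\<forall>i\<in>vertices Q. \<forall>j\<in>vertices Q. arrows R (f i) (f j) = arrows Q i j" and
      g: "bij_betw g (vertices R) (vertices S)"
         "\<forall>i\<in>vertices R. \<forall>j\<in>vertices R. arrows S (g i) (g j) = arrows R i j"
      by (auto simp: quiver_iso_def)
    have "\<forall>i\<in>vertices Q. \<forall>j\<in>vertices Q. arrows S ((g \<circ> f) i) ((g \<circ> f) j) = arrows Q i j"
      using f g bij_betwE[OF f(1)] by simp
    then show "quiver_iso Q S"
      unfolding quiver_iso_def using bij_betw_trans[OF f(1) g(1)] by (intro exI[of _ "g \<circ> f"]) simp
  qed
qed


section \<open>Weighted projective lines\<close>

text \<open>
  Points of the projective line over \<open>'k\<close>: \<open>Affine a\<close> is the point with affine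
  coordinate \<open>a\<close>.
\<close>

datatype 'k proj_point = Infinity | Affine 'k

text \<open>
  Only the values of \<open>weight\<close> and \<open>point\<close> at the indices \<open>1, \<dots>, num_weights\<close> matter.
\<close>

record 'k wpl =
  num_weights :: nat
  weight :: "nat \<Rightarrow> nat"
  point :: "nat \<Rightarrow> 'k proj_point"

definition weighted_projective_line :: "('k :: field) wpl \<Rightarrow> bool" where
  "weighted_projective_line X \<longleftrightarrow>
     2 \<le> num_weights X \<and>
     (\<forall>i\<in>{1..num_weights X}. 0 < weight X i) \<and>
     inj_on (point X) {1..num_weights X} \<and>
     point X 1 = Infinity \<and> point X 2 = Affine 0"

definition weight_lcm :: "'k wpl \<Rightarrow> nat" where
  "weight_lcm X = Lcm (weight X ` {1..num_weights X})"

definition genus :: "'k wpl \<Rightarrow> real" where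
  "genus X = 1 + 1 / 2 *
     ((real (num_weights X) - 2) * real (weight_lcm X)
      - (\<Sum>i = 1..num_weights X. real (weight_lcm X) / real (weight X i)))"

definition domestic :: "'k wpl \<Rightarrow> bool" where
  "domestic X \<longleftrightarrow> genus X < 1"

definition tubular :: "'k wpl \<Rightarrow> bool" where
  "tubular X \<longleftrightarrow> genus X = 1"

definition wild :: "'k wpl \<Rightarrow> bool" where
  "wild X \<longleftrightarrow> genus X > 1"


section \<open>The quiver of the cluster-tilting object $T_{sq}(X)$\<close>

text \<open>
  The indecomposable summands of $T_{sq}(X)$: \<open>Struct\<close> is the structure sheaf $O$,
  \<open>Struct_c\<close> is $O(c)$, and \<open>Tube i j\<close> is the indecomposable sheaf $S_i^{[j]}$ of length
  \<open>j\<close> with top $S_i$ in the exceptional tube at the \<open>i\<close>-th point.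
\<close>

datatype summand = Struct | Struct_c | Tube nat nat

definition Tsq_summands :: "'k wpl \<Rightarrow> summand set" where
  "Tsq_summands X =
     {Struct, Struct_c} \<union>
     {Tube i j | i j. 1 \<le> i \<and> i \<le> num_weights X \<and> 1 \<le> j \<and> j \<le> weight X i - 1}"

text \<open>
  The Gabriel quiver of the endomorphism algebra of $T_{sq}(X)$ in the cluster category,
  given by its arrows rather than computed from the category.
\<close>

fun Tsq_arrows :: "'k wpl \<Rightarrow> summand \<Rightarrow> summand \<Rightarrow> nat" where
  "Tsq_arrows X Struct Struct_c = 2"
| "Tsq_arrows X Struct_c (Tube i j) =
     (if Tube i j \<in> Tsq_summands X \<and> j = weight X i - 1 then 1 else 0)"
| "Tsq_arrows X (Tube i j) Struct =
     (if Tube i j \<in> Tsq_summands X \<and> j = weight X i - 1 then 1 else 0)"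
| "Tsq_arrows X (Tube i j) (Tube i' j') =
     (if Tube i j \<in> Tsq_summands X \<and> Tube i' j' \<in> Tsq_summands X \<and> i = i' \<and> j = j' + 1
      then 1 else 0)"
| "Tsq_arrows X _ _ = 0"

definition Q_Tsq :: "'k wpl \<Rightarrow> summand quiver" where
  "Q_Tsq X = \<lparr>vertices = Tsq_summands X, arrows = Tsq_arrows X\<rparr>"

lemma finite_Tsq_summands: "finite (Tsq_summands X)"
proof -
  have "{Tube i j | i j. 1 \<le> i \<and> i \<le> num_weights X \<and> 1 \<le> j \<and> j \<le> weight X i - 1}
      = (\<lambda>(i, j). Tube i j) ` (SIGMA i:{1..num_weights X}. {1..weight X i - 1})"
    by (auto simp: image_iff)
  then show ?thesis by (simp add: Tsq_summands_def)
qed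

lemma is_quiver_Q_Tsq: "is_quiver (Q_Tsq X)"
proof -
  have "i \<in> Tsq_summands X \<and> j \<in> Tsq_summands X" if "Tsq_arrows X i j \<noteq> 0" for i j
    using that by (cases "(X, i, j)" rule: Tsq_arrows.cases)
      (auto split: if_splits simp: Tsq_summands_def)
  moreover have "Tsq_arrows X i i = 0" for i by (cases i) auto
  moreover have "Tsq_arrows X i j = 0 \<or> Tsq_arrows X j i = 0" for i j
    by (cases i; cases j) auto
  ultimately show ?thesis
    by (simp add: is_quiver_def Q_Tsq_def finite_Tsq_summands)
qed

end

theory Submission
  imports Defs
begin

text \<open>
  Both directions only see the exchange matrix, the skew-symmetric matrix of differences of arrow numbers.
  A quiver has finite mutation type iff the arrow numbers in its mutation class are bounded
  (\<open>finite_mutation_type_iff_bounded\<close>), and this property passes to full subquivers, because mutation at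
  vertices of a full subquiver does not see the rest. Shortening the arms of the quiver of $T_{sq}$ or leaving
  out arms gives full subquivers (\<open>finite_mutation_type_Q_Tsq_mono\<close>), so only the extreme weight sequences
  matter: genus at most $1$ means $\sum (1 - 1/p_i) \le 2$, every weight sequence with this property lies below one of
  $(a,b)$, $(2,2,n)$, $(2,3,6)$, $(2,4,4)$, $(3,3,3)$, $(2,2,2,2)$, and every other one lies above one of $(2,3,7)$, $(2,4,5)$,
  $(3,3,4)$, $(2,2,2,3)$, $(2,2,2,2,2)$ (\<open>tame_or_wild\<close>).

  For the five minimal wild sequences an explicit sequence of mutations produces three vertices, two of which are
  joined by at least three arrows and connected to the third. Mutating alternately at the first two makes the
  arrow numbers grow without bound (\<open>growing_triangle\<close>).

  For genus at most $1$ the bound comes from the Grothendieck group $K$ of coherent sheaves with its Euler form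
  \<open>chi\<close>. A mutation class is tracked by families of real roots (classes with \<open>chi x x = 1\<close>), which
  behave like the classes of a simple-minded collection of sheaves and shifted sheaves: if they are ordered by phase,
  that is, by the angle of the vector (rank, degree), then \<open>chi\<close> vanishes from an earlier member to a later one,
  and is nonpositive between members on the same ray. Such a family is called a seed. Its exchange matrix is the
  antisymmetrisation of \<open>chi\<close>, and mutation of the matrix lifts to a tilt of the seed
  (\<open>seed_mutation\<close>). Since \<open>chi\<close> is positive semidefinite, \<open>\<bar>chi x y + chi y x\<bar> \<le> 2\<close>
  for roots; in a seed \<open>chi x y\<close> and \<open>chi y x\<close> never have opposite signs, so all arrow numbers stay
  at most $2$ (\<open>form_bound\<close>).

  That the tilt of a seed is a seed needs two facts on \<open>K\<close>. The first is stability: a root of smaller phase,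
  within half a turn, has \<open>chi \<ge> 0\<close> to one of larger phase. The second concerns roots on a single line through the
  origin, where three configurations have to be controlled. On the line of rank $0$ these roots are intervals in the
  cyclic sets of simple objects of the exceptional tubes; a member of the seed off the line cuts the cycles open, and
  the configurations are settled by the combinatorics of intervals in a linear order (\<open>rank_0_hereditary\<close>).
  In the tubular case every class is moved to rank $0$ by isometries that preserve the determinant of
  (rank, degree): line bundle twists and the tubular mutation along the orbit of the structure sheaf under
  $\tau$ realise the Euclidean algorithm on (rank, degree) (\<open>transitive\<close>). In the domestic cases $(a,b)$ and
  $(2,2,n)$ the roots of positive rank are listed explicitly, and no two of them of equal slope interact in
  the way that would have to be excluded (\<open>charged_lattice_if_domestic\<close>).
\<close>

section \<open>Mutation classes and full subquivers\<close>

text \<open>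
  Since 2-cycles are cancelled, a quiver is determined by these signed arrow numbers, and in terms of them the three
  steps of a mutation become the single formula \<open>net_mutate\<close>.
\<close>

definition net :: "'v quiver \<Rightarrow> 'v \<Rightarrow> 'v \<Rightarrow> int" where
  "net Q i j = int (arrows Q i j) - int (arrows Q j i)"

lemma net_skew: "net Q j i = - net Q i j" by (simp add: net_def)
lemma net_self[simp]: "net Q i i = 0" by (simp add: net_def)

lemma arrows_net: "is_quiver Q \<Longrightarrow> arrows Q i j = nat (net Q i j)"
  unfolding is_quiver_def net_def by (metis (no_types, lifting) diff_0 diff_0_right int_ops(1) nat_int nat_zminus_int)

lemma vertices_mutate[simp]: "vertices (mutate k Q) = vertices Q"
  by (simp add: mutate_def cancel_2cycles_def reverse_at_def add_composites_def)

lemma net_mutate: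
  assumes "is_quiver Q"
  shows "net (mutate k Q) i j = (if i = k \<or> j = k then - net Q i j
    else net Q i j + max 0 (net Q i k) * max 0 (net Q k j) - max 0 (net Q j k) * max 0 (net Q k i))"
proof -
  have n: "int (arrows Q a b) = max 0 (net Q a b)" for a b using arrows_net[OF assms] by simp
  have z: "arrows Q a a = 0" for a using assms by (simp add: is_quiver_def)
  let ?M = "arrows (reverse_at k (add_composites k Q))"
  have "net (mutate k Q) i j = int (?M i j) - int (?M j i)"
    by (simp add: net_def mutate_def cancel_2cycles_def)
  also have "\<dots> = (if i = k \<or> j = k then - net Q i j
    else net Q i j + int (arrows Q i k) * int (arrows Q k j) - int (arrows Q j k) * int (arrows Q k i))"
    by (simp add: reverse_at_def add_composites_def net_def z)
  finally show ?thesis by (simp add: n)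
qed

definition reachable :: "'v quiver \<Rightarrow> 'v quiver \<Rightarrow> bool" where
  "reachable Q R \<longleftrightarrow> mutation_step\<^sup>*\<^sup>* Q R"

lemma reachable_refl: "reachable Q Q" by (simp add: reachable_def)

lemma reachable_mutate: "reachable Q R \<Longrightarrow> k \<in> vertices R \<Longrightarrow> reachable Q (mutate k R)"
  unfolding reachable_def by (rule rtranclp.rtrancl_into_rtrancl) (auto simp: mutation_step_def)

lemma reachable_induct [consumes 1, case_names refl mutate]:
  assumes "reachable Q R" "P Q"
    "\<And>R k. reachable Q R \<Longrightarrow> P R \<Longrightarrow> k \<in> vertices R \<Longrightarrow> P (mutate k R)"
  shows "P R"
  using assms(1) unfolding reachable_def
  by (induction rule: rtranclp_induct) (use assms(2,3) in \<open>auto simp: mutation_step_def reachable_def\<close>)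

lemma reachable_vertices: "reachable Q R \<Longrightarrow> vertices R = vertices Q"
  by (induction rule: reachable_induct) auto

lemma reachable_is_quiver: "reachable Q R \<Longrightarrow> is_quiver Q \<Longrightarrow> is_quiver R"
  by (induction rule: reachable_induct) (auto intro: is_quiver_mutate)

text \<open>
  Finitely many isomorphism classes allow only finitely many values of the total number of arrows, which is an isomorphism
  invariant and bounds every arrow number. Conversely, all quivers reachable from \<open>Q\<close> share its vertex set, so a bound on
  the arrow numbers leaves only finitely many of them, even before passing to isomorphism classes.
\<close>

lemma finite_mutation_type_iff_bounded:
  assumes Q: "is_quiver Q"
  shows "finite_mutation_type Q \<longleftrightarrow> (\<exists>N. \<forall>R. reachable Q R \<longrightarrow> (\<forall>i j. arrows R i j \<le> N))"
proof
  let ?r = "{(R, R'). quiver_iso (R :: 'a quiver) R'}"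
  assume "finite_mutation_type Q"
  then have fin: "finite ({R. reachable Q R} // ?r)"
    by (simp add: finite_mutation_type_def Mut_def reachable_def)
  define total where "total R = (\<Sum>i\<in>vertices R. \<Sum>j\<in>vertices R. arrows R i j)" for R :: "'a quiver"
  have iso: "total R = total R'" if iso: "quiver_iso R R'" for R R' :: "'a quiver"
  proof -
    obtain f where f: "bij_betw f (vertices R) (vertices R')"
      "\<forall>i\<in>vertices R. \<forall>j\<in>vertices R. arrows R' (f i) (f j) = arrows R i j"
      using iso unfolding quiver_iso_def by blast
    have "total R' = (\<Sum>i\<in>vertices R. \<Sum>j\<in>vertices R. arrows R' (f i) (f j))"
      unfolding total_def
      by (simp add: sum.reindex_bij_betw[OF f(1), symmetric])
    then show ?thesis unfolding total_def using f(2) by simp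
  qed
  have "total ` {R. reachable Q R} \<subseteq> (\<lambda>C. total (SOME R. R \<in> C)) ` ({R. reachable Q R} // ?r)"
  proof (rule image_subsetI)
    fix R assume "R \<in> {R. reachable Q R}"
    then have R: "reachable Q R" by simp
    let ?C = "?r `` {R}"
    have "R \<in> ?C" using equiv_class_self[OF equiv_quiver_iso] by blast
    then have "(SOME R. R \<in> ?C) \<in> ?C" by (rule someI)
    then have "total R = total (SOME R. R \<in> ?C)" by (intro iso) simp
    moreover have "?C \<in> {R. reachable Q R} // ?r" using R by (intro quotientI) simp
    ultimately show "total R \<in> (\<lambda>C. total (SOME R. R \<in> C)) ` ({R. reachable Q R} // ?r)" by blast
  qed
  then have "finite (total ` {R. reachable Q R})" using fin finite_surj by blast
  then obtain N where N: "\<And>R. reachable Q R \<Longrightarrow> total R \<le> N"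
    unfolding finite_nat_set_iff_bounded_le by auto
  have "arrows R i j \<le> N" if R: "reachable Q R" for R i j
  proof (cases "arrows R i j = 0")
    case False
    have q: "is_quiver R" by (rule reachable_is_quiver[OF R Q])
    then have fv: "finite (vertices R)" and ij: "i \<in> vertices R" "j \<in> vertices R"
      using False by (auto simp: is_quiver_def)
    have "arrows R i j \<le> (\<Sum>j\<in>vertices R. arrows R i j)" using fv ij by (intro member_le_sum) auto
    also have "\<dots> \<le> total R" unfolding total_def
      using fv ij by (intro member_le_sum[of i _ "\<lambda>i. \<Sum>j\<in>vertices R. arrows R i j"]) auto
    also have "\<dots> \<le> N" by (rule N[OF R])
    finally show ?thesis .
  qed simp
  then show "\<exists>N. \<forall>R. reachable Q R \<longrightarrow> (\<forall>i j. arrows R i j \<le> N)" by blast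
next
  assume "\<exists>N. \<forall>R. reachable Q R \<longrightarrow> (\<forall>i j. arrows R i j \<le> N)"
  then obtain N where N: "\<And>R i j. reachable Q R \<Longrightarrow> arrows R i j \<le> N" by blast
  let ?V = "vertices Q"
  let ?F = "{f. \<forall>p. (p \<in> ?V \<times> ?V \<longrightarrow> f p \<in> {..N}) \<and> (p \<notin> ?V \<times> ?V \<longrightarrow> f p = 0)}"
  have "finite ?V" using Q by (simp add: is_quiver_def)
  then have "finite ?F" by (intro finite_set_of_finite_funs) auto
  moreover have "{R. reachable Q R} \<subseteq> (\<lambda>f. \<lparr>vertices = ?V, arrows = \<lambda>i j. f (i, j)\<rparr>) ` ?F"
  proof (clarify)
    fix R assume R: "reachable Q R"
    have q: "is_quiver R" by (rule reachable_is_quiver[OF R Q])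
    then have "(\<lambda>(i, j). arrows R i j) \<in> ?F"
      using N[OF R] reachable_vertices[OF R] by (auto simp: is_quiver_def)
    moreover have "R = \<lparr>vertices = ?V, arrows = \<lambda>i j. (\<lambda>(i, j). arrows R i j) (i, j)\<rparr>"
      using reachable_vertices[OF R] by simp
    ultimately show "R \<in> (\<lambda>f. \<lparr>vertices = ?V, arrows = \<lambda>i j. f (i, j)\<rparr>) ` ?F" by blast
  qed
  ultimately have "finite {R. reachable Q R}" by (meson finite_surj)
  then show "finite_mutation_type Q"
    by (simp add: finite_mutation_type_def Mut_def reachable_def quotient_def)
qed

definition full_embedding :: "('v \<Rightarrow> 'w) \<Rightarrow> 'v quiver \<Rightarrow> 'w quiver \<Rightarrow> bool" where
  "full_embedding h Q R \<longleftrightarrow> inj_on h (vertices Q) \<and> h ` vertices Q \<subseteq> vertices R \<and>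
     (\<forall>i\<in>vertices Q. \<forall>j\<in>vertices Q. arrows R (h i) (h j) = arrows Q i j)"

text \<open>
  The number of arrows between two vertices after a mutation at \<open>k\<close> depends only on the arrows among these two vertices and \<open>k\<close>.
\<close>

lemma full_embedding_mutate:
  assumes "full_embedding h Q R" "k \<in> vertices Q"
  shows "full_embedding h (mutate k Q) (mutate (h k) R)"
  using assms unfolding full_embedding_def
  by (auto simp: mutate_def cancel_2cycles_def reverse_at_def add_composites_def inj_on_eq_iff)

lemma full_embedding_finite_mutation_type:
  assumes Q: "is_quiver Q" and R: "is_quiver R" and h: "full_embedding h Q R" and fin: "finite_mutation_type R"
  shows "finite_mutation_type Q"
proof -
  obtain N where N: "\<And>R' i j. reachable R R' \<Longrightarrow> arrows R' i j \<le> N"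
    using fin finite_mutation_type_iff_bounded[OF R] by blast
  have "\<exists>R'. reachable R R' \<and> full_embedding h Q' R'" if "reachable Q Q'" for Q'
    using that
  proof (induction rule: reachable_induct)
    case refl
    then show ?case using h reachable_refl by blast
  next
    case (mutate Q' k)
    then obtain R' where R': "reachable R R'" "full_embedding h Q' R'" by blast
    then have "h k \<in> vertices R'" using mutate by (auto simp: full_embedding_def)
    then show ?case using reachable_mutate[OF R'(1)] full_embedding_mutate[OF R'(2) \<open>k \<in> vertices Q'\<close>] by blast
  qed
  then have "arrows Q' i j \<le> N" if Q': "reachable Q Q'" for Q' i j
  proof (cases "arrows Q' i j = 0")
    case False
    then have "i \<in> vertices Q'" "j \<in> vertices Q'"
      using reachable_is_quiver[OF Q' Q] by (auto simp: is_quiver_def)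
    moreover obtain R' where "reachable R R'" "full_embedding h Q' R'"
      using \<open>\<And>Q'. reachable Q Q' \<Longrightarrow> \<exists>R'. reachable R R' \<and> full_embedding h Q' R'\<close> Q' by blast
    ultimately show ?thesis using N[of R' "h i" "h j"] by (simp add: full_embedding_def)
  qed simp
  then show ?thesis using finite_mutation_type_iff_bounded[OF Q] by blast
qed

text \<open>
  Mutating at \<open>v\<close> turns the path \<open>u \<rightarrow> v \<rightarrow> w\<close> into at least \<open>3 b - b = 2 b\<close> arrows from
  \<open>u\<close> to \<open>w\<close>, where \<open>b\<close> is the number of arrows \<open>v \<rightarrow> w\<close>, and reverses the
  arrows at \<open>v\<close>. So the hypotheses hold again with \<open>u\<close> and \<open>v\<close> exchanged and \<open>b\<close> at least doubled.
\<close>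

lemma growing_triangle:
  assumes Q: "is_quiver Q" and R: "reachable Q R"
    and uvw: "u \<in> vertices Q" "v \<in> vertices Q" "u \<noteq> v" "u \<noteq> w" "v \<noteq> w"
    and big: "net R u v \<ge> 3" and vw: "net R v w \<ge> 1" "net R w u \<le> net R v w"
  shows "\<not> finite_mutation_type Q"
proof
  assume "finite_mutation_type Q"
  then obtain N where N: "\<And>R' i j. reachable Q R' \<Longrightarrow> arrows R' i j \<le> N"
    using finite_mutation_type_iff_bounded[OF Q] by blast
  have "\<exists>R u v. reachable Q R \<and> u \<in> vertices Q \<and> v \<in> vertices Q \<and> u \<noteq> v \<and> u \<noteq> w \<and> v \<noteq> w \<and>
     net R u v \<ge> 3 \<and> net R v w \<ge> int n + 1 \<and> net R w u \<le> net R v w" for n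
  proof (induction n)
    case 0
    then show ?case using assms by force
  next
    case (Suc n)
    then obtain R u v where R: "reachable Q R" and uv: "u \<in> vertices Q" "v \<in> vertices Q" "u \<noteq> v" "u \<noteq> w" "v \<noteq> w"
      and b: "net R u v \<ge> 3" "net R v w \<ge> int n + 1" "net R w u \<le> net R v w" by blast
    let ?R = "mutate v R"
    have R': "reachable Q ?R" using R uv reachable_vertices[OF R] by (intro reachable_mutate) simp_all
    have q: "is_quiver R" by (rule reachable_is_quiver[OF R Q])
    have 1: "net ?R v u = net R u v" "net ?R w v = net R v w"
      using net_mutate[OF q, of v v u] net_mutate[OF q, of v w v] net_skew[of R u v] net_skew[of R w v] by auto
    have 2: "net ?R u w = net R u w + net R u v * net R v w"
      using net_mutate[OF q, of v u w] uv b net_skew[of R u v] net_skew[of R v w] by simp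
    have "3 * net R v w \<le> net R u v * net R v w" using b by (intro mult_right_mono) auto
    then have "net ?R u w \<ge> 2 * net R v w" using 2 b net_skew[of R u w] by linarith
    then show ?case
      using R' uv b 1 by (intro exI[of _ ?R] exI[of _ v] exI[of _ u]) auto
  qed
  from this[of N] obtain R u v where "reachable Q R" "net R v w \<ge> int N + 1" by blast
  then show False using N[of R v w] by (simp add: net_def)
qed

section \<open>The minimal wild weight sequences\<close>

text \<open>
  Mutation of matrices given as lists of rows, in a form suited to symbolic evaluation: the rows with entry \<open>0\<close> in
  column \<open>k\<close> do not change.
\<close>

definition mutate_row :: "int \<Rightarrow> int list \<Rightarrow> int list \<Rightarrow> int list" where
  "mutate_row a r row = map2 (\<lambda>x y. x + max 0 a * max 0 y - max 0 (- y) * max 0 (- a)) row r"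

definition mutate_matrix :: "nat \<Rightarrow> int list list \<Rightarrow> int list list" where
  "mutate_matrix k M = (map (\<lambda>row. let a = row ! k in if a = 0 then row else (mutate_row a (M ! k) row)[k := - a]) M)
     [k := map uminus (M ! k)]"

definition represents :: "'v list \<Rightarrow> 'v quiver \<Rightarrow> int list list \<Rightarrow> bool" where
  "represents vs Q M \<longleftrightarrow> length M = length vs \<and> (\<forall>i<length vs. length (M ! i) = length vs) \<and>
     (\<forall>i<length vs. \<forall>j<length vs. M ! i ! j = net Q (vs ! i) (vs ! j))"

lemma represents_mutate:
  assumes Q: "is_quiver Q" and vs: "distinct vs" and k: "k < length vs" and M: "represents vs Q M"
  shows "represents vs (mutate (vs ! k) Q) (mutate_matrix k M)"
proof -
  let ?n = "length vs"
  have len: "length M = ?n" "\<And>i. i < ?n \<Longrightarrow> length (M ! i) = ?n"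
    and ent: "\<And>i j. i < ?n \<Longrightarrow> j < ?n \<Longrightarrow> M ! i ! j = net Q (vs ! i) (vs ! j)"
    using M by (auto simp: represents_def)
  have row: "mutate_matrix k M ! i = (if i = k then map uminus (M ! k) else if M ! i ! k = 0 then M ! i
      else (mutate_row (M ! i ! k) (M ! k) (M ! i))[k := - (M ! i ! k)])" if "i < ?n" for i
    using that k len by (auto simp: mutate_matrix_def Let_def nth_list_update)
  have "length (mutate_matrix k M ! i) = ?n" if "i < ?n" for i
    using that k len by (simp add: row mutate_row_def)
  moreover have "mutate_matrix k M ! i ! j = net (mutate (vs ! k) Q) (vs ! i) (vs ! j)" if "i < ?n" "j < ?n" for i j
  proof -
    have eq: "vs ! i = vs ! k \<longleftrightarrow> i = k" "vs ! j = vs ! k \<longleftrightarrow> j = k"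
      using vs that k by (simp_all add: nth_eq_iff_index_eq)
    show ?thesis
      unfolding net_mutate[OF Q] eq
      using that k len ent net_skew[of Q "vs ! k" "vs ! j"] net_skew[of Q "vs ! k" "vs ! i"]
      by (auto simp: row mutate_row_def)
  qed
  ultimately show ?thesis using len by (simp add: represents_def mutate_matrix_def)
qed

lemma represents_fold:
  assumes "is_quiver Q" "distinct vs" "set vs \<subseteq> vertices Q" "\<forall>k\<in>set ks. k < length vs" "represents vs Q M"
  shows "\<exists>R. reachable Q R \<and> represents vs R (fold mutate_matrix ks M)"
  using assms(4,5)
proof (induction ks rule: rev_induct)
  case Nil
  then show ?case using reachable_refl by auto
next
  case (snoc k ks)
  then obtain R where R: "reachable Q R" "represents vs R (fold mutate_matrix ks M)" by auto
  have "vs ! k \<in> vertices R" using snoc assms(3) reachable_vertices[OF R(1)] by auto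
  then have "reachable Q (mutate (vs ! k) R)" by (rule reachable_mutate[OF R(1)])
  then show ?case
    using represents_mutate[OF reachable_is_quiver[OF R(1) assms(1)] assms(2) _ R(2)] snoc by auto
qed

text \<open>
  The quiver of $T_{sq}$ does not depend on the points, so they are all set to an arbitrary value; the result is not a
  weighted projective line in the strict sense.
\<close>

definition of_weights :: "nat list \<Rightarrow> unit wpl" where
  "of_weights p = \<lparr>num_weights = length p, weight = \<lambda>i. p ! (i - 1), point = \<lambda>_. Infinity\<rparr>"

fun arrow_count :: "nat list \<Rightarrow> summand \<Rightarrow> summand \<Rightarrow> int" where
  "arrow_count p Struct Struct_c = 2"
| "arrow_count p Struct_c (Tube i j) = (if j = p ! (i - 1) - 1 then 1 else 0)"
| "arrow_count p (Tube i j) Struct = (if j = p ! (i - 1) - 1 then 1 else 0)"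
| "arrow_count p (Tube i j) (Tube i' j') = (if i = i' \<and> j = j' + 1 then 1 else 0)"
| "arrow_count p _ _ = 0"

definition vertex_list :: "nat list \<Rightarrow> summand list" where
  "vertex_list p = Struct # Struct_c # concat (map (\<lambda>i. map (Tube i) [1..<p ! (i - 1)]) [1..<Suc (length p)])"

definition exchange_matrix :: "nat list \<Rightarrow> int list list" where
  "exchange_matrix p = map (\<lambda>v. map (\<lambda>w. arrow_count p v w - arrow_count p w v) (vertex_list p)) (vertex_list p)"

lemma set_vertex_list: "set (vertex_list p) = Tsq_summands (of_weights p)"
  by (auto simp: vertex_list_def Tsq_summands_def of_weights_def)

lemma represents_exchange_matrix: "represents (vertex_list p) (Q_Tsq (of_weights p)) (exchange_matrix p)"
proof -
  have "int (Tsq_arrows (of_weights p) v w) = arrow_count p v w"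
    if "v \<in> Tsq_summands (of_weights p)" "w \<in> Tsq_summands (of_weights p)" for v w
    using that by (cases "(p, v, w)" rule: arrow_count.cases) (auto simp: of_weights_def)
  then show ?thesis
    unfolding represents_def exchange_matrix_def
    by (simp add: net_def Q_Tsq_def set_vertex_list[symmetric])
qed

text \<open>
  \<open>ks\<close> lists the positions of the vertices at which to mutate successively, and \<open>u\<close>, \<open>v\<close>,
  \<open>w\<close> are the positions of a triangle as in \<open>growing_triangle\<close> in the resulting quiver.
\<close>

definition growth_certificate :: "nat list \<Rightarrow> nat list \<Rightarrow> nat \<Rightarrow> nat \<Rightarrow> nat \<Rightarrow> bool" where
  "growth_certificate p ks u v w \<longleftrightarrow>
     (let n = length (vertex_list p); M = fold mutate_matrix ks (exchange_matrix p) in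
      distinct (vertex_list p) \<and> list_all (\<lambda>k. k < n) (u # v # w # ks) \<and> distinct [u, v, w] \<and>
      M ! u ! v \<ge> 3 \<and> M ! v ! w \<ge> 1 \<and> M ! w ! u \<le> M ! v ! w)"

lemma infinite_if_growth_certificate:
  assumes "growth_certificate p ks u v w"
  shows "\<not> finite_mutation_type (Q_Tsq (of_weights p))"
proof -
  let ?Q = "Q_Tsq (of_weights p)" and ?vs = "vertex_list p" and ?M = "fold mutate_matrix ks (exchange_matrix p)"
  have c: "distinct ?vs" "\<forall>k\<in>set ks. k < length ?vs" "u < length ?vs" "v < length ?vs" "w < length ?vs"
    "u \<noteq> v" "u \<noteq> w" "v \<noteq> w" "?M ! u ! v \<ge> 3" "?M ! v ! w \<ge> 1" "?M ! w ! u \<le> ?M ! v ! w"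
    using assms by (auto simp: growth_certificate_def Let_def list_all_iff)
  have V: "set ?vs = vertices ?Q" by (simp add: set_vertex_list Q_Tsq_def)
  obtain R where R: "reachable ?Q R" "represents ?vs R ?M"
    using represents_fold[OF is_quiver_Q_Tsq c(1) _ c(2) represents_exchange_matrix] V by auto
  have in_V: "?vs ! i \<in> vertices ?Q" if "i < length ?vs" for i using that V nth_mem by blast
  have n: "net R (?vs ! i) (?vs ! j) = ?M ! i ! j" if "i < length ?vs" "j < length ?vs" for i j
    using R(2) that by (simp add: represents_def)
  show ?thesis
    by (rule growing_triangle[OF is_quiver_Q_Tsq R(1) in_V[OF c(3)] in_V[OF c(4)], of "?vs ! w"])
      (use c in \<open>simp_all add: n nth_eq_iff_index_eq\<close>)
qed

text \<open>
  All arrow numbers of the minimal wild quivers are at most $2$, so the mutations first have to create a triple arrow.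
\<close>

lemma wild_22222: "growth_certificate [2,2,2,2,2] [5, 6, 2, 3, 4] 1 0 2"
  by code_simp

lemma wild_2223: "growth_certificate [2,2,2,3] [2, 3, 6, 4, 0, 1, 0] 1 5 0"
  by code_simp

lemma wild_334: "growth_certificate [3,3,4] [8, 3, 5, 7, 1, 2, 4, 0, 7, 1, 7] 6 1 7"
  by code_simp

lemma wild_245: "growth_certificate [2,4,5] [5, 9, 2, 0, 1, 8, 4, 0, 3, 1, 7, 0, 2, 0] 2 6 0"
  by code_simp

lemma wild_237: "growth_certificate [2,3,7] [10, 4, 2, 0, 1, 7, 9, 0, 8, 3, 2, 4, 0, 6, 1, 7, 2, 8, 2] 8 5 2"
  by code_simp

section \<open>Seeds ordered by phase\<close>

text \<open>
  The conditions on roots of one line are stated relative to a root \<open>w\<close> off the line. \<open>P\<close> and \<open>N\<close> are roots on the two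
  rays of the line. The three alternatives correspond to the possible phases of a member \<open>w\<close> of a seed relative to members
  \<open>P\<close> and \<open>N\<close>: before both rays, after both rays, or between them.
\<close>

definition separates :: "('a \<Rightarrow> 'a \<Rightarrow> int) \<Rightarrow> 'a \<Rightarrow> 'a set \<Rightarrow> 'a set \<Rightarrow> bool" where
  "separates \<chi> w P N \<longleftrightarrow>
     (\<forall>x\<in>P \<union> N. \<chi> w x = 0) \<or> (\<forall>x\<in>P \<union> N. \<chi> x w = 0) \<or>
     ((\<forall>x\<in>P. \<chi> x w = 0) \<and> (\<forall>x\<in>N. \<chi> w x = 0))"

text \<open>
  Two roots on a ray are never joined by extensions in both directions if some \<open>w\<close> is orthogonal to both on the same side: in
  a tube, \<open>w\<close> excludes families whose extensions form a full cycle of simple objects.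
\<close>

definition acyclic_at :: "('a \<Rightarrow> 'a \<Rightarrow> int) \<Rightarrow> ('a \<Rightarrow> 'a \<Rightarrow> int) \<Rightarrow> 'a \<Rightarrow> 'a \<Rightarrow> 'a \<Rightarrow> bool" where
  "acyclic_at \<chi> S w x y \<longleftrightarrow> (S x y = 0 \<longrightarrow> S w x * S w y > 0 \<longrightarrow>
     separates \<chi> w {x, y} {} \<longrightarrow> \<chi> x y < 0 \<longrightarrow> \<chi> y x < 0 \<longrightarrow> False)"

text \<open>
  What the tilt at \<open>k\<close> needs to know about two further members \<open>i\<close> and \<open>j\<close> on the line of \<open>k\<close>. The
  member \<open>i\<close> lies on the ray opposite to \<open>k\<close> and is replaced by \<open>i + b k\<close>, which may change its ray. The first clause
  treats \<open>j\<close> on the ray of \<open>k\<close>, with \<open>i\<close> moving onto this ray. The last two treat \<open>j\<close> on the ray of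
  \<open>i\<close>, with \<open>i\<close> moving while \<open>j\<close> stays, and with \<open>i\<close> staying. The sign of a product of two values of \<open>S w\<close>
  tells whether two vectors lie on the same ray.
\<close>

definition hereditary_at :: "('a \<Rightarrow> 'a \<Rightarrow> int) \<Rightarrow> ('a \<Rightarrow> 'a \<Rightarrow> int) \<Rightarrow> 'a \<Rightarrow> 'a \<Rightarrow> 'a \<Rightarrow> 'a \<Rightarrow> int \<Rightarrow> bool" where
  "hereditary_at \<chi> S w k i j b \<longleftrightarrow> (S k i = 0 \<longrightarrow> S k j = 0 \<longrightarrow>
     S w k * S w i < 0 \<longrightarrow> \<chi> k i = 0 \<longrightarrow> \<chi> i k = - b \<longrightarrow> b > 0 \<longrightarrow>
     (separates \<chi> w {k, j} {i} \<longrightarrow> S w k * S w j > 0 \<longrightarrow> \<chi> j k \<le> 0 \<longrightarrow> \<chi> k j \<le> 0 \<longrightarrow> \<chi> j i = 0 \<longrightarrow>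
        S w k * (S w i + b * S w k) > 0 \<longrightarrow> \<chi> i j + b * \<chi> k j \<le> 0) \<and>
     (separates \<chi> w {k} {i, j} \<longrightarrow> S w k * S w j < 0 \<longrightarrow> \<chi> k j = 0 \<longrightarrow> \<chi> i j \<le> 0 \<longrightarrow> \<chi> j i \<le> 0 \<longrightarrow>
        (S w k * (S w i + b * S w k) > 0 \<longrightarrow> S w k * (S w j + max 0 (- \<chi> j k) * S w k) < 0 \<longrightarrow> \<chi> i j = 0) \<and>
        (S w k * (S w i + b * S w k) < 0 \<longrightarrow> \<chi> j k \<ge> 0 \<longrightarrow> \<chi> j i + b * \<chi> j k \<le> 0)))"

definition rays_acyclic :: "('a \<Rightarrow> bool) \<Rightarrow> ('a \<Rightarrow> 'a \<Rightarrow> int) \<Rightarrow> ('a \<Rightarrow> 'a \<Rightarrow> int) \<Rightarrow> bool" where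
  "rays_acyclic R \<chi> S \<longleftrightarrow> (\<forall>w x y. R w \<longrightarrow> R x \<longrightarrow> R y \<longrightarrow> acyclic_at \<chi> S w x y)"

definition rays_hereditary :: "('a \<Rightarrow> bool) \<Rightarrow> ('a \<Rightarrow> 'a \<Rightarrow> int) \<Rightarrow> ('a \<Rightarrow> 'a \<Rightarrow> int) \<Rightarrow> bool" where
  "rays_hereditary R \<chi> S \<longleftrightarrow>
     (\<forall>w k i j b. R w \<longrightarrow> R k \<longrightarrow> R i \<longrightarrow> R j \<longrightarrow> hereditary_at \<chi> S w k i j b)"

text \<open>
  A form \<open>chi\<close> together with a charge \<open>(rk, deg)\<close> in the plane. The set \<open>V\<close> is only a carrier closed under the
  operation \<open>comb x a y\<close>, which stands for \<open>x + a y\<close>. The sign \<open>\<sigma>\<close> decides which of the two rays of rank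
  \<open>0\<close> belongs to the positive half-plane; both choices occur, because passing to the opposite form exchanges them
  (\<open>charged_lattice_op\<close>).
\<close>

locale charged_lattice =
  fixes V :: "'a set"
    and comb :: "'a \<Rightarrow> int \<Rightarrow> 'a \<Rightarrow> 'a"
    and chi :: "'a \<Rightarrow> 'a \<Rightarrow> int"
    and rk deg :: "'a \<Rightarrow> int"
    and \<sigma> :: int
  assumes comb_closed: "x \<in> V \<Longrightarrow> y \<in> V \<Longrightarrow> comb x a y \<in> V"
    and chi_left: "x \<in> V \<Longrightarrow> y \<in> V \<Longrightarrow> z \<in> V \<Longrightarrow> chi (comb x a y) z = chi x z + a * chi y z"
    and chi_right: "x \<in> V \<Longrightarrow> y \<in> V \<Longrightarrow> z \<in> V \<Longrightarrow> chi z (comb x a y) = chi z x + a * chi z y"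
    and rk_comb: "x \<in> V \<Longrightarrow> y \<in> V \<Longrightarrow> rk (comb x a y) = rk x + a * rk y"
    and deg_comb: "x \<in> V \<Longrightarrow> y \<in> V \<Longrightarrow> deg (comb x a y) = deg x + a * deg y"
    and sigma: "\<sigma> = 1 \<or> \<sigma> = -1"
    and chi_psd: "x \<in> V \<Longrightarrow> 0 \<le> chi x x"
    and charge_nonzero: "x \<in> V \<Longrightarrow> chi x x = 1 \<Longrightarrow> rk x \<noteq> 0 \<or> deg x \<noteq> 0"
    and stability: "x \<in> V \<Longrightarrow> y \<in> V \<Longrightarrow> chi x x = 1 \<Longrightarrow> chi y y = 1 \<Longrightarrow>
       rk x * deg y - rk y * deg x > 0 \<Longrightarrow> 0 \<le> chi x y"
    and acyclic: "rays_acyclic (\<lambda>x. x \<in> V \<and> chi x x = 1) chi (\<lambda>x y. rk x * deg y - rk y * deg x)"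
    and hereditary: "rays_hereditary (\<lambda>x. x \<in> V \<and> chi x x = 1) chi (\<lambda>x y. rk x * deg y - rk y * deg x)"
    and hereditary_op: "rays_hereditary (\<lambda>x. x \<in> V \<and> chi x x = 1) (\<lambda>x y. chi y x) (\<lambda>x y. rk x * deg y - rk y * deg x)"
begin

definition root :: "'a \<Rightarrow> bool" where "root x \<longleftrightarrow> x \<in> V \<and> chi x x = 1"

definition S :: "'a \<Rightarrow> 'a \<Rightarrow> int" where "S x y = rk x * deg y - rk y * deg x"

definition pos :: "'a \<Rightarrow> bool" where "pos x \<longleftrightarrow> rk x > 0 \<or> (rk x = 0 \<and> \<sigma> * deg x > 0)"

text \<open>
  The order by phase: the positive half-plane comes before the negative one, and \<open>S x y > 0\<close> says that the phase of \<open>x\<close> is smaller.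
\<close>

definition before :: "'a \<Rightarrow> 'a \<Rightarrow> bool" where
  "before x y \<longleftrightarrow> (pos x \<and> \<not> pos y) \<or> (pos x = pos y \<and> S x y > 0)"

definition same_ray :: "'a \<Rightarrow> 'a \<Rightarrow> bool" where
  "same_ray x y \<longleftrightarrow> pos x = pos y \<and> S x y = 0"

text \<open>
  The numerical shadow of a simple-minded collection of sheaves (positive members) and shifted sheaves (the others).
  The last conjunct excludes families contained in a single line, for which there would be no member \<open>w\<close> to play the role of
  a separating root.
\<close>

definition seed :: "'v set \<Rightarrow> ('v \<Rightarrow> 'a) \<Rightarrow> bool" where
  "seed I c \<longleftrightarrow> (\<forall>i\<in>I. root (c i)) \<and>
     (\<forall>i\<in>I. \<forall>j\<in>I. i \<noteq> j \<longrightarrow> (before (c i) (c j) \<longrightarrow> chi (c i) (c j) = 0) \<and>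
        (same_ray (c i) (c j) \<longrightarrow> chi (c i) (c j) \<le> 0)) \<and>
     (\<exists>i\<in>I. \<exists>j\<in>I. S (c i) (c j) \<noteq> 0)"

text \<open>
  Tilting at a positive \<open>k\<close>: the member \<open>k\<close> is shifted, and every member is extended by as many copies of \<open>k\<close> as it
  has extensions with \<open>k\<close>. The coefficient \<open>-2\<close> turns \<open>c k\<close> into its negative.
\<close>

definition tilt :: "'v \<Rightarrow> ('v \<Rightarrow> 'a) \<Rightarrow> 'v \<Rightarrow> 'a" where
  "tilt k c i = comb (c i) (if i = k then -2 else max 0 (- chi (c i) (c k))) (c k)"

definition form :: "'a \<Rightarrow> 'a \<Rightarrow> int" where "form x y = chi x y - chi y x"

lemma rootD: "root x \<Longrightarrow> x \<in> V" "root x \<Longrightarrow> chi x x = 1"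
  by (auto simp: root_def)

text \<open>
  The duality that exchanges positive and negative members. It reduces the tilt at a negative member to the tilt at a positive one.
\<close>

lemma charged_lattice_op:
  "charged_lattice V comb (\<lambda>x y. chi y x) (\<lambda>x. - rk x) deg (- \<sigma>)"
proof
  have S: "(\<lambda>x y. - rk x * deg y - - rk y * deg x) = (\<lambda>x y. - S x y)"
    by (auto simp: S_def fun_eq_iff)
  have acyc: "rays_acyclic R (\<lambda>x y. f y x) (\<lambda>x y. - g x y)" if "rays_acyclic R f g" for R f and g :: "'a \<Rightarrow> 'a \<Rightarrow> int"
    using that unfolding rays_acyclic_def acyclic_at_def separates_def by (simp; blast)
  have her: "rays_hereditary R f (\<lambda>x y. - g x y)" if "rays_hereditary R f g" for R f and g :: "'a \<Rightarrow> 'a \<Rightarrow> int"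
  proof -
    have 1: "- g w k * (- g w i + b * - g w k) = g w k * (g w i + b * g w k)" for w k i b
      by (simp add: algebra_simps)
    show ?thesis
      using that unfolding rays_hereditary_def hereditary_at_def 1 by simp
  qed
  show "rays_acyclic (\<lambda>x. x \<in> V \<and> chi x x = 1) (\<lambda>x y. chi y x) (\<lambda>x y. - rk x * deg y - - rk y * deg x)"
    unfolding S by (rule acyc) (use acyclic in \<open>simp add: S_def[abs_def]\<close>)
  show "rays_hereditary (\<lambda>x. x \<in> V \<and> chi x x = 1) (\<lambda>x y. chi y x) (\<lambda>x y. - rk x * deg y - - rk y * deg x)"
    unfolding S by (rule her) (use hereditary_op in \<open>simp add: S_def[abs_def]\<close>)
  show "rays_hereditary (\<lambda>x. x \<in> V \<and> chi x x = 1) (\<lambda>x y. chi x y) (\<lambda>x y. - rk x * deg y - - rk y * deg x)"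
    unfolding S by (rule her) (use hereditary in \<open>simp add: S_def[abs_def]\<close>)
qed (use sigma in \<open>auto simp: comb_closed chi_left chi_right rk_comb deg_comb chi_psd algebra_simps
       dest: charge_nonzero intro: stability\<close>)

lemma root_neg: "root x \<Longrightarrow> root (comb x (-2) x)"
  by (simp add: root_def comb_closed chi_left chi_right)

lemma stable: "root x \<Longrightarrow> root y \<Longrightarrow> S x y > 0 \<Longrightarrow> 0 \<le> chi x y"
  using stability by (simp add: root_def S_def)

lemma stable':
  assumes "root x" "root y" "S x y > 0"
  shows "chi y x \<le> 0"
proof -
  have "rk y * deg (comb x (-2) x) - rk (comb x (-2) x) * deg y > 0"
    using assms by (simp add: root_def S_def rk_comb deg_comb algebra_simps)
  from stability[OF _ _ _ _ this] root_neg[OF assms(1)] show ?thesis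
    using assms by (simp add: root_def chi_right)
qed

text \<open>
  Semidefiniteness on \<open>x + y\<close> and \<open>x - y\<close>.
\<close>

lemma abs_sum_le_2: "root x \<Longrightarrow> root y \<Longrightarrow> \<bar>chi x y + chi y x\<bar> \<le> 2"
  using chi_psd[of "comb x 1 y"] chi_psd[of "comb x (-1) y"]
  by (simp add: root_def comb_closed chi_left chi_right)

lemma S_comb: "x \<in> V \<Longrightarrow> y \<in> V \<Longrightarrow> S (comb x a y) z = S x z + a * S y z"
   "x \<in> V \<Longrightarrow> y \<in> V \<Longrightarrow> S z (comb x a y) = S z x + a * S z y"
  by (simp_all add: S_def rk_comb deg_comb algebra_simps)

lemma S_skew: "S y x = - S x y" by (simp add: S_def)
lemma S_self[simp]: "S x x = 0" by (simp add: S_def)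

definition upper :: "int \<Rightarrow> int \<Rightarrow> bool" where "upper r d \<longleftrightarrow> r > 0 \<or> (r = 0 \<and> \<sigma> * d > 0)"

lemma upper_add: "upper r d \<Longrightarrow> upper r' d' \<Longrightarrow> upper (r + r') (d + d')"
  using sigma by (auto simp: upper_def)

lemma upper_scale: "a > 0 \<Longrightarrow> upper r d \<Longrightarrow> upper (a * r) (a * d)"
  using sigma by (auto simp: upper_def zero_less_mult_iff mult_less_0_iff)

lemma upper_zero: "\<not> upper 0 0" by (simp add: upper_def)

lemma upper_neg: "r \<noteq> 0 \<or> d \<noteq> 0 \<Longrightarrow> upper (- r) (- d) \<longleftrightarrow> \<not> upper r d"
  using sigma by (auto simp: upper_def)

lemma pos_upper: "pos x \<longleftrightarrow> upper (rk x) (deg x)" by (simp add: pos_def upper_def)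

lemma root_charge: "root x \<Longrightarrow> rk x \<noteq> 0 \<or> deg x \<noteq> 0"
  using charge_nonzero by (auto simp: root_def)

text \<open>
  The circle of phases is cut at the boundary of the positive half-plane and divided by the line through a positive \<open>k\<close>:
  before the ray of \<open>k\<close> (\<open>0\<close>), on this ray (\<open>1\<close>), in the open half-plane that follows (\<open>2\<close>), on the opposite ray
  (\<open>3\<close>), and behind it (\<open>4\<close>). The order by phase is the order by level, refined by \<open>S\<close> within a level
  (\<open>level_order\<close>). In these terms the tilt at \<open>k\<close> is easy to follow: it changes only members of
  level \<open>1\<close>, \<open>2\<close> and \<open>3\<close>, and the levels only of \<open>k\<close> itself (from \<open>1\<close> to \<open>3\<close>) and of some members of level \<open>3\<close> (to
  \<open>1\<close>).
\<close>

definition level :: "'a \<Rightarrow> 'a \<Rightarrow> nat" where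
  "level k x = (if S k x = 0 then (if pos x then 1 else 3)
     else if S k x > 0 then 2 else if pos x then 0 else 4)"

text \<open>
  The charges of \<open>k\<close>, \<open>x\<close>, \<open>y\<close> lie in a plane, so they satisfy the linear relation
  \<open>S x y k = S k y x - S k x y\<close>. For a positive \<open>k\<close>, the sign of \<open>S x y\<close> can therefore be read off from the half-plane in which
  the right-hand side lies.
\<close>

lemma S_pos_iff_upper:
  assumes "pos k"
  shows "S x y > 0 \<longleftrightarrow> upper (S k y * rk x + - S k x * rk y) (S k y * deg x + - S k x * deg y)"
    and "S x y = 0 \<longleftrightarrow> S k y * rk x + - S k x * rk y = 0 \<and> S k y * deg x + - S k x * deg y = 0"
proof -
  have e: "S k y * rk x + - S k x * rk y = S x y * rk k" "S k y * deg x + - S k x * deg y = S x y * deg k"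
    by (simp_all add: S_def algebra_simps)
  have k: "upper (rk k) (deg k)" "rk k \<noteq> 0 \<or> deg k \<noteq> 0"
    using assms sigma by (auto simp: pos_upper upper_def)
  consider "S x y > 0" | "S x y = 0" | "S x y < 0" by linarith
  then show "S x y > 0 \<longleftrightarrow> upper (S k y * rk x + - S k x * rk y) (S k y * deg x + - S k x * deg y)"
  proof cases
    case 3
    then have "upper (- S x y * rk k) (- S x y * deg k)" by (intro upper_scale k) simp
    then have "\<not> upper (S x y * rk k) (S x y * deg k)"
      using upper_neg[of "S x y * rk k" "S x y * deg k"] k 3 by auto
    with 3 show ?thesis unfolding e by simp
  qed (use k in \<open>simp_all add: e upper_scale upper_zero del: mult_minus_left\<close>)
  show "S x y = 0 \<longleftrightarrow> S k y * rk x + - S k x * rk y = 0 \<and> S k y * deg x + - S k x * deg y = 0"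
    unfolding e using k by auto
qed

lemma upper_comb:
  assumes "a \<noteq> 0 \<Longrightarrow> upper r d \<longleftrightarrow> a > 0" "b \<noteq> 0 \<Longrightarrow> upper r' d' \<longleftrightarrow> b > 0" "a \<noteq> 0 \<or> b \<noteq> 0"
    "r \<noteq> 0 \<or> d \<noteq> 0" "r' \<noteq> 0 \<or> d' \<noteq> 0"
  shows "upper (a * r + b * r') (a * d + b * d')"
proof -
  have 1: "a \<noteq> 0 \<Longrightarrow> upper (a * r) (a * d)"
    using upper_scale[of a r d] upper_scale[of "-a" "-r" "-d"] upper_neg[of r d] assms by force
  have 2: "b \<noteq> 0 \<Longrightarrow> upper (b * r') (b * d')"
    using upper_scale[of b r' d'] upper_scale[of "-b" "-r'" "-d'"] upper_neg[of r' d'] assms by force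
  show ?thesis
    using 1 2 upper_add[of "a * r" "a * d" "b * r'" "b * d'"] assms(3)
    by (cases "a = 0"; cases "b = 0") auto
qed

lemma upper_mult:
  assumes "r \<noteq> 0 \<or> d \<noteq> 0"
  shows "upper (a * r) (a * d) \<longleftrightarrow> (if upper r d then a > 0 else a < 0)"
proof -
  consider "a > 0" | "a = 0" | "a < 0" by linarith
  then show ?thesis
  proof cases
    case 1
    then show ?thesis
      using upper_scale[of a r d] upper_scale[of a "-r" "-d"] upper_neg[of r d] upper_neg[of "a * r" "a * d"] assms
      by auto
  next
    case 3
    then show ?thesis
      using upper_scale[of "-a" r d] upper_scale[of "-a" "-r" "-d"] upper_neg[of r d] upper_neg[of "a * r" "a * d"] assms
      by auto
  qed (simp add: upper_zero)
qed

text \<open>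
  On the line of \<open>k\<close>, the two rays are distinguished by any \<open>w\<close> off the line.
\<close>

lemma ray_sign:
  assumes k: "pos k" and x: "root x" and line: "S k x = 0" and off: "S w k \<noteq> 0"
  shows "S w k * S w x > 0 \<longleftrightarrow> pos x" and "S w k * S w x < 0 \<longleftrightarrow> \<not> pos x"
proof -
  have "S w k * rk x - S w x * rk k = - S k x * rk w" "S w k * deg x - S w x * deg k = - S k x * deg w"
    by (simp_all add: S_def algebra_simps)
  with line have e: "S w k * rk x = S w x * rk k" "S w k * deg x = S w x * deg k"
    by simp_all
  have k': "upper (rk k) (deg k)" "rk k \<noteq> 0 \<or> deg k \<noteq> 0"
    using k by (auto simp: pos_upper upper_def)
  have "(if pos x then S w k > 0 else S w k < 0) \<longleftrightarrow> S w x > 0"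
    using upper_mult[OF root_charge[OF x], of "S w k"] upper_mult[OF k'(2), of "S w x"] k'
    by (simp add: pos_upper e)
  moreover have "S w x \<noteq> 0" using e off root_charge[OF x] by auto
  ultimately show "S w k * S w x > 0 \<longleftrightarrow> pos x" and "S w k * S w x < 0 \<longleftrightarrow> \<not> pos x"
    using off by (auto simp: zero_less_mult_iff mult_less_0_iff split: if_splits)
qed

lemma level_order:
  assumes k: "pos k" and x: "root x" and y: "root y"
  shows "before x y \<longleftrightarrow> level k x < level k y \<or> (level k x = level k y \<and> S x y > 0)"
    and "same_ray x y \<longleftrightarrow> level k x = level k y \<and> S x y = 0"
proof -
  have px: "upper (rk x) (deg x) = pos x" and py: "upper (rk y) (deg y) = pos y"
    by (simp_all add: pos_upper)
  note zx = root_charge[OF x] and zy = root_charge[OF y]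
  have 1: "S x y > 0" if "S k y \<noteq> 0 \<Longrightarrow> pos x \<longleftrightarrow> S k y > 0" "S k x \<noteq> 0 \<Longrightarrow> pos y \<longleftrightarrow> - S k x > 0" "S k y \<noteq> 0 \<or> S k x \<noteq> 0"
    unfolding S_pos_iff_upper(1)[OF k]
    by (rule upper_comb) (use that px py zx zy in auto)
  have 2: "S y x > 0" if "S k x \<noteq> 0 \<Longrightarrow> pos y \<longleftrightarrow> S k x > 0" "S k y \<noteq> 0 \<Longrightarrow> pos x \<longleftrightarrow> - S k y > 0" "S k y \<noteq> 0 \<or> S k x \<noteq> 0"
    unfolding S_pos_iff_upper(1)[OF k]
    by (rule upper_comb) (use that px py zx zy in auto)
  have 3: "S x y = 0" if "S k x = 0" "S k y = 0"
    unfolding S_pos_iff_upper(2)[OF k] using that by simp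
  have 4: "S y x = - S x y" by (rule S_skew)
  consider "S k x > 0" | "S k x = 0" | "S k x < 0" by linarith
  note X = this
  consider "S k y > 0" | "S k y = 0" | "S k y < 0" by linarith
  note Y = this
  show "before x y \<longleftrightarrow> level k x < level k y \<or> (level k x = level k y \<and> S x y > 0)"
    by (rule X; rule Y; cases "pos x"; cases "pos y")
       (use 1 2 3 4 in \<open>simp_all add: before_def level_def\<close>)
  show "same_ray x y \<longleftrightarrow> level k x = level k y \<and> S x y = 0"
    by (rule X; rule Y; cases "pos x"; cases "pos y")
       (use 1 2 3 4 in \<open>simp_all add: same_ray_def level_def\<close>)
qed

context
  fixes I :: "'v set" and c k
  assumes seed: "seed I c" and k: "k \<in> I" and pos_k: "pos (c k)"
begin

abbreviation "lv i \<equiv> level (c k) (c i)"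
abbreviation "h i \<equiv> S (c k) (c i)"
abbreviation "a i \<equiv> (if i = k then -2 else max 0 (- chi (c i) (c k)))"
abbreviation "c' \<equiv> tilt k c"

lemma roots: "i \<in> I \<Longrightarrow> root (c i)" using seed by (simp add: seed_def)

lemma inV: "i \<in> I \<Longrightarrow> c i \<in> V" using roots rootD by blast

lemma chi_zero: "i \<in> I \<Longrightarrow> j \<in> I \<Longrightarrow> lv i < lv j \<Longrightarrow> chi (c i) (c j) = 0"
  using seed level_order(1)[OF pos_k roots roots, of i j] by (cases "i = j") (auto simp: seed_def)

lemma chi_zero_S: "i \<in> I \<Longrightarrow> j \<in> I \<Longrightarrow> lv i = lv j \<Longrightarrow> S (c i) (c j) > 0 \<Longrightarrow> chi (c i) (c j) = 0"
  using seed level_order(1)[OF pos_k roots roots, of i j] by (cases "i = j") (auto simp: seed_def)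

lemma chi_ray: "i \<in> I \<Longrightarrow> j \<in> I \<Longrightarrow> i \<noteq> j \<Longrightarrow> lv i = lv j \<Longrightarrow> S (c i) (c j) = 0 \<Longrightarrow> chi (c i) (c j) \<le> 0"
  using seed level_order(2)[OF pos_k roots roots, of i j] by (auto simp: seed_def)

lemma level_self: "lv k = 1" using pos_k by (simp add: level_def)

lemma S_level: "lv i \<in> {1, 3} \<longleftrightarrow> h i = 0" "lv i = 2 \<longleftrightarrow> h i > 0" "lv i \<in> {0, 4} \<longleftrightarrow> h i < 0"
  by (auto simp: level_def)

lemma on_line:
  assumes "i \<in> I" "j \<in> I" "h i = 0" "h j = 0" shows "S (c i) (c j) = 0"
  unfolding S_pos_iff_upper(2)[OF pos_k] using assms by simp

text \<open>
  The possible extensions between \<open>k\<close> and the other members. The vanishing statements and the signs at level \<open>1\<close>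
  come from the definition of a seed, the signs at the levels \<open>2\<close> and \<open>4\<close> from stability.
\<close>

lemma coeff:
  assumes i: "i \<in> I" "i \<noteq> k"
  shows "lv i = 0 \<Longrightarrow> chi (c i) (c k) = 0" "lv i = 1 \<Longrightarrow> chi (c i) (c k) \<le> 0 \<and> chi (c k) (c i) \<le> 0"
    "lv i = 2 \<Longrightarrow> chi (c i) (c k) \<le> 0" "lv i = 4 \<Longrightarrow> chi (c i) (c k) \<ge> 0"
    "lv i > 1 \<Longrightarrow> chi (c k) (c i) = 0"
proof -
  show "chi (c i) (c k) = 0" if "lv i = 0" using chi_zero[OF i(1) k] that level_self by simp
  show "chi (c k) (c i) = 0" if "lv i > 1" using chi_zero[OF k i(1)] that level_self by simp
  show "chi (c i) (c k) \<le> 0 \<and> chi (c k) (c i) \<le> 0" if "lv i = 1"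
  proof -
    have "h i = 0" using that S_level(1)[of i] by simp
    then show ?thesis using chi_ray[OF i(1) k i(2)] chi_ray[OF k i(1)] i that level_self S_skew[of "c k" "c i"]
      by simp
  qed
  show "chi (c i) (c k) \<le> 0" if "lv i = 2"
    using stable'[OF roots[OF k] roots[OF i(1)]] that S_level(2)[of i] by simp
  show "chi (c i) (c k) \<ge> 0" if "lv i = 4"
    using stable[OF roots[OF i(1)] roots[OF k]] that S_level(3)[of i] S_skew[of "c k" "c i"] by simp
qed

lemma level_le: "lv i \<le> 4" by (simp add: level_def)

lemma tilt_eq: "c' i = comb (c i) (a i) (c k)" by (simp add: tilt_def)

lemma tilt_V: "i \<in> I \<Longrightarrow> c' i \<in> V" by (simp add: tilt_eq inV k comb_closed del: max.absorb1)

lemma chi_tilt: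
  assumes "i \<in> I" "j \<in> I"
  shows "chi (c' i) (c' j) = chi (c i) (c j) + a i * chi (c k) (c j) + a j * (chi (c i) (c k) + a i)"
  using assms by (simp add: tilt_eq chi_left chi_right inV k comb_closed rootD(2)[OF roots] algebra_simps del: max.absorb1)

lemma S_tilt: "i \<in> I \<Longrightarrow> S (c k) (c' i) = h i"
  by (simp add: tilt_eq S_comb inV k)

lemma coeff_le: "i \<in> I \<Longrightarrow> i \<noteq> k \<Longrightarrow> lv i \<in> {0, 4} \<Longrightarrow> a i = 0"
  using coeff(1,4)[of i] by auto

lemma coeff_reflect: "i \<in> I \<Longrightarrow> i \<noteq> k \<Longrightarrow> lv i \<in> {1, 2} \<Longrightarrow> chi (c i) (c k) + a i = 0"
  using coeff(2,3)[of i] by auto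

text \<open>
  Every seed has a member off the line of \<open>k\<close>, and its phase decides which alternative of \<open>separates\<close> holds for all
  members on the line simultaneously.
\<close>

lemma witness:
  obtains w where "w \<in> I" "S (c w) (c k) \<noteq> 0"
    "\<And>P N. P \<subseteq> {i \<in> I. lv i = 1} \<Longrightarrow> N \<subseteq> {i \<in> I. lv i = 3} \<Longrightarrow> separates chi (c w) (c ` P) (c ` N)"
proof -
  have "\<exists>w\<in>I. h w \<noteq> 0"
  proof (rule ccontr)
    assume "\<not> ?thesis"
    then have "S (c i) (c j) = 0" if "i \<in> I" "j \<in> I" for i j using on_line that by blast
    then show False using seed by (auto simp: seed_def)
  qed
  then obtain w where w: "w \<in> I" "h w \<noteq> 0" by blast
  show ?thesis
  proof (rule that[OF w(1)])
    show "S (c w) (c k) \<noteq> 0" using w S_skew[of "c k" "c w"] by simp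
    fix P N assume PN: "P \<subseteq> {i \<in> I. lv i = 1}" "N \<subseteq> {i \<in> I. lv i = 3}"
    have "lv w = 0 \<or> lv w = 2 \<or> lv w = 4" using w by (simp add: level_def)
    then show "separates chi (c w) (c ` P) (c ` N)"
      using chi_zero[OF w(1)] chi_zero[OF _ w(1)] PN unfolding separates_def
      by (auto simp: subset_iff)
  qed
qed

text \<open>
  This makes the tilted vectors roots again: \<open>x + a k\<close> with \<open>a = - chi x k\<close> has norm \<open>1 + a chi k x\<close>.
\<close>

lemma no_two_cycle:
  assumes i: "i \<in> I" "i \<noteq> k" and neg: "chi (c i) (c k) < 0"
  shows "chi (c k) (c i) = 0"
proof -
  have "lv i \<noteq> 0" "lv i > 1 \<Longrightarrow> ?thesis" using coeff(1,5)[OF i] neg by auto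
  moreover have ?thesis if l: "lv i = 1"
  proof -
    obtain w where w: "w \<in> I" "S (c w) (c k) \<noteq> 0" "separates chi (c w) (c ` {i, k}) (c ` {})"
    proof (rule witness)
      fix w
      assume w: "w \<in> I" "S (c w) (c k) \<noteq> 0"
        and "\<And>P N. P \<subseteq> {i \<in> I. lv i = 1} \<Longrightarrow> N \<subseteq> {i \<in> I. lv i = 3} \<Longrightarrow> separates chi (c w) (c ` P) (c ` N)"
      from this(3)[of "{i, k}" "{}"] w show thesis using i k l level_self by (intro that[of w]) auto
    qed
    have hi: "h i = 0" "pos (c i)" using l by (auto simp: level_def split: if_splits)
    have "S (c w) (c i) * S (c w) (c k) > 0"
      using ray_sign(1)[OF pos_k roots[OF i(1)] hi(1) w(2)] hi by (simp add: mult.commute)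
    then have "\<not> chi (c k) (c i) < 0"
      using acyclic[unfolded rays_acyclic_def acyclic_at_def, folded root_def S_def, rule_format, OF roots[OF w(1)] roots[OF i(1)] roots[OF k]]
        w(3) neg hi S_skew[of "c k" "c i"] by auto
    then show ?thesis using coeff(2)[OF i l] by simp
  qed
  ultimately show ?thesis using level_le[of i] by linarith
qed

lemma tilt_root:
  assumes i: "i \<in> I" shows "root (c' i)"
proof -
  have "chi (c' i) (c' i) = 1"
  proof (cases "i = k \<or> a i = 0")
    case True
    then show ?thesis using chi_tilt[OF i i] rootD(2)[OF roots] i k by auto
  next
    case False
    then have "chi (c i) (c k) < 0" by auto
    then show ?thesis using chi_tilt[OF i i] rootD(2)[OF roots] i k no_two_cycle[OF i] False by simp
  qed
  then show ?thesis using tilt_V[OF i] by (simp add: root_def)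
qed

text \<open>
  The coefficient of the tilt only involves the sign of \<open>chi x k\<close>, but it equals the one prescribed by the exchange form, because
  \<open>chi k x\<close> vanishes whenever it could interfere.
\<close>

lemma coeff_form: "i \<in> I \<Longrightarrow> i \<noteq> k \<Longrightarrow> a i = max 0 (- form (c i) (c k))"
proof -
  assume i: "i \<in> I" "i \<noteq> k"
  consider "lv i = 0" | "lv i = 1" | "lv i > 1" by linarith
  then show ?thesis
  proof cases
    case 1
    then have "h i < 0" using S_level(3)[of i] by simp
    then have "chi (c k) (c i) \<le> 0"
      using stable'[OF roots[OF i(1)] roots[OF k]] S_skew[of "c i" "c k"] by simp
    then show ?thesis using coeff(1)[OF i 1] i by (simp add: form_def)
  next
    case 2
    then show ?thesis using coeff(2)[OF i] no_two_cycle[OF i] i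
      by (cases "chi (c i) (c k) = 0") (simp_all add: form_def)
  qed (use coeff(5)[OF i] i in \<open>simp add: form_def\<close>)
qed

lemma tilt_level:
  assumes i: "i \<in> I"
  shows "i = k \<Longrightarrow> level (c k) (c' i) = 3"
    "i \<noteq> k \<Longrightarrow> lv i \<noteq> 3 \<Longrightarrow> level (c k) (c' i) = lv i"
    "lv i = 3 \<Longrightarrow> level (c k) (c' i) = 3 \<or> (level (c k) (c' i) = 1 \<and> a i > 0)"
proof -
  obtain w where w: "w \<in> I" "S (c w) (c k) \<noteq> 0" by (rule witness)
  let ?s = "S (c w) (c k)"
  have sgn: "h i = 0 \<Longrightarrow> ?s * S (c w) (c' i) > 0 \<longleftrightarrow> pos (c' i)"
    "h i = 0 \<Longrightarrow> ?s * S (c w) (c i) > 0 \<longleftrightarrow> pos (c i)"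
    using ray_sign(1)[OF pos_k tilt_root[OF i] _ w(2)] ray_sign(1)[OF pos_k roots[OF i] _ w(2)]
    by (simp_all add: S_tilt[OF i])
  have S': "?s * S (c w) (c' i) = ?s * S (c w) (c i) + a i * (?s * ?s)"
    using i k by (simp add: tilt_eq S_comb inV algebra_simps)
  have sq: "?s * ?s > 0" using w(2) zero_le_square[of ?s] by (metis less_le mult_eq_0_iff)
  show "level (c k) (c' i) = 3" if "i = k"
  proof -
    have "\<not> pos (c' i)" using sgn(1) S' sq that by (simp only: if_True) auto
    then show ?thesis using S_tilt[OF i] that by (simp add: level_def)
  qed
  show "level (c k) (c' i) = lv i" if n: "i \<noteq> k" "lv i \<noteq> 3"
  proof (cases "lv i = 1")
    case True
    then have "h i = 0" "pos (c i)" by (auto simp: level_def split: if_splits)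
    moreover have "a i \<ge> 0" using n by simp
    then have "a i * (?s * ?s) \<ge> 0" using mult_nonneg_nonneg[OF _ less_imp_le[OF sq]] by blast
    ultimately have "pos (c' i)" using sgn S' by linarith
    then show ?thesis using \<open>h i = 0\<close> S_tilt[OF i] True by (simp add: level_def)
  next
    case False
    show ?thesis
    proof (cases "lv i = 2")
      case True
      then show ?thesis using S_level(2)[of i] S_tilt[OF i] by (simp add: level_def)
    next
      case F: False
      then have "lv i \<in> {0, 4}" using False n level_le[of i] by auto
      then have "a i = 0" using coeff_le[OF i n(1)] by simp
      moreover have "h i \<noteq> 0" using S_level(1)[of i] False n by auto
      ultimately have "rk (c' i) = rk (c i)" "deg (c' i) = deg (c i)"
        using i k by (simp_all add: tilt_eq rk_comb deg_comb inV)
      then show ?thesis by (simp add: level_def pos_def S_def)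
    qed
  qed
  show "level (c k) (c' i) = 3 \<or> (level (c k) (c' i) = 1 \<and> a i > 0)" if "lv i = 3"
  proof -
    have h: "h i = 0" "\<not> pos (c i)" using that by (auto simp: level_def split: if_splits)
    then have "pos (c' i) \<Longrightarrow> a i > 0" using sgn S' sq by (smt (verit) mult_nonneg_nonpos2)
    then show ?thesis using S_tilt[OF i] h by (auto simp: level_def)
  qed
qed

abbreviation "lv' i \<equiv> level (c k) (c' i)"

lemma reflect_reduces:
  assumes i: "i \<in> I" "i \<noteq> k" and "lv i \<in> {1, 2} \<or> a i > 0"
  shows "chi (c i) (c k) + a i = 0"
  using assms coeff_reflect[OF i] by (auto simp: max_def split: if_splits)

lemma chi_tilt_k:
  assumes "i \<in> I" shows "chi (c' i) (c' k) = - (chi (c i) (c k) + a i)"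
    and "chi (c' k) (c' i) = - chi (c k) (c i) - (if i = k then -2 else a i)"
  using chi_tilt[OF assms k] chi_tilt[OF k assms] rootD(2)[OF roots[OF k]] by (simp_all)

text \<open>
  The following lemmas translate levels into the vocabulary of \<open>hereditary_at\<close>.
\<close>

lemma ray_witness:
  obtains w where "w \<in> I" "S (c w) (c k) \<noteq> 0"
    "\<And>i j. i \<in> I \<Longrightarrow> j \<in> I \<Longrightarrow> lv i = 3 \<Longrightarrow> lv j = 1 \<Longrightarrow> separates chi (c w) {c k, c j} {c i}"
    "\<And>i j. i \<in> I \<Longrightarrow> j \<in> I \<Longrightarrow> lv i = 3 \<Longrightarrow> lv j = 3 \<Longrightarrow> separates chi (c w) {c k} {c i, c j}"
proof (rule witness)
  fix w
  assume w: "w \<in> I" "S (c w) (c k) \<noteq> 0"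
    and s: "\<And>P N. P \<subseteq> {i \<in> I. lv i = 1} \<Longrightarrow> N \<subseteq> {i \<in> I. lv i = 3} \<Longrightarrow> separates chi (c w) (c ` P) (c ` N)"
  show thesis
  proof (rule that[OF w])
    fix i j assume ij: "i \<in> I" "j \<in> I" "lv i = 3"
    show "separates chi (c w) {c k, c j} {c i}" if "lv j = 1"
      using s[of "{k, j}" "{i}"] ij that k level_self by simp
    show "separates chi (c w) {c k} {c i, c j}" if "lv j = 3"
      using s[of "{k}" "{i, j}"] ij that k level_self by simp
  qed
qed

lemma ray_sides:
  assumes "S (c w) (c k) \<noteq> 0" "w \<in> I" "i \<in> I"
  shows "lv i = 1 \<Longrightarrow> S (c w) (c k) * S (c w) (c i) > 0"
    "lv i = 3 \<Longrightarrow> S (c w) (c k) * S (c w) (c i) < 0"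
    "lv' i = 1 \<Longrightarrow> S (c w) (c k) * (S (c w) (c i) + a i * S (c w) (c k)) > 0"
    "lv' i = 3 \<Longrightarrow> S (c w) (c k) * (S (c w) (c i) + a i * S (c w) (c k)) < 0"
proof -
  have e: "S (c w) (c i) + a i * S (c w) (c k) = S (c w) (c' i)"
    using assms k by (simp add: tilt_eq S_comb inV)
  show "lv i = 1 \<Longrightarrow> S (c w) (c k) * S (c w) (c i) > 0"
    "lv i = 3 \<Longrightarrow> S (c w) (c k) * S (c w) (c i) < 0"
    using ray_sign[OF pos_k roots[OF assms(3)] _ assms(1)] by (auto simp: level_def split: if_splits)
  show "lv' i = 1 \<Longrightarrow> S (c w) (c k) * (S (c w) (c i) + a i * S (c w) (c k)) > 0"
    "lv' i = 3 \<Longrightarrow> S (c w) (c k) * (S (c w) (c i) + a i * S (c w) (c k)) < 0"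
    unfolding e
    using ray_sign[OF pos_k tilt_root[OF assms(3)] _ assms(1)] by (auto simp: level_def split: if_splits)
qed

lemma ray_hereditary:
  assumes i: "i \<in> I" "lv i = 3" "a i > 0" and j: "j \<in> I" "j \<noteq> k" "j \<noteq> i"
  shows "lv j = 1 \<Longrightarrow> lv' i = 1 \<Longrightarrow> chi (c i) (c j) + a i * chi (c k) (c j) \<le> 0"
    and "lv j = 3 \<Longrightarrow> lv' i = 1 \<Longrightarrow> lv' j = 3 \<Longrightarrow> chi (c i) (c j) = 0"
    and "lv j = 3 \<Longrightarrow> lv' i = 3 \<Longrightarrow> chi (c j) (c k) \<ge> 0 \<Longrightarrow> chi (c j) (c i) + a i * chi (c j) (c k) \<le> 0"
proof -
  obtain w where w: "w \<in> I" "S (c w) (c k) \<noteq> 0"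
    "lv j = 1 \<Longrightarrow> separates chi (c w) {c k, c j} {c i}"
    "lv j = 3 \<Longrightarrow> separates chi (c w) {c k} {c i, c j}"
  proof (rule ray_witness)
    fix w assume "w \<in> I" "S (c w) (c k) \<noteq> 0"
      "\<And>i j. i \<in> I \<Longrightarrow> j \<in> I \<Longrightarrow> lv i = 3 \<Longrightarrow> lv j = 1 \<Longrightarrow> separates chi (c w) {c k, c j} {c i}"
      "\<And>i j. i \<in> I \<Longrightarrow> j \<in> I \<Longrightarrow> lv i = 3 \<Longrightarrow> lv j = 3 \<Longrightarrow> separates chi (c w) {c k} {c i, c j}"
    then show thesis using that i j by blast
  qed
  have ik: "i \<noteq> k" using i level_self by auto
  have hi: "h i = 0" using i by (simp add: level_def split: if_splits)
  have ki: "chi (c k) (c i) = 0" using coeff(5)[OF i(1) ik] i by simp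
  have ai: "chi (c i) (c k) = - a i" using i ik by (auto simp: max_def split: if_splits)
  note H = hereditary[unfolded rays_hereditary_def hereditary_at_def, folded root_def S_def, rule_format,
      OF roots[OF w(1)] roots[OF k] roots[OF i(1)] roots[OF j(1)] hi _ ray_sides(2)[OF w(2,1) i(1,2)] ki ai i(3)]
  have hj: "lv j \<in> {1, 3} \<Longrightarrow> h j = 0" by (simp add: level_def split: if_splits)
  show "chi (c i) (c j) + a i * chi (c k) (c j) \<le> 0" if l: "lv j = 1" "lv' i = 1"
  proof -
    have "chi (c j) (c i) = 0" using chi_zero[OF j(1) i(1)] l i by simp
    then show ?thesis
      using H hj l w(3) ray_sides(1)[OF w(2,1) j(1) l(1)] coeff(2)[OF j(1,2) l(1)]
        ray_sides(3)[OF w(2,1) i(1) l(2)] by blast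
  qed
  have r: "lv j = 3 \<Longrightarrow> chi (c i) (c j) \<le> 0 \<and> chi (c j) (c i) \<le> 0"
    using chi_ray[OF i(1) j(1)] chi_ray[OF j(1) i(1)] on_line[OF i(1) j(1) hi] on_line[OF j(1) i(1)] hi hj i j by auto
  have kj: "lv j = 3 \<Longrightarrow> chi (c k) (c j) = 0" using coeff(5)[OF j(1,2)] by simp
  show "chi (c i) (c j) = 0" if l: "lv j = 3" "lv' i = 1" "lv' j = 3"
    using H hj l w(4) ray_sides(2)[OF w(2,1) j(1) l(1)] kj r
        ray_sides(3)[OF w(2,1) i(1) l(2)] ray_sides(4)[OF w(2,1) j(1) l(3)] j(2) by auto
  show "chi (c j) (c i) + a i * chi (c j) (c k) \<le> 0" if l: "lv j = 3" "lv' i = 3" "chi (c j) (c k) \<ge> 0"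
    using H hj l w(4) ray_sides(2)[OF w(2,1) j(1) l(1)] kj r
        ray_sides(4)[OF w(2,1) i(1) l(2)] by auto
qed

lemma parallel_S:
  assumes "root x" "S (c k) x = 0" "S (c k) y > 0"
  shows "pos x \<Longrightarrow> S x y > 0" "\<not> pos x \<Longrightarrow> S y x > 0"
proof -
  have "S x y > 0 \<longleftrightarrow> pos x"
    unfolding S_pos_iff_upper(1)[OF pos_k, of x y] using assms upper_mult[OF root_charge[OF assms(1)]]
    by (simp add: pos_upper)
  moreover have "S y x > 0 \<longleftrightarrow> \<not> pos x"
    unfolding S_pos_iff_upper(1)[OF pos_k, of y x] using assms
      upper_mult[OF root_charge[OF assms(1)], of "- S (c k) y"] by (simp add: pos_upper)
  ultimately show "pos x \<Longrightarrow> S x y > 0" "\<not> pos x \<Longrightarrow> S y x > 0" by blast+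
qed

lemma chi_upper_nonpos:
  assumes "i \<in> I" "j \<in> I" "i \<noteq> j" "lv i = lv j"
  shows "S (c i) (c j) \<ge> 0 \<Longrightarrow> chi (c i) (c j) \<le> 0" "lv i = 2 \<Longrightarrow> chi (c i) (c j) \<le> 0"
proof -
  show 1: "S (c i) (c j) \<ge> 0 \<Longrightarrow> chi (c i) (c j) \<le> 0"
    using chi_zero_S[of i j] chi_ray[of i j] assms by fastforce
  show "lv i = 2 \<Longrightarrow> chi (c i) (c j) \<le> 0"
    using 1 stable'[OF roots[OF assms(2)] roots[OF assms(1)]] S_skew[of "c i" "c j"] by linarith
qed

lemma unchanged_charge:
  assumes "i \<in> I" "j \<in> I" "i \<noteq> k" "j \<noteq> k" "a i = 0" "a j = 0"
  shows "S (c' i) (c' j) = S (c i) (c j)"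
  using assms k by (simp add: tilt_eq S_comb inV comb_closed del: max.absorb1)

lemma tilt_level_cases:
  assumes "i \<in> I" "i \<noteq> k"
  shows "lv' i = 0 \<Longrightarrow> lv i = 0" "lv' i = 2 \<Longrightarrow> lv i = 2" "lv' i = 4 \<Longrightarrow> lv i = 4" "lv' i = 3 \<Longrightarrow> lv i = 3"
    "lv' i = 1 \<Longrightarrow> lv i = 1 \<or> (lv i = 3 \<and> a i > 0)"
  using tilt_level(2,3)[OF assms(1)] assms(2) by (cases "lv i = 3"; force)+

text \<open>
  The order after the tilt is analysed by the new levels. In most cases either the coefficients vanish or the reflection
  makes \<open>chi x k\<close> vanish, and the old relations apply. New information is needed in three places. Between two members of level
  \<open>2\<close>, or one arriving at level \<open>1\<close> and one of level \<open>2\<close>, the value of \<open>chi\<close> is nonpositive before and nonnegative after the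
  tilt, both by stability. For two members on the line, \<open>hereditary_at\<close> is used.
\<close>

lemma tilt_before:
  assumes i: "i \<in> I" and j: "j \<in> I" and ij: "i \<noteq> j" and b: "before (c' i) (c' j)"
  shows "chi (c' i) (c' j) = 0"
proof -
  have b': "lv' i < lv' j \<or> (lv' i = lv' j \<and> S (c' i) (c' j) > 0)"
    using b level_order(1)[OF pos_k tilt_root[OF i] tilt_root[OF j]] by simp
  have line: "lv' i = lv' j \<Longrightarrow> lv' i \<in> {1, 3} \<Longrightarrow> S (c' i) (c' j) = 0"
    unfolding S_pos_iff_upper(2)[OF pos_k] by (auto simp: level_def split: if_splits)
  have le: "lv' i \<le> 4" "lv' j \<le> 4" by (simp_all add: level_def)
  consider (jk) "j = k" | (ik) "i = k" | (no) "i \<noteq> k" "j \<noteq> k" by blast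
  then show ?thesis
  proof cases
    case jk
    then have ik: "i \<noteq> k" and "lv' j = 3" using ij tilt_level(1)[OF j] by auto
    then have "lv' i = 0 \<or> lv' i = 1 \<or> lv' i = 2" using b' line by force
    then have "chi (c i) (c k) + a i = 0"
      using tilt_level_cases[OF i ik] reflect_reduces[OF i ik] coeff(1)[OF i ik] coeff_le[OF i ik]
      by auto
    then show ?thesis using chi_tilt_k(1)[OF i] jk by simp
  next
    case ik
    then have jk: "j \<noteq> k" and "lv' i = 3" using ij tilt_level(1)[OF i] by auto
    then have "lv' j = 4" using b' line le by force
    then have "lv j = 4" using tilt_level_cases[OF j jk] by simp
    then show ?thesis
      using chi_tilt_k(2)[OF j] jk ik coeff(5)[OF j jk] coeff_le[OF j jk] by simp
  next
    case no
    note ci = tilt_level_cases[OF i no(1)] and cj = tilt_level_cases[OF j no(2)]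
    have f: "chi (c' i) (c' j) = chi (c i) (c j) + a i * chi (c k) (c j) + a j * (chi (c i) (c k) + a i)"
      by (rule chi_tilt[OF i j])
    have kj: "lv' j \<ge> 2 \<Longrightarrow> chi (c k) (c j) = 0"
      using cj le coeff(5)[OF j no(2)] by (cases "lv' j = 2"; cases "lv' j = 3"; cases "lv' j = 4") auto
    consider "lv' i = 0" | "lv' i = 1" | "lv' i = 2" | "lv' i = 3" | "lv' i = 4" using le by linarith
    then show ?thesis
    proof cases
      case 1
      then have li: "lv i = 0" using ci by simp
      then have "chi (c' i) (c' j) = chi (c i) (c j)"
        using f coeff_le[OF i no(1)] coeff(1)[OF i no(1)] by simp
      moreover have "chi (c i) (c j) = 0"
      proof (cases "lv j = 0")
        case True
        then have "a j = 0" "a i = 0" "lv' j = 0"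
          using coeff_le[OF j no(2)] coeff_le[OF i no(1)] li tilt_level(2)[OF j no(2)] by auto
        then show ?thesis
          using b' 1 unchanged_charge[OF i j no] chi_zero_S[OF i j] li True by simp
      qed (use chi_zero[OF i j] li in simp)
      ultimately show ?thesis by simp
    next
      case 2
      then have r: "chi (c i) (c k) + a i = 0" using ci reflect_reduces[OF i no(1)] by auto
      have lj: "lv' j \<ge> 2" using b' line 2 by force
      have e: "chi (c' i) (c' j) = chi (c i) (c j)" using f r kj[OF lj] by simp
      have ljj: "lv j = lv' j" using lj cj le by (cases "lv' j = 2"; cases "lv' j = 3"; cases "lv' j = 4") auto
      show ?thesis
      proof (cases "lv i = 1")
        case True
        then show ?thesis using e chi_zero[OF i j] lj ljj by simp
      next
        case False
        then have li: "lv i = 3" "a i > 0" using ci(5)[OF 2] by auto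
        consider "lv j = 2" | "lv j = 3" | "lv j = 4" using lj ljj le by linarith
        then show ?thesis
        proof cases
          case l: 1
          \<comment> \<open>The member i crosses to the ray of k, so its phase passes that of j by the tilt, while the value of chi stays the same.\<close>
          then have hj: "h j > 0" "S (c k) (c' j) > 0" using S_level(2)[of j] S_tilt[OF j] by auto
          have hi: "h i = 0" "\<not> pos (c i)" "S (c k) (c' i) = 0" "pos (c' i)"
            using li 2 S_tilt[OF i] by (auto simp: level_def split: if_splits)
          have "chi (c i) (c j) \<le> 0"
            using stable'[OF roots[OF j] roots[OF i]] parallel_S(2)[OF roots[OF i] hi(1) hj(1) hi(2)] by simp
          moreover have "chi (c' i) (c' j) \<ge> 0"
            using stable[OF tilt_root[OF i] tilt_root[OF j]] parallel_S(1)[OF tilt_root[OF i] hi(3) hj(2) hi(4)]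
            by simp
          ultimately show ?thesis using e by simp
        next
          case l: 2
          then show ?thesis
            using e ray_hereditary(2)[OF i li j no(2) ij[symmetric] l 2] ljj by simp
        qed (use e chi_zero[OF i j] li in simp)
      qed
    next
      case 3
      then have li: "lv i = 2" using ci by simp
      then have r: "chi (c i) (c k) + a i = 0" using reflect_reduces[OF i no(1)] by auto
      have lj: "lv' j \<ge> 2" using b' 3 by force
      have e: "chi (c' i) (c' j) = chi (c i) (c j)" using f r kj[OF lj] by simp
      have ljj: "lv j = lv' j" using lj cj le by (cases "lv' j = 2"; cases "lv' j = 3"; cases "lv' j = 4") auto
      show ?thesis
      proof (cases "lv j = 2")
        case True
        then have "chi (c' i) (c' j) \<ge> 0"
          using b' 3 ljj stable[OF tilt_root[OF i] tilt_root[OF j]] by simp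
        then show ?thesis using e chi_upper_nonpos(2)[OF i j ij] li True by simp
      qed (use e chi_zero[OF i j] li lj ljj in simp)
    next
      case 4
      then have li: "lv i = 3" using ci by simp
      have "lv' j = 4" using b' line 4 le by force
      then have lj: "lv j = 4" using cj by simp
      then show ?thesis
        using f li coeff_le[OF j no(2)] coeff(5)[OF j no(2)] chi_zero[OF i j] no by simp
    next
      case 5
      then have li: "lv i = 4" and lj: "lv j = 4" "lv' j = 4" using ci cj b' le by force+
      then have a: "a i = 0" "a j = 0" using coeff_le[OF j no(2)] coeff_le[OF i no(1)] by auto
      then have "S (c i) (c j) > 0" using unchanged_charge[OF i j no] b' 5 lj by simp
      then show ?thesis using f a chi_zero_S[OF i j] li lj no by simp
    qed
  qed
qed

lemma tilt_same_ray:
  assumes i: "i \<in> I" and j: "j \<in> I" and ij: "i \<noteq> j" and b: "same_ray (c' i) (c' j)"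
  shows "chi (c' i) (c' j) \<le> 0"
proof -
  have b': "lv' i = lv' j" "S (c' i) (c' j) = 0"
    using b level_order(2)[OF pos_k tilt_root[OF i] tilt_root[OF j]] by simp_all
  have le: "lv' i \<le> 4" by (simp add: level_def)
  consider (jk) "j = k" | (ik) "i = k" | (no) "i \<noteq> k" "j \<noteq> k" by blast
  then show ?thesis
  proof cases
    case jk
    then show ?thesis using chi_tilt_k(1)[OF i] ij by simp
  next
    case ik
    then have jk: "j \<noteq> k" and "lv' j = 3" using ij tilt_level(1)[OF i] b' by auto
    then show ?thesis
      using chi_tilt_k(2)[OF j] tilt_level_cases(4)[OF j jk] coeff(5)[OF j jk] ik by simp
  next
    case no
    note ci = tilt_level_cases[OF i no(1)] and cj = tilt_level_cases[OF j no(2)]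
    have f: "chi (c' i) (c' j) = chi (c i) (c j) + a i * chi (c k) (c j) + a j * (chi (c i) (c k) + a i)"
      by (rule chi_tilt[OF i j])
    have nn: "a i \<ge> 0" "a j \<ge> 0" using no by simp_all
    have r: "chi (c i) (c j) \<le> 0" if "lv i = 3 \<and> lv j = 3 \<or> lv i = 1 \<and> lv j = 1"
      using chi_ray[OF i j ij] on_line[OF i j] S_level(1)[of i] S_level(1)[of j] that by auto
    consider "lv' i = 0 \<or> lv' i = 4" | "lv' i = 1" | "lv' i = 2" | "lv' i = 3" using le by linarith
    then show ?thesis
    proof cases
      case 1
      then have l: "lv i = lv j" "lv i \<in> {0, 4}" using ci cj b' by auto
      then have a: "a i = 0" "a j = 0" using coeff_le[OF j no(2)] coeff_le[OF i no(1)] by auto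
      then have "S (c i) (c j) = 0" using unchanged_charge[OF i j no] b' by simp
      then show ?thesis using f a chi_ray[OF i j ij] l no by simp
    next
      case 2
      then have "chi (c i) (c k) + a i = 0" using ci reflect_reduces[OF i no(1)] by auto
      then have e: "chi (c' i) (c' j) = chi (c i) (c j) + a i * chi (c k) (c j)" using f by simp
      consider "lv i = 1" "lv j = 1" | "lv i = 3" "a i > 0" "lv j = 1" | "lv i = 1" "lv j = 3" | "lv i = 3" "lv j = 3"
        using ci(5) cj(5) 2 b' by metis
      then show ?thesis
      proof cases
        case l: 1
        then have "a i * chi (c k) (c j) \<le> 0"
          using coeff(2)[OF j no(2)] nn by (intro mult_nonneg_nonpos) auto
        then show ?thesis using e r l by linarith
      next
        case l: 2
        then show ?thesis using e ray_hereditary(1)[OF i l(1,2) j no(2) ij[symmetric] l(3) 2] by simp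
      next
        case l: 3
        then show ?thesis using e coeff(5)[OF j no(2)] chi_zero[OF i j] by simp
      next
        case l: 4
        then show ?thesis using e coeff(5)[OF j no(2)] r by simp
      qed
    next
      case 3
      then have l: "lv i = 2" "lv j = 2" using ci cj b' by auto
      then have "chi (c i) (c k) + a i = 0" using reflect_reduces[OF i no(1)] by auto
      then show ?thesis
        using f coeff(5)[OF j no(2)] l chi_upper_nonpos(2)[OF i j ij] by simp
    next
      case 4
      then have l: "lv i = 3" "lv j = 3" using ci cj b' by auto
      have kj: "chi (c k) (c j) = 0" using coeff(5)[OF j no(2)] l by simp
      show ?thesis
      proof (cases "a j = 0 \<or> chi (c i) (c k) + a i = 0")
        case True
        then show ?thesis using f kj r l by auto
      next
        case False
        then have "a j > 0" "a i = 0" "chi (c i) (c k) \<ge> 0" using nn no by (auto simp: max_def split: if_splits)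
        then show ?thesis
          using f kj ray_hereditary(3)[OF j l(2) _ i no(1) ij l(1)] 4 b' by simp
      qed
    qed
  qed
qed

lemma tilt_seed: "seed I c'"
proof -
  have "\<exists>i\<in>I. \<exists>j\<in>I. S (c' i) (c' j) \<noteq> 0"
  proof -
    obtain w where w: "w \<in> I" "S (c w) (c k) \<noteq> 0" by (rule witness)
    then have "S (c' w) (c' k) = - S (c w) (c k)"
      using k by (simp add: tilt_eq S_comb inV comb_closed)
    with w(2) have "S (c' w) (c' k) \<noteq> 0" by simp
    then show ?thesis using w(1) k by blast
  qed
  then show ?thesis
    unfolding seed_def using tilt_root tilt_before tilt_same_ray by blast
qed

lemma form_tilt:
  assumes "i \<in> I" "j \<in> I"
  shows "form (c' i) (c' j) = (if i = k \<or> j = k then - form (c i) (c j)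
     else form (c i) (c j) + max 0 (form (c i) (c k)) * max 0 (form (c k) (c j))
        - max 0 (form (c j) (c k)) * max 0 (form (c k) (c i)))"
proof -
  have f: "form (c' i) (c' j) = form (c i) (c j) + a i * form (c k) (c j) + a j * form (c i) (c k)"
    unfolding form_def chi_tilt[OF assms] chi_tilt[OF assms(2,1)] by (simp add: algebra_simps del: max.absorb1)
  have sk: "form (c k) (c i) = - form (c i) (c k)" "form (c k) (c j) = - form (c j) (c k)" "form (c k) (c k) = 0"
    by (simp_all add: form_def)
  show ?thesis
  proof (cases "i = k \<or> j = k")
    case True
    then show ?thesis using f sk by auto
  next
    case False
    then have "a i = max 0 (- form (c i) (c k))" "a j = max 0 (- form (c j) (c k))"
      using coeff_form assms by blast+
    then show ?thesis using f sk False by (auto simp: max_def algebra_simps)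
  qed
qed

end

text \<open>
  Semidefiniteness bounds \<open>chi x y + chi y x\<close>. In a seed one of the summands vanishes or both are nonpositive, so
  the difference is bounded as well.
\<close>

lemma form_bound:
  assumes "seed I c" "i \<in> I" "j \<in> I"
  shows "\<bar>form (c i) (c j)\<bar> \<le> 2"
proof -
  have r: "root (c i)" "root (c j)" using assms by (auto simp: seed_def)
  have s: "\<bar>chi (c i) (c j) + chi (c j) (c i)\<bar> \<le> 2" by (rule abs_sum_le_2[OF r])
  have "before (c i) (c j) \<or> before (c j) (c i) \<or> (same_ray (c i) (c j) \<and> same_ray (c j) (c i))"
    using S_skew[of "c i" "c j"] by (auto simp: before_def same_ray_def)
  then consider "i = j" | "i \<noteq> j" "before (c i) (c j)" | "i \<noteq> j" "before (c j) (c i)"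
    | "i \<noteq> j" "same_ray (c i) (c j)" "same_ray (c j) (c i)" by blast
  then show ?thesis
  proof cases
    case 1
    then show ?thesis by (simp add: form_def)
  next
    case 2
    then have "chi (c i) (c j) = 0" using assms by (simp add: seed_def)
    then show ?thesis using s by (simp add: form_def)
  next
    case 3
    then have "chi (c j) (c i) = 0" using assms by (simp add: seed_def)
    then show ?thesis using s by (simp add: form_def)
  next
    case 4
    then have "chi (c i) (c j) \<le> 0" "chi (c j) (c i) \<le> 0" using assms by (simp_all add: seed_def)
    then show ?thesis using s unfolding form_def by linarith
  qed
qed

text \<open>
  The formula is the mutation rule for skew-symmetric matrices at \<open>k\<close>.
\<close>

theorem seed_mutation:
  assumes seed: "seed I c" and k: "k \<in> I"
  obtains c' where "seed I c'"
    "\<And>i j. i \<in> I \<Longrightarrow> j \<in> I \<Longrightarrow> form (c' i) (c' j) = (if i = k \<or> j = k then - form (c i) (c j)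
     else form (c i) (c j) + max 0 (form (c i) (c k)) * max 0 (form (c k) (c j))
        - max 0 (form (c j) (c k)) * max 0 (form (c k) (c i)))"
proof (cases "pos (c k)")
  case True
  show ?thesis
    by (rule that[OF tilt_seed[OF seed k True] form_tilt[OF seed k True]])
next
  case False
  interpret op: charged_lattice V comb "\<lambda>x y. chi y x" "\<lambda>x. - rk x" deg "- \<sigma>"
    by (rule charged_lattice_op)
  have root: "op.root x \<longleftrightarrow> root x" for x by (simp add: op.root_def root_def)
  have S: "op.S x y = - S x y" for x y by (simp add: op.S_def S_def)
  have pos: "op.pos x \<longleftrightarrow> \<not> pos x" if "root x" for x
    using root_charge[OF that] sigma by (auto simp: op.pos_def pos_def)
  have before: "op.before x y \<longleftrightarrow> before y x" "op.same_ray x y \<longleftrightarrow> same_ray y x" if "root x" "root y" for x y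
    using that S_skew[of x y] by (auto simp: op.before_def before_def op.same_ray_def same_ray_def pos S)
  have seed_op: "op.seed I d \<longleftrightarrow> seed I d" for d :: "'b \<Rightarrow> 'a"
  proof -
    have "op.seed I d" if "seed I d" for d :: "'b \<Rightarrow> 'a"
      using that before unfolding op.seed_def seed_def root S by (simp; blast)
    moreover have "seed I d" if "op.seed I d" for d :: "'b \<Rightarrow> 'a"
      using that before unfolding op.seed_def seed_def root S by (simp; blast)
    ultimately show ?thesis by blast
  qed
  have form: "op.form x y = - form x y" for x y by (simp add: op.form_def form_def)
  have "root (c k)" using seed k by (auto simp: seed_def)
  then have pk: "op.pos (c k)" using pos False by simp
  have s: "op.seed I c" using seed seed_op by simp
  have skew: "form y x = - form x y" for x y by (simp add: form_def)
  show ?thesis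
  proof (rule that)
    show "seed I (op.tilt k c)" using op.tilt_seed[OF s k pk] seed_op by simp
    fix i j assume ij: "i \<in> I" "j \<in> I"
    show "form (op.tilt k c i) (op.tilt k c j) = (if i = k \<or> j = k then - form (c i) (c j)
     else form (c i) (c j) + max 0 (form (c i) (c k)) * max 0 (form (c k) (c j))
        - max 0 (form (c j) (c k)) * max 0 (form (c k) (c i)))"
      using op.form_tilt[OF s k pk ij] skew[of "c k" "c i"] skew[of "c k" "c j"]
      by (cases "i = k \<or> j = k") (simp_all only: form minus_minus if_True if_False, auto simp: algebra_simps)
  qed
qed

end

section \<open>The numerical Grothendieck group of a weighted projective line\<close>

text \<open>
  Vector bundles on the weighted line correspond to vector bundles on the projective line with a flag in the fibre at
  each weighted point. The class is recorded by the rank, the degree of the underlying bundle and the dimensions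
  \<open>mu x i j\<close> of the successive quotients of the \<open>i\<close>-th flag. Only \<open>j < p ! i\<close> matters, and for the classes in the lattice
  \<open>K\<close> below the entries of each row add up to the rank.
\<close>

type_synonym kclass = "int \<times> int \<times> (nat \<Rightarrow> nat \<Rightarrow> int)"

definition rk :: "kclass \<Rightarrow> int" where "rk x = fst x"
definition dg :: "kclass \<Rightarrow> int" where "dg x = fst (snd x)"
definition mu :: "kclass \<Rightarrow> nat \<Rightarrow> nat \<Rightarrow> int" where "mu x = snd (snd x)"

definition comb :: "kclass \<Rightarrow> int \<Rightarrow> kclass \<Rightarrow> kclass" where
  "comb x a y = (rk x + a * rk y, dg x + a * dg y, \<lambda>i j. mu x i j + a * mu y i j)"

lemma comb_simps[simp]:
  "rk (comb x a y) = rk x + a * rk y" "dg (comb x a y) = dg x + a * dg y"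
  "mu (comb x a y) i j = mu x i j + a * mu y i j"
  by (simp_all add: rk_def dg_def mu_def comb_def)

lemma tuple_simps[simp]: "rk (r, d, m) = r" "dg (r, d, m) = d" "mu (r, d, m) = m"
  by (simp_all add: rk_def dg_def mu_def)

lemma double_sum_triangle:
  fixes m :: "nat \<Rightarrow> int"
  shows "2 * (\<Sum>j<n. \<Sum>l<j. m l * m j) = (\<Sum>j<n. m j)\<^sup>2 - (\<Sum>j<n. (m j)\<^sup>2)"
  by (induction n) (simp_all add: power2_eq_square algebra_simps sum_distrib_left sum_distrib_right)

lemma sum_squares_mean:
  fixes m :: "nat \<Rightarrow> int"
  shows "(\<Sum>j<n. m j)\<^sup>2 \<le> int n * (\<Sum>j<n. (m j)\<^sup>2)"
proof -
  have e: "(\<Sum>j<k. (a * m j - c)\<^sup>2) = a * a * (\<Sum>j<k. (m j)\<^sup>2) - 2 * a * c * (\<Sum>j<k. m j) + int k * c\<^sup>2" for k a c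
    by (induction k) (simp_all add: power2_eq_square algebra_simps)
  have "0 \<le> (\<Sum>j<n. (int n * m j - (\<Sum>j<n. m j))\<^sup>2)" by (simp add: sum_nonneg)
  then have "0 \<le> int n * (int n * (\<Sum>j<n. (m j)\<^sup>2) - (\<Sum>j<n. m j)\<^sup>2)"
    unfolding e[of "int n" "\<Sum>j<n. m j" n] by (simp add: power2_eq_square algebra_simps)
  then show ?thesis by (cases "n = 0") (simp_all add: zero_le_mult_iff)
qed

lemma sign_sequence_sums:
  fixes m :: "nat \<Rightarrow> int"
  assumes "\<And>j. j < n \<Longrightarrow> \<bar>m j\<bar> \<le> 1"
  shows "(\<Sum>j<n. m j) = int (card {j. j < n \<and> m j = 1}) - int (card {j. j < n \<and> m j = -1})"
    "(\<Sum>j<n. (m j)\<^sup>2) = int (card {j. j < n \<and> m j = 1}) + int (card {j. j < n \<and> m j = -1})"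
proof -
  have e: "m j = (if m j = 1 then 1 else 0) - (if m j = -1 then 1 else 0)"
    "(m j)\<^sup>2 = (if m j = 1 then 1 else 0) + (if m j = -1 then 1 else 0)" if "j < n" for j
  proof -
    have "m j = 1 \<or> m j = 0 \<or> m j = -1" using assms[OF that] by linarith
    then show "m j = (if m j = 1 then 1 else 0) - (if m j = -1 then 1 else 0)"
      "(m j)\<^sup>2 = (if m j = 1 then 1 else 0) + (if m j = -1 then 1 else 0)" by auto
  qed
  have c: "(\<Sum>j<n. if m j = v then 1 else 0) = int (card {j. j < n \<and> m j = v})" for v
    by (simp add: sum.If_cases lessThan_def Int_def)
  have "(\<Sum>j<n. m j) = (\<Sum>j<n. (if m j = 1 then 1 else 0) - (if m j = -1 then 1 else 0))"
    by (intro sum.cong) (use e(1) in auto)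
  then show "(\<Sum>j<n. m j) = int (card {j. j < n \<and> m j = 1}) - int (card {j. j < n \<and> m j = -1})"
    by (simp only: sum_subtractf c)
  have "(\<Sum>j<n. (m j)\<^sup>2) = (\<Sum>j<n. (if m j = 1 then 1 else 0) + (if m j = -1 then 1 else 0))"
    by (intro sum.cong) (use e(2) in auto)
  then show "(\<Sum>j<n. (m j)\<^sup>2) = int (card {j. j < n \<and> m j = 1}) + int (card {j. j < n \<and> m j = -1})"
    by (simp only: sum.distrib c)
qed

lemma square_le_3_abs_le_1: "(x::int)\<^sup>2 \<le> 3 \<Longrightarrow> \<bar>x\<bar> \<le> 1"
proof (rule ccontr)
  assume *: "x\<^sup>2 \<le> 3" "\<not> \<bar>x\<bar> \<le> 1"
  then have "2 * 2 \<le> \<bar>x\<bar> * \<bar>x\<bar>" by (intro mult_mono) auto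
  then show False using * by (simp add: power2_eq_square)
qed

lemma member_le_sum_squares:
  fixes m :: "nat \<Rightarrow> int"
  shows "j < n \<Longrightarrow> (m j)\<^sup>2 \<le> (\<Sum>j<n. (m j)\<^sup>2)"
  by (rule member_le_sum) auto

lemma abs_sum_le_sum_squares:
  fixes m :: "nat \<Rightarrow> int"
  shows "\<bar>\<Sum>j<n. m j\<bar> \<le> (\<Sum>j<n. (m j)\<^sup>2)"
proof -
  have "\<bar>\<Sum>j<n. m j\<bar> \<le> (\<Sum>j<n. \<bar>m j\<bar>)" by (rule sum_abs)
  also have "\<dots> \<le> (\<Sum>j<n. (m j)\<^sup>2)"
  proof (intro sum_mono)
    fix j
    show "\<bar>m j\<bar> \<le> (m j)\<^sup>2"
    proof (cases "m j = 0")
      case False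
      then have "\<bar>m j\<bar> * 1 \<le> \<bar>m j\<bar> * \<bar>m j\<bar>" by (intro mult_left_mono) auto
      then show ?thesis by (simp add: power2_eq_square)
    qed simp
  qed
  finally show ?thesis .
qed

lemma sum_squares_2_sum_0:
  fixes m :: "nat \<Rightarrow> int"
  assumes s: "(\<Sum>j<n. (m j)\<^sup>2) = 2" and z: "(\<Sum>j<n. m j) = 0"
  obtains a b where "a < n" "b < n" "a \<noteq> b" "\<And>j. j < n \<Longrightarrow> m j = (if j = a then 1 else 0) - (if j = b then 1 else 0)"
proof -
  have l: "\<bar>m j\<bar> \<le> 1" if "j < n" for j
    using member_le_sum_squares[OF that, of m] s by (intro square_le_3_abs_le_1) simp
  have c: "card {j. j < n \<and> m j = 1} = 1" "card {j. j < n \<and> m j = -1} = 1"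
    using sign_sequence_sums[of n m, OF l] s z by auto
  obtain a where a: "{j. j < n \<and> m j = 1} = {a}" by (rule card_1_singletonE[OF c(1)])
  obtain b where b: "{j. j < n \<and> m j = -1} = {b}" by (rule card_1_singletonE[OF c(2)])
  have am: "j < n \<and> m j = 1 \<longleftrightarrow> j = a" and bm: "j < n \<and> m j = -1 \<longleftrightarrow> j = b" for j
    using a b by blast+
  show ?thesis
  proof (rule that)
    show "a < n" "b < n" using am[of a] bm[of b] by blast+
    show "a \<noteq> b" using am[of a] bm[of b] by force
    fix j assume j: "j < n"
    have "m j = 1 \<or> m j = 0 \<or> m j = -1" using l[OF j] by linarith
    then show "m j = (if j = a then 1 else 0) - (if j = b then 1 else 0)"
      using am[of j] bm[of j] j by force
  qed
qed

text \<open>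
  The Euler form between the objects of a tube of rank \<open>r - q\<close> that correspond to the intervals \<open>[A, B)\<close>
  and \<open>[C, D)\<close> of its simple objects, after the cycle of simple objects has been cut open to \<open>{q..<r}\<close>. The last term accounts
  for the identification of \<open>r\<close> with \<open>q\<close>.
\<close>

definition arc_chi :: "int \<Rightarrow> int \<Rightarrow> int \<Rightarrow> int \<Rightarrow> int \<Rightarrow> int \<Rightarrow> int" where
  "arc_chi q r A B C D = of_bool (A < D \<and> D \<le> B) - of_bool (A < C \<and> C \<le> B) - of_bool (C = q \<and> B = r)"

text \<open>
  Proper intervals of a cycle cut open at \<open>q = r\<close>. An interval with \<open>q < A\<close> or \<open>B < r\<close> does not touch the left
  or the right end, and the alternatives in the hypotheses of the following lemmas say which ends are avoided by all intervals
  in question; they come from the alternatives of \<open>separates\<close>. In the names, \<open>quotient\<close>,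
  \<open>extension\<close> and \<open>kernel\<close> refer to the three configurations of \<open>hereditary_at\<close>.
\<close>

abbreviation (input) ivl :: "int \<Rightarrow> int \<Rightarrow> int \<Rightarrow> int \<Rightarrow> bool" where
  "ivl q r A B \<equiv> q \<le> A \<and> A < B \<and> B \<le> r \<and> \<not> (A = q \<and> B = r)"

lemma ivl_acyclic:
  assumes "ivl q r A B" "ivl q r C D" "(q < A \<and> q < C) \<or> (B < r \<and> D < r)"
  shows "\<not> (arc_chi q r A B C D < 0 \<and> arc_chi q r C D A B < 0)"
  using assms unfolding arc_chi_def of_bool_def by (auto split: if_splits)

text \<open>
  If there is a map but no extension between two intervals in this position, then it is the inclusion or projection along a common end.
\<close>

lemma ivl_hom:
  assumes "ivl q r A B" "ivl q r C D"
    and "(q < A \<and> q < C) \<or> (B < r \<and> D < r) \<or> (B < r \<and> q < C) \<or> (q < A \<and> D < r)"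
    and "arc_chi q r A B C D = 0" "arc_chi q r C D A B > 0"
  shows "arc_chi q r C D A B = 1" "(A < C \<and> B = D) \<or> (A = C \<and> B < D)"
  using assms unfolding arc_chi_def of_bool_def by (auto split: if_splits)

lemma ivl_hom_op:
  assumes "ivl q r A B" "ivl q r C D"
    and "(q < A \<and> q < C) \<or> (B < r \<and> D < r) \<or> (B < r \<and> q < C) \<or> (q < A \<and> D < r)"
    and "arc_chi q r C D A B = 0" "arc_chi q r A B C D > 0"
  shows "arc_chi q r A B C D = 1"
  using assms unfolding arc_chi_def of_bool_def by (auto split: if_splits)

lemma ivl_quotient:
  assumes "ivl q r A B" "ivl q r C D" "ivl q r E F"
    and "(q < A \<and> q < C \<and> q < E) \<or> (B < r \<and> D < r \<and> F < r) \<or> (B < r \<and> F < r \<and> q < C)"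
    and "arc_chi q r A B C D = 0" "arc_chi q r C D A B > 0" "B - A > D - C"
    and "arc_chi q r E F A B \<le> 0" "arc_chi q r A B E F \<le> 0" "arc_chi q r E F C D = 0"
  shows "arc_chi q r A B E F \<le> arc_chi q r C D E F"
  using ivl_hom(2)[OF assms(1,2) _ assms(5,6)] assms
  unfolding arc_chi_def of_bool_def by (auto split: if_splits)

lemma ivl_quotient_op:
  assumes "ivl q r A B" "ivl q r C D" "ivl q r E F"
    and "(q < A \<and> q < C \<and> q < E) \<or> (B < r \<and> D < r \<and> F < r) \<or> (q < A \<and> q < E \<and> D < r)"
    and "arc_chi q r C D A B = 0" "arc_chi q r A B C D > 0" "B - A > D - C"
    and "arc_chi q r A B E F \<le> 0" "arc_chi q r E F A B \<le> 0" "arc_chi q r C D E F = 0"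
  shows "arc_chi q r E F A B \<le> arc_chi q r E F C D"
  using assms unfolding arc_chi_def of_bool_def by (auto split: if_splits)

lemma ivl_extension:
  assumes "ivl q r A B" "ivl q r C D" "ivl q r E F"
    and "(q < A \<and> q < C \<and> q < E) \<or> (B < r \<and> D < r \<and> F < r) \<or> (B < r \<and> q < C \<and> q < E)"
    and "arc_chi q r A B C D = 0" "arc_chi q r C D A B > 0" "B - A > D - C"
    and "arc_chi q r A B E F = 0" "arc_chi q r C D E F \<le> 0" "arc_chi q r E F C D \<le> 0"
  shows "arc_chi q r C D E F = 0"
  using ivl_hom(2)[OF assms(1,2) _ assms(5,6)] assms
  unfolding arc_chi_def of_bool_def by (auto split: if_splits)

lemma ivl_extension_op:
  assumes "ivl q r A B" "ivl q r C D" "ivl q r E F"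
    and "(q < A \<and> q < C \<and> q < E) \<or> (B < r \<and> D < r \<and> F < r) \<or> (q < A \<and> D < r \<and> F < r)"
    and "arc_chi q r C D A B = 0" "arc_chi q r A B C D > 0" "B - A > D - C"
    and "arc_chi q r E F A B = 0" "arc_chi q r E F C D \<le> 0" "arc_chi q r C D E F \<le> 0"
  shows "arc_chi q r E F C D = 0"
  using assms unfolding arc_chi_def of_bool_def by (auto split: if_splits)

lemma ivl_kernel:
  assumes "ivl q r A B" "ivl q r C D" "ivl q r E F"
    and "(q < A \<and> q < C \<and> q < E) \<or> (B < r \<and> D < r \<and> F < r) \<or> (B < r \<and> q < C \<and> q < E)"
    and "arc_chi q r A B C D = 0" "arc_chi q r C D A B > 0" "B - A < D - C"
    and "arc_chi q r A B E F = 0" "arc_chi q r C D E F \<le> 0" "arc_chi q r E F C D \<le> 0" "arc_chi q r E F A B \<le> 0"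
  shows "arc_chi q r E F C D \<le> arc_chi q r E F A B"
  using ivl_hom(2)[OF assms(1,2) _ assms(5,6)] assms
  unfolding arc_chi_def of_bool_def by (auto split: if_splits)

lemma ivl_kernel_op:
  assumes "ivl q r A B" "ivl q r C D" "ivl q r E F"
    and "(q < A \<and> q < C \<and> q < E) \<or> (B < r \<and> D < r \<and> F < r) \<or> (q < A \<and> D < r \<and> F < r)"
    and "arc_chi q r C D A B = 0" "arc_chi q r A B C D > 0" "B - A < D - C"
    and "arc_chi q r E F A B = 0" "arc_chi q r E F C D \<le> 0" "arc_chi q r C D E F \<le> 0" "arc_chi q r A B E F \<le> 0"
  shows "arc_chi q r C D E F \<le> arc_chi q r A B E F"
  using assms unfolding arc_chi_def of_bool_def by (auto split: if_splits)

locale weights =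
  fixes p :: "nat list" and N :: nat
  assumes p_pos: "i < length p \<Longrightarrow> 0 < p ! i"
    and N_pos: "0 < N" and dvd_N: "i < length p \<Longrightarrow> p ! i dvd N"
begin

abbreviation t where "t \<equiv> length p"

definition K :: "kclass set" where "K = {x. \<forall>i<t. (\<Sum>j<p!i. mu x i j) = rk x}"

text \<open>
  The Riemann--Roch formula on the projective line, corrected by the homomorphisms of the fibres that do not respect the flags.
\<close>

definition chi :: "kclass \<Rightarrow> kclass \<Rightarrow> int" where
  "chi x y = rk x * rk y + rk x * dg y - rk y * dg x - (\<Sum>i<t. \<Sum>j<p!i. \<Sum>l<j. mu x i l * mu y i j)"

text \<open>
  \<open>N\<close> times the parabolic degree, where the \<open>j\<close>-th step of the \<open>i\<close>-th flag has weight \<open>- j / p ! i\<close>. The factor \<open>N\<close>, a common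
  multiple of the weights, makes it an integer.
\<close>

definition deg :: "kclass \<Rightarrow> int" where
  "deg x = int N * dg x - (\<Sum>i<t. \<Sum>j<p!i. int (N div p!i * j) * mu x i j)"

definition S :: "kclass \<Rightarrow> kclass \<Rightarrow> int" where "S x y = rk x * deg y - rk y * deg x"

definition root :: "kclass \<Rightarrow> bool" where "root x \<longleftrightarrow> x \<in> K \<and> chi x x = 1"

definition psum :: "kclass \<Rightarrow> nat \<Rightarrow> nat \<Rightarrow> int" where "psum x i n = (\<Sum>j<n. mu x i j)"

lemma comb_K: "x \<in> K \<Longrightarrow> y \<in> K \<Longrightarrow> comb x a y \<in> K"
  by (simp add: K_def sum.distrib sum_distrib_left[symmetric])

lemma chi_comb_left: "chi (comb x a y) z = chi x z + a * chi y z"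
  by (simp add: chi_def sum.distrib sum_distrib_left algebra_simps)

lemma chi_comb_right: "chi z (comb x a y) = chi z x + a * chi z y"
  by (simp add: chi_def sum.distrib sum_distrib_left algebra_simps)

lemma deg_comb: "deg (comb x a y) = deg x + a * deg y"
  by (simp add: deg_def sum.distrib sum_distrib_left algebra_simps)

text \<open>
  The cross terms of the form are completed to squares of the row sums, which equal the rank.
\<close>

lemma norm_formula:
  assumes "x \<in> K"
  shows "2 * chi x x = (2 - int t) * (rk x)\<^sup>2 + (\<Sum>i<t. \<Sum>j<p!i. (mu x i j)\<^sup>2)"
proof -
  have "2 * (\<Sum>j<p!i. \<Sum>l<j. mu x i l * mu x i j) = (rk x)\<^sup>2 - (\<Sum>j<p!i. (mu x i j)\<^sup>2)" if "i < t" for i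
    using double_sum_triangle[of "mu x i" "p!i"] assms that by (simp add: K_def)
  then have "2 * (\<Sum>i<t. \<Sum>j<p!i. \<Sum>l<j. mu x i l * mu x i j)
    = (\<Sum>i<t. (rk x)\<^sup>2 - (\<Sum>j<p!i. (mu x i j)\<^sup>2))"
    by (simp add: sum_distrib_left)
  then show ?thesis
    by (simp add: chi_def sum_subtractf power2_eq_square algebra_simps)
qed

lemma psum_total: "x \<in> K \<Longrightarrow> i < t \<Longrightarrow> psum x i (p!i) = rk x"
  by (simp add: K_def psum_def)

text \<open>
  The class of a sheaf of finite length in the \<open>i\<close>-th tube, or the negative of one, whose composition factors form the cyclic
  interval from \<open>a\<close> to \<open>b\<close>; the number of full turns and the sign are recorded by \<open>dg x\<close>.
\<close>

definition torsion :: "kclass \<Rightarrow> nat \<Rightarrow> nat \<Rightarrow> nat \<Rightarrow> bool" where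
  "torsion x i a b \<longleftrightarrow> rk x = 0 \<and> i < t \<and> a < p!i \<and> b < p!i \<and> a \<noteq> b \<and>
     (\<forall>i'<t. \<forall>j<p!i'. mu x i' j = (if i' = i then (if j = a then 1 else 0) - (if j = b then 1 else 0) else 0))"

text \<open>
  For rank \<open>0\<close> the norm formula says that the squares of all entries sum to \<open>2\<close>, and the sum of squares of each row is even because the row
  sums to \<open>0\<close>.
\<close>

lemma root_rank_0:
  assumes x: "root x" and r: "rk x = 0"
  obtains i a b where "torsion x i a b"
proof -
  let ?q = "\<lambda>i. \<Sum>j<p!i. (mu x i j)\<^sup>2"
  have xK: "x \<in> K" and s: "(\<Sum>i<t. ?q i) = 2"
    using norm_formula[of x] x r by (auto simp: root_def)
  have zero: "(\<Sum>j<p!i. mu x i j) = 0" if "i < t" for i using xK that r by (simp add: K_def)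
  have ev: "even (?q i)" if "i < t" for i
  proof -
    have "?q i = (\<Sum>j<p!i. mu x i j) - 2 * (\<Sum>j<p!i. \<Sum>l<j. mu x i l * mu x i j)"
      using double_sum_triangle[of "mu x i" "p!i"] zero[OF that] by (simp add: power2_eq_square)
    then show ?thesis using zero[OF that] by simp
  qed
  have nn: "0 \<le> ?q i" for i by (simp add: sum_nonneg)
  have "\<exists>i<t. ?q i \<noteq> 0"
  proof (rule ccontr)
    assume "\<not> ?thesis"
    then have "(\<Sum>i<t. ?q i) = 0" by (intro sum.neutral) blast
    then show False using s by simp
  qed
  then obtain i where i: "i < t" "?q i \<noteq> 0" by blast
  have split: "(\<Sum>i<t. ?q i) = ?q i + (\<Sum>i'\<in>{..<t} - {i}. ?q i')" using i by (intro sum.remove) auto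
  have rest: "0 \<le> (\<Sum>i'\<in>{..<t} - {i}. ?q i')" by (intro sum_nonneg nn)
  have "?q i \<noteq> 1" using ev[OF i(1)] by fastforce
  then have qi: "?q i = 2" "(\<Sum>i'\<in>{..<t} - {i}. ?q i') = 0" using split rest s i nn[of i] by linarith+
  have others: "mu x i' j = 0" if "i' < t" "i' \<noteq> i" "j < p!i'" for i' j
  proof -
    have "?q i' = 0" using qi(2) nn that by (simp add: sum_nonneg_eq_0_iff)
    then show ?thesis using that by (simp add: sum_nonneg_eq_0_iff)
  qed
  show ?thesis
  proof (rule sum_squares_2_sum_0[OF qi(1) zero[OF i(1)]])
    fix a b assume "a < p!i" "b < p!i" "a \<noteq> b"
      "\<And>j. j < p!i \<Longrightarrow> mu x i j = (if j = a then 1 else 0) - (if j = b then 1 else 0)"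
    then have "torsion x i a b" using others i r by (simp add: torsion_def)
    then show thesis by (rule that)
  qed
qed

lemma chi_torsion:
  assumes x: "torsion x i a b" and y: "y \<in> K"
  shows "chi y x = rk y * dg x + psum y i b - psum y i a"
    and "chi x y = - rk y * dg x + psum y i (Suc a) - psum y i (Suc b)"
    and "deg x = int (N div p!i) * (int (p!i) * dg x + int b - int a)"
proof -
  have i: "i < t" "a < p!i" "b < p!i" "rk x = 0" using x by (auto simp: torsion_def)
  have m: "mu x i' j = (if i' = i then (if j = a then 1 else 0) - (if j = b then 1 else 0) else 0)" if "i' < t" "j < p!i'" for i' j
    using x that by (simp add: torsion_def)
  have row: "(\<Sum>i'<t. \<Sum>j<p!i'. f i' j * mu x i' j) = f i a - f i b" for f :: "nat \<Rightarrow> nat \<Rightarrow> int"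
  proof -
    have "(\<Sum>i'<t. \<Sum>j<p!i'. f i' j * mu x i' j) = (\<Sum>i'<t. if i' = i then (\<Sum>j<p!i. f i j * ((if j = a then 1 else 0) - (if j = b then 1 else 0))) else 0)"
      by (intro sum.cong) (auto simp: m intro!: sum.cong)
    also have "\<dots> = (\<Sum>j<p!i. (if j = a then f i j else 0) - (if j = b then f i j else 0))"
      using i by (auto intro!: sum.cong)
    also have "\<dots> = f i a - f i b" using i by (simp add: sum_subtractf)
    finally show ?thesis .
  qed
  have "(\<Sum>i'<t. \<Sum>j<p!i'. \<Sum>l<j. mu y i' l * mu x i' j) = (\<Sum>i'<t. \<Sum>j<p!i'. psum y i' j * mu x i' j)"
    by (simp add: psum_def sum_distrib_right)
  then show "chi y x = rk y * dg x + psum y i b - psum y i a"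
    using i row[of "psum y"] by (simp add: chi_def)
  have "(\<Sum>j<n. \<Sum>l<j. mu x i' l * mu y i' j) = (\<Sum>l<n. (psum y i' n - psum y i' (Suc l)) * mu x i' l)" for n i'
  proof (induction n)
    case (Suc n)
    have "(psum y i' (Suc n) - psum y i' (Suc l)) * mu x i' l
      = (psum y i' n - psum y i' (Suc l)) * mu x i' l + mu x i' l * mu y i' n" for l
      by (simp add: psum_def algebra_simps)
    moreover have "(psum y i' n - psum y i' (Suc n)) * mu x i' n + mu x i' n * mu y i' n = 0"
      by (simp add: psum_def algebra_simps)
    ultimately show ?case using Suc by (simp add: sum.distrib)
  qed simp
  then have "(\<Sum>i'<t. \<Sum>j<p!i'. \<Sum>l<j. mu x i' l * mu y i' j)
     = (\<Sum>i'<t. \<Sum>l<p!i'. (psum y i' (p!i') - psum y i' (Suc l)) * mu x i' l)" by simp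
  also have "\<dots> = (rk y - psum y i (Suc a)) - (rk y - psum y i (Suc b))"
    unfolding row using psum_total[OF y i(1)] by simp
  finally show "chi x y = - rk y * dg x + psum y i (Suc a) - psum y i (Suc b)"
    using i by (simp add: chi_def)
  have "deg x = int N * dg x - (int (N div p!i * a) - int (N div p!i * b))"
    unfolding deg_def row ..
  also have "int N = int (N div p!i) * int (p!i)" using dvd_N[OF i(1)]
    by (metis dvd_div_mult_self of_nat_mult)
  finally show "deg x = int (N div p!i) * (int (p!i) * dg x + int b - int a)"
    by (simp add: algebra_simps)
qed

lemma torsion_K: "torsion x i a b \<Longrightarrow> x \<in> K"
proof -
  assume x: "torsion x i a b"
  have "(\<Sum>j<p!i'. mu x i' j) = rk x" if "i' < t" for i'
  proof -
    have "(\<Sum>j<p!i'. mu x i' j) = (\<Sum>j<p!i'. if i' = i then (if j = a then 1 else 0) - (if j = b then 1 else 0) else 0)"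
      using x that by (intro sum.cong) (auto simp: torsion_def)
    also have "\<dots> = 0" using x by (cases "i' = i") (simp_all add: sum_subtractf torsion_def)
    finally show ?thesis using x by (simp add: torsion_def)
  qed
  then show "x \<in> K" by (simp add: K_def)
qed

lemma chi_torsion_other:
  assumes x: "torsion x i a b" and y: "torsion y i' c d" and "i \<noteq> i'"
  shows "chi x y = 0"
proof -
  have "psum x i' n = 0" if "n \<le> p!i'" for n
    unfolding psum_def using x y that assms(3) by (intro sum.neutral) (auto simp: torsion_def)
  then show ?thesis
    using chi_torsion(1)[OF y torsion_K[OF x]] x y by (simp add: torsion_def)
qed

lemma deg_torsion_nonzero:
  assumes x: "torsion x i a b"
  shows "deg x \<noteq> 0" "deg x > 0 \<longleftrightarrow> (if a < b then dg x \<ge> 0 else dg x \<ge> 1)"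
proof -
  have i: "i < t" "a < p!i" "b < p!i" "a \<noteq> b" using x by (auto simp: torsion_def)
  have P: "int (N div p!i) > 0" using dvd_N[OF i(1)] N_pos p_pos[OF i(1)]
    by (simp add: dvd_imp_le div_greater_zero_iff)
  let ?v = "int (p!i) * dg x + int b - int a"
  have v1: "dg x \<ge> 1 \<Longrightarrow> int (p!i) * dg x \<ge> int (p!i)"
    using mult_left_mono[of 1 "dg x" "int (p!i)"] by simp
  have v2: "dg x \<le> -1 \<Longrightarrow> int (p!i) * dg x \<le> - int (p!i)"
    using mult_left_mono[of "dg x" "-1" "int (p!i)"] by simp
  have v: "?v \<noteq> 0" "?v > 0 \<longleftrightarrow> (if a < b then dg x \<ge> 0 else dg x \<ge> 1)"
  proof -
    have "dg x \<ge> 1 \<or> dg x = 0 \<or> dg x \<le> -1" by linarith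
    then have "?v \<noteq> 0 \<and> (?v > 0 \<longleftrightarrow> (if a < b then dg x \<ge> 0 else dg x \<ge> 1))"
    proof (elim disjE)
      assume d: "dg x \<ge> 1"
      then have "?v > 0" using v1[OF d] i by linarith
      then show ?thesis using d by auto
    next
      assume "dg x = 0"
      then show ?thesis using i by auto
    next
      assume d: "dg x \<le> -1"
      then have "?v < 0" using v2[OF d] i by linarith
      then show ?thesis using d by auto
    qed
    then show "?v \<noteq> 0" "?v > 0 \<longleftrightarrow> (if a < b then dg x \<ge> 0 else dg x \<ge> 1)" by auto
  qed
  show "deg x \<noteq> 0" "deg x > 0 \<longleftrightarrow> (if a < b then dg x \<ge> 0 else dg x \<ge> 1)"
    using v P by (simp_all add: chi_torsion(3)[OF x torsion_K[OF x]] zero_less_mult_iff)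
qed

lemma charge_nonzero: "root x \<Longrightarrow> rk x \<noteq> 0 \<or> deg x \<noteq> 0"
  using root_rank_0 deg_torsion_nonzero(1) by metis

lemma torsion_neg: "torsion x i a b \<Longrightarrow> torsion (comb x (-2) x) i b a"
  by (simp add: torsion_def)

lemma root_neg: "root x \<Longrightarrow> root (comb x (-2) x)"
  by (simp add: root_def comb_K chi_comb_left chi_comb_right)

text \<open>Intervals in a cyclically ordered set, cut open at q.\<close>

text \<open>
  The cycle of simple objects of a tube is cut open at a point \<open>q\<close> and unrolled to \<open>{q..<q + p ! i}\<close>. The integer \<open>A\<close> in this range,
  or equal to \<open>q + p ! i\<close>, represents this element of the cycle.
\<close>

definition residue :: "nat \<Rightarrow> int \<Rightarrow> int" where
  "residue i A = (if A < int (p!i) then A else A - int (p!i))"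

text \<open>
  \<open>x\<close> is \<open>s\<close> times the class of the interval \<open>[A, B)\<close>.
\<close>

definition arc :: "nat \<Rightarrow> int \<Rightarrow> int \<Rightarrow> kclass \<Rightarrow> int \<Rightarrow> int \<Rightarrow> bool" where
  "arc i q s x A B \<longleftrightarrow> 0 \<le> q \<and> q < int (p!i) \<and> q \<le> A \<and> A < B \<and> B \<le> q + int (p!i) \<and> \<not> (A = q \<and> B = q + int (p!i)) \<and>
     (\<exists>a b. int a = residue i A \<and> int b = residue i B \<and>
        (s = 1 \<and> torsion x i a b \<or> s = -1 \<and> torsion x i b a)) \<and>
     deg x = s * (int (N div p!i) * (B - A))"

lemma psum_torsion:
  assumes "torsion x i a b" "n \<le> p!i"
  shows "psum x i n = of_bool (a < n) - of_bool (b < n)"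
proof -
  have "psum x i n = (\<Sum>j<n. (if j = a then 1 else 0) - (if j = b then 1 else 0))"
    unfolding psum_def using assms by (intro sum.cong) (auto simp: torsion_def)
  then show ?thesis by (simp add: sum_subtractf)
qed

lemma chi_arc:
  assumes x: "arc i q s x A B" and y: "arc i q s' y C D"
  shows "chi x y = s * s' * arc_chi q (q + int (p!i)) A B C D"
proof -
  define g :: "int \<Rightarrow> int \<Rightarrow> int \<Rightarrow> int \<Rightarrow> int" where
    "g a b c d = of_bool (a < d) - of_bool (b < d) - of_bool (a < c) + of_bool (b < c)" for a b c d
  have chi: "chi x y = g (int a) (int b) (int c) (int d)" if "torsion x i a b" "torsion y i c d" for a b c d
    using chi_torsion(1)[OF that(2) torsion_K[OF that(1)]] psum_torsion[OF that(1)] that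
    by (simp add: torsion_def g_def)
  have g: "g (residue i A) (residue i B) (residue i C) (residue i D) = arc_chi q (q + int (p!i)) A B C D"
    using x y unfolding arc_def g_def arc_chi_def residue_def
    by (auto simp: of_bool_def)
  have swap: "g b a c d = - g a b c d" "g a b d c = - g a b c d" for a b c d by (simp_all add: g_def)
  obtain a b where ab: "int a = residue i A" "int b = residue i B" "s = 1 \<and> torsion x i a b \<or> s = -1 \<and> torsion x i b a"
    using x by (auto simp: arc_def)
  obtain c d where cd: "int c = residue i C" "int d = residue i D" "s' = 1 \<and> torsion y i c d \<or> s' = -1 \<and> torsion y i d c"
    using y by (auto simp: arc_def)
  show ?thesis
    using ab cd chi[of a b c d] chi[of b a c d] chi[of a b d c] chi[of b a d c] swap[of "int b" "int a" "int c" "int d"]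
      swap[of "int a" "int b" "int d" "int c"] swap[of "int b" "int a" "int d" "int c"]  swap[of "int a" "int b" "int c" "int d"] g
    by auto
qed

end

text \<open>
  The inequality \<open>kappa\<close> says that the genus is at most \<open>1\<close>. The second assumption holds for classes of vector
  bundles; for roots of positive rank it has to be derived from the shape of the roots.
\<close>

locale semistable_weights = weights +
  assumes kappa: "(int t - 2) * int N \<le> (\<Sum>i<t. int (N div p!i))"
    and mult_nonneg: "root x \<Longrightarrow> rk x > 0 \<Longrightarrow> i < t \<Longrightarrow> j < p!i \<Longrightarrow> 0 \<le> mu x i j"
begin

text \<open>
  By the norm formula and the Cauchy--Schwarz inequality for each row.
\<close>

lemma chi_nonneg:
  assumes "x \<in> K" shows "0 \<le> chi x x"
proof -
  have "(\<Sum>i<t. int (N div p!i) * (rk x)\<^sup>2) \<le> (\<Sum>i<t. int N * (\<Sum>j<p!i. (mu x i j)\<^sup>2))"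
  proof (intro sum_mono)
    fix i assume "i \<in> {..<t}"
    then have i: "i < t" by simp
    have "(rk x)\<^sup>2 \<le> int (p!i) * (\<Sum>j<p!i. (mu x i j)\<^sup>2)"
      using sum_squares_mean[of "mu x i" "p!i"] assms i by (simp add: K_def)
    then have "int (N div p!i) * (rk x)\<^sup>2 \<le> int (N div p!i) * (int (p!i) * (\<Sum>j<p!i. (mu x i j)\<^sup>2))"
      by (intro mult_left_mono) auto
    also have "\<dots> = int N * (\<Sum>j<p!i. (mu x i j)\<^sup>2)"
      using dvd_N[OF i] by (metis dvd_div_mult_self mult.assoc of_nat_mult)
    finally show "int (N div p!i) * (rk x)\<^sup>2 \<le> int N * (\<Sum>j<p!i. (mu x i j)\<^sup>2)" .
  qed
  moreover have "(int t - 2) * int N * (rk x)\<^sup>2 \<le> (\<Sum>i<t. int (N div p!i)) * (rk x)\<^sup>2"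
    by (intro mult_right_mono kappa) auto
  ultimately have "0 \<le> int N * (2 * chi x x)"
    unfolding norm_formula[OF assms] by (simp add: sum_distrib_left sum_distrib_right algebra_simps)
  then show ?thesis using N_pos by (simp add: zero_le_mult_iff)
qed

context
  fixes w assumes w: "root w" "rk w > 0"
begin

lemma psum_mono: "i < t \<Longrightarrow> a \<le> b \<Longrightarrow> b \<le> p!i \<Longrightarrow> psum w i a \<le> psum w i b"
  unfolding psum_def using mult_nonneg[OF w] by (intro sum_mono2) auto

lemma psum_strict:
  assumes "i < t" "a \<le> j" "j < b" "b \<le> p!i" "mu w i j > 0"
  shows "psum w i a < psum w i b"
  using psum_mono[of i a j] psum_mono[of i "Suc j" b] assms by (simp add: psum_def)

lemma psum_bounds: "i < t \<Longrightarrow> a \<le> p!i \<Longrightarrow> 0 \<le> psum w i a \<and> psum w i a \<le> rk w"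
  using psum_mono[of i 0 a] psum_mono[of i a "p!i"] psum_total[of w i] w by (simp add: psum_def root_def)

text \<open>
  Stability between a root of positive rank and a torsion class: the partial sums of a row of \<open>w\<close> increase from \<open>0\<close> to the rank.
\<close>

lemma torsion_positive:
  assumes x: "torsion x i a b" and d: "deg x > 0"
  shows "0 \<le> chi w x" "chi x w \<le> 0"
proof -
  have i: "i < t" "a < p!i" "b < p!i" "a \<noteq> b" using x by (auto simp: torsion_def)
  have wK: "w \<in> K" using w by (simp add: root_def)
  have m: "dg x \<ge> 0 \<Longrightarrow> 0 \<le> rk w * dg x" "dg x \<ge> 1 \<Longrightarrow> rk w \<le> rk w * dg x"
    using w mult_left_mono[of 1 "dg x" "rk w"] by simp_all
  show "0 \<le> chi w x"
  proof (cases "a < b")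
    case True
    then have "0 \<le> rk w * dg x" using deg_torsion_nonzero(2)[OF x] d m by simp
    then show ?thesis using psum_mono[of i a b] True i unfolding chi_torsion(1)[OF x wK] by simp
  next
    case False
    then have "rk w \<le> rk w * dg x" using deg_torsion_nonzero(2)[OF x] d m by simp
    then show ?thesis using psum_bounds[of i a] psum_bounds[of i b] i unfolding chi_torsion(1)[OF x wK] by simp
  qed
  show "chi x w \<le> 0"
  proof (cases "a < b")
    case True
    then have "0 \<le> rk w * dg x" using deg_torsion_nonzero(2)[OF x] d m by simp
    then show ?thesis using psum_mono[of i "Suc a" "Suc b"] True i unfolding chi_torsion(2)[OF x wK] by simp
  next
    case False
    then have "rk w \<le> rk w * dg x" using deg_torsion_nonzero(2)[OF x] d m by simp
    then show ?thesis using psum_bounds[of i "Suc a"] psum_bounds[of i "Suc b"] i unfolding chi_torsion(2)[OF x wK] by simp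
  qed
qed

lemma exists_mult:
  assumes "i < t" obtains q where "q < p!i" "mu w i q > 0"
proof -
  have "\<exists>q<p!i. mu w i q > 0"
  proof (rule ccontr)
    assume "\<not> ?thesis"
    then have "(\<Sum>j<p!i. mu w i j) \<le> 0" by (intro sum_nonpos) (meson lessThan_iff not_less)
    then show False using w assms by (simp add: root_def K_def)
  qed
  then show ?thesis using that by blast
qed

text \<open>
  A root \<open>w\<close> of positive rank has a nonzero multiplicity at some \<open>q\<close>. The value \<open>chi w x\<close> adds up the multiplicities of \<open>w\<close> along
  the interval of \<open>x\<close>, so if it vanishes then this interval stays away from \<open>q\<close>, and the cycle can be cut there. The two
  directions of orthogonality differ by a shift of the interval by one, hence exclude different ends.
\<close>

lemma torsion_arc_pos:
  assumes x: "torsion x i a b" and d: "deg x > 0" and q: "q < p!i" "mu w i q > 0"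
  shows "chi w x = 0 \<Longrightarrow> \<exists>A B. arc i (int q) 1 x A B \<and> int q < A"
    and "chi x w = 0 \<Longrightarrow> \<exists>A B. arc i (int q) 1 x A B \<and> B < int q + int (p!i)"
proof -
  let ?p = "int (p!i)"
  have i: "i < t" "a < p!i" "b < p!i" "a \<noteq> b" using x by (auto simp: torsion_def)
  have wK: "w \<in> K" using w by (simp add: root_def)
  have m: "dg x \<ge> 1 \<Longrightarrow> rk w \<le> rk w * dg x" "dg x \<ge> 2 \<Longrightarrow> rk w < rk w * dg x"
    using w mult_left_mono[of 1 "dg x" "rk w"] mult_left_mono[of 2 "dg x" "rk w"] by simp_all
  note D = deg_torsion_nonzero(2)[OF x]
  have deg: "deg x = int (N div p!i) * (?p * dg x + int b - int a)"
    by (rule chi_torsion(3)[OF x wK])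
  have arcI: "arc i (int q) 1 x A B"
    if "int q \<le> A" "A < B" "B \<le> int q + ?p" "\<not> (A = int q \<and> B = int q + ?p)" "int a = residue i A" "int b = residue i B"
      "B - A = ?p * dg x + int b - int a" for A B
    unfolding arc_def using that x q deg by auto
  show "\<exists>A B. arc i (int q) 1 x A B \<and> int q < A" if z: "chi w x = 0"
  proof (cases "a < b")
    case True
    have z': "rk w * dg x + (psum w i b - psum w i a) = 0" using z chi_torsion(1)[OF x wK] by simp
    have "dg x \<ge> 0" using True D d by simp
    moreover have "psum w i b - psum w i a \<ge> 0" using psum_mono[of i a b] True i by simp
    moreover have "dg x \<noteq> 0 \<Longrightarrow> dg x \<ge> 0 \<Longrightarrow> rk w \<le> rk w * dg x" using m by simp
    ultimately have e0: "dg x = 0" using z' w by linarith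
    then have e: "dg x = 0" "psum w i b = psum w i a" using z' by simp_all
    have "q < a \<or> b \<le> q" using psum_strict[OF i(1), of a q b] q e i by force
    then show ?thesis
    proof
      assume "q < a"
      then show ?thesis using arcI[of "int a" "int b"] True i e by (intro exI[of _ "int a"] exI[of _ "int b"]) (simp add: residue_def)
    next
      assume "b \<le> q"
      then show ?thesis using arcI[of "int a + ?p" "int b + ?p"] True i e q
        by (intro exI[of _ "int a + ?p"] exI[of _ "int b + ?p"]) (simp add: residue_def)
    qed
  next
    case False
    then have ba: "b < a" using i by simp
    have z': "rk w * dg x = psum w i a - psum w i b" using z chi_torsion(1)[OF x wK] by simp
    have "dg x \<ge> 1" using False D d by simp
    moreover have "psum w i a - psum w i b \<le> rk w" using psum_bounds[of i a] psum_bounds[of i b] i by simp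
    ultimately have e0: "dg x = 1" using z' m w by linarith
    then have e: "dg x = 1" "psum w i a = rk w" "psum w i b = 0"
      using z' psum_bounds[of i a] psum_bounds[of i b] i by simp_all
    have "b \<le> q" using psum_strict[OF i(1), of 0 q b] q e i by (force simp: psum_def)
    moreover have "q < a" using psum_strict[OF i(1), of a q "p!i"] q e i psum_total[OF wK i(1)] by force
    ultimately show ?thesis using arcI[of "int a" "int b + ?p"] e i ba
      by (intro exI[of _ "int a"] exI[of _ "int b + ?p"]) (simp add: residue_def)
  qed
  show "\<exists>A B. arc i (int q) 1 x A B \<and> B < int q + ?p" if z: "chi x w = 0"
  proof (cases "a < b")
    case True
    have z': "rk w * dg x + (psum w i (Suc b) - psum w i (Suc a)) = 0" using z chi_torsion(2)[OF x wK] by simp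
    have "dg x \<ge> 0" using True D d by simp
    moreover have "psum w i (Suc b) - psum w i (Suc a) \<ge> 0" using psum_mono[of i "Suc a" "Suc b"] True i by simp
    moreover have "dg x \<noteq> 0 \<Longrightarrow> dg x \<ge> 0 \<Longrightarrow> rk w \<le> rk w * dg x" using m by simp
    ultimately have e0: "dg x = 0" using z' w by linarith
    then have e: "dg x = 0" "psum w i (Suc b) = psum w i (Suc a)" using z' by simp_all
    have "q \<le> a \<or> b < q" using psum_strict[OF i(1), of "Suc a" q "Suc b"] q e i by force
    then show ?thesis
    proof
      assume "q \<le> a"
      then show ?thesis using arcI[of "int a" "int b"] True i e by (intro exI[of _ "int a"] exI[of _ "int b"]) (simp add: residue_def)
    next
      assume "b < q"
      then show ?thesis using arcI[of "int a + ?p" "int b + ?p"] True i e q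
        by (intro exI[of _ "int a + ?p"] exI[of _ "int b + ?p"]) (simp add: residue_def)
    qed
  next
    case False
    then have ba: "b < a" using i by simp
    have z': "rk w * dg x = psum w i (Suc a) - psum w i (Suc b)" using z chi_torsion(2)[OF x wK] by simp
    have "dg x \<ge> 1" using False D d by simp
    moreover have "psum w i (Suc a) - psum w i (Suc b) \<le> rk w" using psum_bounds[of i "Suc a"] psum_bounds[of i "Suc b"] i by simp
    ultimately have e0: "dg x = 1" using z' m w by linarith
    then have e: "dg x = 1" "psum w i (Suc a) = rk w" "psum w i (Suc b) = 0"
      using z' psum_bounds[of i "Suc a"] psum_bounds[of i "Suc b"] i by simp_all
    have "b < q" using psum_strict[OF i(1), of 0 q "Suc b"] q e i by (force simp: psum_def)
    moreover have "q \<le> a" using psum_strict[OF i(1), of "Suc a" q "p!i"] q e i psum_total[OF wK i(1)] by force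
    ultimately show ?thesis using arcI[of "int a" "int b + ?p"] e i ba
      by (intro exI[of _ "int a"] exI[of _ "int b + ?p"]) (simp add: residue_def)
  qed
qed

end

lemma torsion_arc:
  assumes w: "root w" "rk w \<noteq> 0" and i: "i < t"
  obtains q where "q < p!i"
    "\<And>x a b. torsion x i a b \<Longrightarrow> chi w x = 0 \<Longrightarrow> \<exists>A B. arc i (int q) (sgn (deg x)) x A B \<and> int q < A"
    "\<And>x a b. torsion x i a b \<Longrightarrow> chi x w = 0 \<Longrightarrow> \<exists>A B. arc i (int q) (sgn (deg x)) x A B \<and> B < int q + int (p!i)"
proof -
  \<comment> \<open>Up to signs of w and of x, this is the case of positive rank and positive degree.\<close>
  define w' where "w' = (if rk w > 0 then w else comb w (-2) w)"
  have w': "root w'" "rk w' > 0" using w root_neg[OF w(1)] by (auto simp: w'_def)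
  obtain q where q: "q < p!i" "mu w' i q > 0" using exists_mult[OF w' i] by blast
  have z: "chi w x = 0 \<Longrightarrow> chi w' x = 0" "chi x w = 0 \<Longrightarrow> chi x w' = 0" for x
    by (auto simp: w'_def chi_comb_left chi_comb_right)
  have neg: "arc i (int q) (-1) x A B" if "arc i (int q) 1 (comb x (-2) x) A B" for x A B
  proof -
    have "torsion x i b a" if t: "torsion (comb x (-2) x) i a b" for a b
    proof -
      have "mu x i' j = (if i' = i then (if j = b then 1 else 0) - (if j = a then 1 else 0) else 0)"
        if "i' < t" "j < p!i'" for i' j
      proof -
        have "- mu x i' j = (if i' = i then (if j = a then 1 else 0) - (if j = b then 1 else 0) else 0)"
          using t that by (simp add: torsion_def)
        then show ?thesis by (auto split: if_splits)
      qed
      then show ?thesis using t by (auto simp: torsion_def)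
    qed
    then show ?thesis using that unfolding arc_def by (auto simp: deg_comb)
  qed
  show ?thesis
  proof (rule that[OF q(1)])
    fix x a b assume x: "torsion x i a b"
    have d: "deg x \<noteq> 0" by (rule deg_torsion_nonzero(1)[OF x])
    let ?y = "comb x (-2) x"
    have y: "torsion ?y i b a" "deg ?y = - deg x" "chi w' ?y = - chi w' x" "chi ?y w' = - chi x w'"
      using torsion_neg[OF x] by (simp_all add: deg_comb chi_comb_left chi_comb_right)
    show "\<exists>A B. arc i (int q) (sgn (deg x)) x A B \<and> int q < A" if "chi w x = 0"
      using torsion_arc_pos(1)[OF w' x _ q] torsion_arc_pos(1)[OF w' y(1) _ q] neg[of x] d y z(1)[OF that]
      by (cases "deg x > 0") force+
    show "\<exists>A B. arc i (int q) (sgn (deg x)) x A B \<and> B < int q + int (p!i)" if "chi x w = 0"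
      using torsion_arc_pos(2)[OF w' x _ q] torsion_arc_pos(2)[OF w' y(1) _ q] neg[of x] d y z(2)[OF that]
      by (cases "deg x > 0") force+
  qed
qed

lemma S_rank_0: "rk x = 0 \<Longrightarrow> S w x = rk w * deg x" by (simp add: S_def)

lemma line_rank_0:
  assumes "root k" "rk k = 0" "S k i = 0" shows "rk i = 0"
  using assms charge_nonzero[of k] by (simp add: S_def)

lemma arc_ivl: "arc i q s x A B \<Longrightarrow> ivl q (q + int (p!i)) A B" by (simp add: arc_def)

lemma arc_deg_scale:
  assumes "i < t" obtains n :: int where "n > 0" "\<And>q s x A B. arc i q s x A B \<Longrightarrow> deg x = s * (n * (B - A))"
proof -
  have "int (N div p!i) > 0" using dvd_N[OF assms] N_pos p_pos[OF assms]
    by (simp add: dvd_imp_le div_greater_zero_iff)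
  then show ?thesis by (intro that[of "int (N div p!i)"]) (simp_all add: arc_def)
qed

lemma rank_0_acyclic:
  assumes w: "root w" and x: "root x" and y: "root y" and rx: "rk x = 0"
  shows "acyclic_at chi S w x y"
  unfolding acyclic_at_def
proof (intro impI)
  assume h: "S x y = 0" "0 < S w x * S w y" "separates chi w {x, y} {}" "chi x y < 0" "chi y x < 0"
  have ry: "rk y = 0" by (rule line_rank_0[OF x rx h(1)])
  have rw: "rk w \<noteq> 0" using h(2) S_rank_0[OF rx] by auto
  obtain i a b where tx: "torsion x i a b" by (rule root_rank_0[OF x rx])
  obtain i' c d where ty: "torsion y i' c d" by (rule root_rank_0[OF y ry])
  have ii: "i' = i" using chi_torsion_other[OF tx ty] h by auto
  have it: "i < t" using tx by (simp add: torsion_def)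
  obtain q where q:
    "\<And>x a b. torsion x i a b \<Longrightarrow> chi w x = 0 \<Longrightarrow> \<exists>A B. arc i (int q) (sgn (deg x)) x A B \<and> int q < A"
    "\<And>x a b. torsion x i a b \<Longrightarrow> chi x w = 0 \<Longrightarrow> \<exists>A B. arc i (int q) (sgn (deg x)) x A B \<and> B < int q + int (p!i)"
    using torsion_arc[OF w rw it] by metis
  have "0 < (rk w)\<^sup>2 * (deg x * deg y)"
    using h(2) S_rank_0[OF rx] S_rank_0[OF ry] by (simp add: power2_eq_square mult_ac)
  then have sg: "deg x * deg y > 0" using rw by (simp add: zero_less_mult_iff)
  then have ss: "sgn (deg x) * sgn (deg y) = 1" "sgn (deg y) * sgn (deg x) = 1"
    by (simp_all add: sgn_mult[symmetric] mult.commute)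
  have "\<exists>A B C D. arc i (int q) (sgn (deg x)) x A B \<and> arc i (int q) (sgn (deg y)) y C D \<and>
     ((int q < A \<and> int q < C) \<or> (B < int q + int (p!i) \<and> D < int q + int (p!i)))"
    using h(3) q(1)[OF tx] q(2)[OF tx] q(1)[OF ty[unfolded ii]] q(2)[OF ty[unfolded ii]]
    by (auto simp: separates_def)
  then obtain A B C D where A: "arc i (int q) (sgn (deg x)) x A B" "arc i (int q) (sgn (deg y)) y C D"
     "(int q < A \<and> int q < C) \<or> (B < int q + int (p!i) \<and> D < int q + int (p!i))" by blast
  show False
    using ivl_acyclic[OF arc_ivl[OF A(1)] arc_ivl[OF A(2)] A(3)] h(4,5)
    unfolding chi_arc[OF A(1,2)] chi_arc[OF A(2,1)] ss by simp
qed

context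
  fixes w k i j
  assumes w: "root w" and k: "root k" and i: "root i" and j: "root j" and rk_k: "rk k = 0"
    and ki: "S k i = 0" and kj: "S k j = 0" and opp: "S w k * S w i < 0"
begin

lemma rank_0_all: "rk i = 0" "rk j = 0" "rk w \<noteq> 0"
  using line_rank_0[OF k rk_k] ki kj opp S_rank_0[OF rk_k] by auto

lemma rank_0_signs:
  "sgn (deg i) = - sgn (deg k)" "sgn (deg k) \<in> {1, -1}"
  "S w k * S w j > 0 \<Longrightarrow> sgn (deg j) = sgn (deg k)" "S w k * S w j < 0 \<Longrightarrow> sgn (deg j) = - sgn (deg k)"
proof -
  have sq: "(rk w)\<^sup>2 > 0" using rank_0_all by simp
  have e: "S w k * S w x = (rk w)\<^sup>2 * (deg k * deg x)" if "rk x = 0" for x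
    using S_rank_0[OF rk_k] S_rank_0[OF that] by (simp add: power2_eq_square mult_ac)
  have "deg k * deg i < 0" using opp e[OF rank_0_all(1)] sq by (simp add: mult_less_0_iff)
  then show "sgn (deg i) = - sgn (deg k)" "sgn (deg k) \<in> {1, -1}" by (auto simp: mult_less_0_iff sgn_if)
  show "sgn (deg j) = sgn (deg k)" if "S w k * S w j > 0"
  proof -
    have "deg k * deg j > 0" using that e[OF rank_0_all(2)] sq by (simp add: zero_less_mult_iff)
    then show ?thesis by (auto simp: zero_less_mult_iff sgn_if)
  qed
  show "sgn (deg j) = - sgn (deg k)" if "S w k * S w j < 0"
  proof -
    have "deg k * deg j < 0" using that e[OF rank_0_all(2)] sq by (simp add: mult_less_0_iff)
    then show ?thesis by (auto simp: mult_less_0_iff sgn_if)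
  qed
qed

text \<open>
  Whether \<open>i + b k\<close> lies on the ray of \<open>k\<close> or on the opposite one is decided by the lengths of the intervals.
\<close>

lemma rank_0_flip:
  assumes "arc n q (sgn (deg k)) k A B" "arc n q (- sgn (deg k)) x C D" "rk x = 0" "n < t"
  shows "S w k * (S w x + b * S w k) > 0 \<longleftrightarrow> D - C < b * (B - A)"
    "S w k * (S w x + b * S w k) < 0 \<longleftrightarrow> b * (B - A) < D - C"
proof -
  obtain n where n: "n > 0" "deg k = sgn (deg k) * (n * (B - A))" "deg x = - sgn (deg k) * (n * (D - C))"
    using arc_deg_scale[OF assms(4)] assms(1,2) by metis
  have BA: "B - A > 0" using assms(1) by (simp add: arc_def)
  have ss: "sgn (deg k) * sgn (deg k) = 1" using rank_0_signs(2) by auto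
  have "S w k * (S w x + b * S w k) = (rk w)\<^sup>2 * (deg k * (deg x + b * deg k))"
    using S_rank_0[OF rk_k] S_rank_0[OF assms(3)] by (simp add: power2_eq_square algebra_simps)
  also have "deg k * (deg x + b * deg k) = (sgn (deg k) * sgn (deg k)) * (n\<^sup>2 * (B - A) * (b * (B - A) - (D - C)))"
    by (subst n(2), subst n(3), subst (3) n(2)) (simp add: power2_eq_square algebra_simps)
  finally have e: "S w k * (S w x + b * S w k) = ((rk w)\<^sup>2 * (n\<^sup>2 * (B - A))) * (b * (B - A) - (D - C))"
    unfolding ss by (simp add: mult_ac)
  have "(rk w)\<^sup>2 * (n\<^sup>2 * (B - A)) > 0" using rank_0_all n BA by simp
  then show "S w k * (S w x + b * S w k) > 0 \<longleftrightarrow> D - C < b * (B - A)"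
    "S w k * (S w x + b * S w k) < 0 \<longleftrightarrow> b * (B - A) < D - C"
    unfolding e by (simp_all add: zero_less_mult_iff mult_less_0_iff)
qed

text \<open>
  Members \<open>k\<close> and \<open>i\<close> that interact lie in the same tube. A member \<open>j\<close> in another tube is orthogonal to both;
  otherwise one point \<open>q\<close> serves to cut open the cycle for all three of them.
\<close>

lemma rank_0_arcs:
  assumes "chi i k \<noteq> 0 \<or> chi k i \<noteq> 0"
  obtains (other) "chi i j = 0" "chi j i = 0" "chi k j = 0" "chi j k = 0"
  | (arcs) n q where "n < t"
     "chi w k = 0 \<Longrightarrow> \<exists>A B. arc n q (sgn (deg k)) k A B \<and> q < A"
     "chi k w = 0 \<Longrightarrow> \<exists>A B. arc n q (sgn (deg k)) k A B \<and> B < q + int (p!n)"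
     "chi w i = 0 \<Longrightarrow> \<exists>A B. arc n q (sgn (deg i)) i A B \<and> q < A"
     "chi i w = 0 \<Longrightarrow> \<exists>A B. arc n q (sgn (deg i)) i A B \<and> B < q + int (p!n)"
     "chi w j = 0 \<Longrightarrow> \<exists>A B. arc n q (sgn (deg j)) j A B \<and> q < A"
     "chi j w = 0 \<Longrightarrow> \<exists>A B. arc n q (sgn (deg j)) j A B \<and> B < q + int (p!n)"
proof -
  obtain n a b where tk: "torsion k n a b" by (rule root_rank_0[OF k rk_k])
  obtain n' c d where ti: "torsion i n' c d" by (rule root_rank_0[OF i rank_0_all(1)])
  obtain m e f where tj: "torsion j m e f" by (rule root_rank_0[OF j rank_0_all(2)])
  have n': "n' = n" using chi_torsion_other[OF tk ti] chi_torsion_other[OF ti tk] assms by auto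
  have nt: "n < t" using tk by (simp add: torsion_def)
  show ?thesis
  proof (cases "m = n")
    case False
    then show ?thesis
      using other chi_torsion_other[OF tk tj] chi_torsion_other[OF tj tk] chi_torsion_other[OF ti tj]
        chi_torsion_other[OF tj ti] n' by metis
  next
    case True
    show ?thesis
    proof (rule torsion_arc[OF w rank_0_all(3) nt])
      fix q
      assume q: "\<And>x a b. torsion x n a b \<Longrightarrow> chi w x = 0 \<Longrightarrow> \<exists>A B. arc n (int q) (sgn (deg x)) x A B \<and> int q < A"
        "\<And>x a b. torsion x n a b \<Longrightarrow> chi x w = 0 \<Longrightarrow> \<exists>A B. arc n (int q) (sgn (deg x)) x A B \<and> B < int q + int (p!n)"
      show thesis
        by (rule arcs[OF nt q(1)[OF tk] q(2)[OF tk] q(1)[OF ti[unfolded n']] q(2)[OF ti[unfolded n']]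
           q(1)[OF tj[unfolded True]] q(2)[OF tj[unfolded True]]])
    qed
  qed
qed

end

text \<open>
  All classes are signed intervals in one tube, cut open so that \<open>separates\<close> translates into the ends they avoid. The interval
  lemmas then give the three conclusions, with \<open>b = 1\<close> because nonzero maps between intervals are unique up to scalars.
\<close>

lemma rank_0_hereditary:
  assumes w: "root w" and k: "root k" and i: "root i" and j: "root j" and rk_k: "rk k = 0"
  shows "hereditary_at chi S w k i j b"
  unfolding hereditary_at_def
proof (intro impI)
  assume h: "S k i = 0" "S k j = 0" "S w k * S w i < 0" "chi k i = 0" "chi i k = - b" "0 < b"
  note ctx = w k i j rk_k h(1-3)
  let ?s = "sgn (deg k)"
  note sg = rank_0_signs[OF ctx]
  have ss: "?s * ?s = 1" "\<And>z. ?s * (?s * z) = z" using sg(2) by auto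
  have dk: "deg k \<noteq> 0" using sg(2) by auto
  have ne: "chi i k \<noteq> 0 \<or> chi k i \<noteq> 0" using h by auto
  note all0 = rank_0_all[OF ctx]
  show "(separates chi w {k, j} {i} \<longrightarrow> S w k * S w j > 0 \<longrightarrow> chi j k \<le> 0 \<longrightarrow> chi k j \<le> 0 \<longrightarrow> chi j i = 0 \<longrightarrow>
        S w k * (S w i + b * S w k) > 0 \<longrightarrow> chi i j + b * chi k j \<le> 0) \<and>
     (separates chi w {k} {i, j} \<longrightarrow> S w k * S w j < 0 \<longrightarrow> chi k j = 0 \<longrightarrow> chi i j \<le> 0 \<longrightarrow> chi j i \<le> 0 \<longrightarrow>
        (S w k * (S w i + b * S w k) > 0 \<longrightarrow> S w k * (S w j + max 0 (- chi j k) * S w k) < 0 \<longrightarrow> chi i j = 0) \<and>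
        (S w k * (S w i + b * S w k) < 0 \<longrightarrow> chi j k \<ge> 0 \<longrightarrow> chi j i + b * chi j k \<le> 0))"
  proof (rule rank_0_arcs[OF ctx ne])
    assume "chi i j = 0" "chi j i = 0" "chi k j = 0" "chi j k = 0"
    then show ?thesis by simp
  next
    fix n q
    let ?r = "q + int (p!n)"
    assume nt: "n < t"
      and arcs: "chi w k = 0 \<Longrightarrow> \<exists>A B. arc n q ?s k A B \<and> q < A"
     "chi k w = 0 \<Longrightarrow> \<exists>A B. arc n q ?s k A B \<and> B < ?r"
     "chi w i = 0 \<Longrightarrow> \<exists>A B. arc n q (sgn (deg i)) i A B \<and> q < A"
     "chi i w = 0 \<Longrightarrow> \<exists>A B. arc n q (sgn (deg i)) i A B \<and> B < ?r"
     "chi w j = 0 \<Longrightarrow> \<exists>A B. arc n q (sgn (deg j)) j A B \<and> q < A"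
     "chi j w = 0 \<Longrightarrow> \<exists>A B. arc n q (sgn (deg j)) j A B \<and> B < ?r"
    have 1: "chi i j + b * chi k j \<le> 0"
      if sep: "separates chi w {k, j} {i}" and side: "S w k * S w j > 0"
        and z: "chi j k \<le> 0" "chi k j \<le> 0" "chi j i = 0" and flip: "S w k * (S w i + b * S w k) > 0"
    proof -
      have "\<exists>A B C D E F. arc n q ?s k A B \<and> arc n q (- ?s) i C D \<and> arc n q ?s j E F \<and>
        ((q < A \<and> q < C \<and> q < E) \<or> (B < ?r \<and> D < ?r \<and> F < ?r) \<or> (B < ?r \<and> F < ?r \<and> q < C))"
        using sep arcs sg(1) sg(3)[OF side] unfolding separates_def by (simp; metis)
      then obtain A B C D E F where arc: "arc n q ?s k A B" "arc n q (- ?s) i C D" "arc n q ?s j E F"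
        and win: "(q < A \<and> q < C \<and> q < E) \<or> (B < ?r \<and> D < ?r \<and> F < ?r) \<or> (B < ?r \<and> F < ?r \<and> q < C)" by blast
      note V = arc_ivl[OF arc(1)] arc_ivl[OF arc(2)] arc_ivl[OF arc(3)]
      have c: "chi k i = - arc_chi q ?r A B C D" "chi i k = - arc_chi q ?r C D A B"
        "chi k j = arc_chi q ?r A B E F" "chi j k = arc_chi q ?r E F A B"
        "chi i j = - arc_chi q ?r C D E F" "chi j i = - arc_chi q ?r E F C D"
        using chi_arc[OF arc(1,2)] chi_arc[OF arc(2,1)] chi_arc[OF arc(1,3)] chi_arc[OF arc(3,1)] chi_arc[OF arc(2,3)] chi_arc[OF arc(3,2)]
        by (simp_all add: ss dk)
      have b: "b = 1" using ivl_hom(1)[OF V(1,2)] win h(4-6) c by auto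
      have len: "B - A > D - C" using rank_0_flip(1)[OF ctx arc(1,2) all0(1) nt, of b] flip b by simp
      show ?thesis
        using ivl_quotient[OF V win _ _ len] h(4-6) z c b by simp
    qed
    have 2: "(S w k * (S w i + b * S w k) > 0 \<longrightarrow> chi i j = 0) \<and>
        (S w k * (S w i + b * S w k) < 0 \<longrightarrow> chi j k \<ge> 0 \<longrightarrow> chi j i + b * chi j k \<le> 0)"
      if sep: "separates chi w {k} {i, j}" and side: "S w k * S w j < 0"
        and z: "chi k j = 0" "chi i j \<le> 0" "chi j i \<le> 0"
    proof -
      have "\<exists>A B C D E F. arc n q ?s k A B \<and> arc n q (- ?s) i C D \<and> arc n q (- ?s) j E F \<and>
        ((q < A \<and> q < C \<and> q < E) \<or> (B < ?r \<and> D < ?r \<and> F < ?r) \<or> (B < ?r \<and> q < C \<and> q < E))"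
        using sep arcs sg(1) sg(4)[OF side] unfolding separates_def by (simp; metis)
      then obtain A B C D E F where arc: "arc n q ?s k A B" "arc n q (- ?s) i C D" "arc n q (- ?s) j E F"
        and win: "(q < A \<and> q < C \<and> q < E) \<or> (B < ?r \<and> D < ?r \<and> F < ?r) \<or> (B < ?r \<and> q < C \<and> q < E)" by blast
      note V = arc_ivl[OF arc(1)] arc_ivl[OF arc(2)] arc_ivl[OF arc(3)]
      have c: "chi k i = - arc_chi q ?r A B C D" "chi i k = - arc_chi q ?r C D A B"
        "chi k j = - arc_chi q ?r A B E F" "chi j k = - arc_chi q ?r E F A B"
        "chi i j = arc_chi q ?r C D E F" "chi j i = arc_chi q ?r E F C D"
        using chi_arc[OF arc(1,2)] chi_arc[OF arc(2,1)] chi_arc[OF arc(1,3)] chi_arc[OF arc(3,1)] chi_arc[OF arc(2,3)] chi_arc[OF arc(3,2)]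
        by (simp_all add: ss dk)
      have b: "b = 1" using ivl_hom(1)[OF V(1,2)] win h(4-6) c by auto
      have len: "S w k * (S w i + b * S w k) > 0 \<longleftrightarrow> B - A > D - C" "S w k * (S w i + b * S w k) < 0 \<longleftrightarrow> B - A < D - C"
        using rank_0_flip[OF ctx arc(1,2) all0(1) nt, of b] b by simp_all
      show ?thesis
        using ivl_extension[OF V win] ivl_kernel[OF V win] h(4-6) z c b len by auto
    qed
    show ?thesis using 1 2 by blast
  qed
qed

lemma rank_0_hereditary_op:
  assumes w: "root w" and k: "root k" and i: "root i" and j: "root j" and rk_k: "rk k = 0"
  shows "hereditary_at (\<lambda>x y. chi y x) S w k i j b"
  unfolding hereditary_at_def
proof (intro impI)
  assume h: "S k i = 0" "S k j = 0" "S w k * S w i < 0" "chi i k = 0" "chi k i = - b" "0 < b"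
  note ctx = w k i j rk_k h(1-3)
  let ?s = "sgn (deg k)"
  note sg = rank_0_signs[OF ctx]
  have ss: "?s * ?s = 1" "\<And>z. ?s * (?s * z) = z" using sg(2) by auto
  have dk: "deg k \<noteq> 0" using sg(2) by auto
  have ne: "chi i k \<noteq> 0 \<or> chi k i \<noteq> 0" using h by auto
  note all0 = rank_0_all[OF ctx]
  show "(separates (\<lambda>x y. chi y x) w {k, j} {i} \<longrightarrow> S w k * S w j > 0 \<longrightarrow> chi k j \<le> 0 \<longrightarrow> chi j k \<le> 0 \<longrightarrow> chi i j = 0 \<longrightarrow>
        S w k * (S w i + b * S w k) > 0 \<longrightarrow> chi j i + b * chi j k \<le> 0) \<and>
     (separates (\<lambda>x y. chi y x) w {k} {i, j} \<longrightarrow> S w k * S w j < 0 \<longrightarrow> chi j k = 0 \<longrightarrow> chi j i \<le> 0 \<longrightarrow> chi i j \<le> 0 \<longrightarrow>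
        (S w k * (S w i + b * S w k) > 0 \<longrightarrow> S w k * (S w j + max 0 (- chi k j) * S w k) < 0 \<longrightarrow> chi j i = 0) \<and>
        (S w k * (S w i + b * S w k) < 0 \<longrightarrow> chi k j \<ge> 0 \<longrightarrow> chi i j + b * chi k j \<le> 0))"
  proof (rule rank_0_arcs[OF ctx ne])
    assume "chi i j = 0" "chi j i = 0" "chi k j = 0" "chi j k = 0"
    then show ?thesis by simp
  next
    fix n q
    let ?r = "q + int (p!n)"
    assume nt: "n < t"
      and arcs: "chi w k = 0 \<Longrightarrow> \<exists>A B. arc n q ?s k A B \<and> q < A"
     "chi k w = 0 \<Longrightarrow> \<exists>A B. arc n q ?s k A B \<and> B < ?r"
     "chi w i = 0 \<Longrightarrow> \<exists>A B. arc n q (sgn (deg i)) i A B \<and> q < A"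
     "chi i w = 0 \<Longrightarrow> \<exists>A B. arc n q (sgn (deg i)) i A B \<and> B < ?r"
     "chi w j = 0 \<Longrightarrow> \<exists>A B. arc n q (sgn (deg j)) j A B \<and> q < A"
     "chi j w = 0 \<Longrightarrow> \<exists>A B. arc n q (sgn (deg j)) j A B \<and> B < ?r"
    have 1: "chi j i + b * chi j k \<le> 0"
      if sep: "separates (\<lambda>x y. chi y x) w {k, j} {i}" and side: "S w k * S w j > 0"
        and z: "chi k j \<le> 0" "chi j k \<le> 0" "chi i j = 0" and flip: "S w k * (S w i + b * S w k) > 0"
    proof -
      have "\<exists>A B C D E F. arc n q ?s k A B \<and> arc n q (- ?s) i C D \<and> arc n q ?s j E F \<and>
        ((q < A \<and> q < C \<and> q < E) \<or> (B < ?r \<and> D < ?r \<and> F < ?r) \<or> (q < A \<and> q < E \<and> D < ?r))"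
        using sep arcs sg(1) sg(3)[OF side] unfolding separates_def by (simp; metis)
      then obtain A B C D E F where arc: "arc n q ?s k A B" "arc n q (- ?s) i C D" "arc n q ?s j E F"
        and win: "(q < A \<and> q < C \<and> q < E) \<or> (B < ?r \<and> D < ?r \<and> F < ?r) \<or> (q < A \<and> q < E \<and> D < ?r)" by blast
      note V = arc_ivl[OF arc(1)] arc_ivl[OF arc(2)] arc_ivl[OF arc(3)]
      have c: "chi i k = - arc_chi q ?r C D A B" "chi k i = - arc_chi q ?r A B C D"
        "chi j k = arc_chi q ?r E F A B" "chi k j = arc_chi q ?r A B E F"
        "chi j i = - arc_chi q ?r E F C D" "chi i j = - arc_chi q ?r C D E F"
        using chi_arc[OF arc(1,2)] chi_arc[OF arc(2,1)] chi_arc[OF arc(1,3)] chi_arc[OF arc(3,1)] chi_arc[OF arc(2,3)] chi_arc[OF arc(3,2)]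
        by (simp_all add: ss dk)
      have b: "b = 1" using ivl_hom_op[OF V(1,2)] win h(4-6) c by auto
      have len: "B - A > D - C" using rank_0_flip(1)[OF ctx arc(1,2) all0(1) nt, of b] flip b by simp
      show ?thesis
        using ivl_quotient_op[OF V win _ _ len] h(4-6) z c b by simp
    qed
    have 2: "(S w k * (S w i + b * S w k) > 0 \<longrightarrow> chi j i = 0) \<and>
        (S w k * (S w i + b * S w k) < 0 \<longrightarrow> chi k j \<ge> 0 \<longrightarrow> chi i j + b * chi k j \<le> 0)"
      if sep: "separates (\<lambda>x y. chi y x) w {k} {i, j}" and side: "S w k * S w j < 0"
        and z: "chi j k = 0" "chi j i \<le> 0" "chi i j \<le> 0"
    proof -
      have "\<exists>A B C D E F. arc n q ?s k A B \<and> arc n q (- ?s) i C D \<and> arc n q (- ?s) j E F \<and>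
        ((q < A \<and> q < C \<and> q < E) \<or> (B < ?r \<and> D < ?r \<and> F < ?r) \<or> (q < A \<and> D < ?r \<and> F < ?r))"
        using sep arcs sg(1) sg(4)[OF side] unfolding separates_def by (simp; metis)
      then obtain A B C D E F where arc: "arc n q ?s k A B" "arc n q (- ?s) i C D" "arc n q (- ?s) j E F"
        and win: "(q < A \<and> q < C \<and> q < E) \<or> (B < ?r \<and> D < ?r \<and> F < ?r) \<or> (q < A \<and> D < ?r \<and> F < ?r)" by blast
      note V = arc_ivl[OF arc(1)] arc_ivl[OF arc(2)] arc_ivl[OF arc(3)]
      have c: "chi i k = - arc_chi q ?r C D A B" "chi k i = - arc_chi q ?r A B C D"
        "chi j k = - arc_chi q ?r E F A B" "chi k j = - arc_chi q ?r A B E F"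
        "chi j i = arc_chi q ?r E F C D" "chi i j = arc_chi q ?r C D E F"
        using chi_arc[OF arc(1,2)] chi_arc[OF arc(2,1)] chi_arc[OF arc(1,3)] chi_arc[OF arc(3,1)] chi_arc[OF arc(2,3)] chi_arc[OF arc(3,2)]
        by (simp_all add: ss dk)
      have b: "b = 1" using ivl_hom_op[OF V(1,2)] win h(4-6) c by auto
      have len: "S w k * (S w i + b * S w k) > 0 \<longleftrightarrow> B - A > D - C" "S w k * (S w i + b * S w k) < 0 \<longleftrightarrow> B - A < D - C"
        using rank_0_flip[OF ctx arc(1,2) all0(1) nt, of b] b by simp_all
      show ?thesis
        using ivl_extension_op[OF V win] ivl_kernel_op[OF V win] h(4-6) z c b len by auto
    qed
    show ?thesis using 1 2 by blast
  qed
qed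

end

section \<open>Reduction to classes of rank zero\<close>

context semistable_weights
begin

lemma stability_rank_0:
  assumes x: "root x" and y: "root y" and r: "rk x = 0 \<or> rk y = 0" and S: "S x y > 0"
  shows "0 \<le> chi x y"
proof -
  have neg: "deg (comb z (-2) z) = - deg z" "rk (comb z (-2) z) = - rk z" for z by (simp_all add: deg_comb)
  have *: "(\<exists>i a b. torsion z i a b) \<and> (\<exists>i a b. torsion (comb z (-2) z) i a b)" if "root z" "rk z = 0" for z
    using root_rank_0[OF that] torsion_neg by metis
  show ?thesis
  proof (cases "rk x = 0")
    case True
    then have S': "rk y * deg x < 0" using S by (simp add: S_def)
    show ?thesis
    proof (cases "rk y > 0")
      case r: True
      then have "deg (comb x (-2) x) > 0" using S' by (simp add: neg mult_less_0_iff)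
      then have "chi (comb x (-2) x) y \<le> 0" using torsion_positive(2)[OF y r] *[OF x True] by blast
      then show ?thesis by (simp add: chi_comb_left)
    next
      case False
      then have "deg x > 0" "rk (comb y (-2) y) > 0" using S' by (auto simp: neg mult_less_0_iff)
      then have "chi x (comb y (-2) y) \<le> 0" using torsion_positive(2)[OF root_neg[OF y]] *[OF x True] by blast
      then show ?thesis by (simp add: chi_comb_right)
    qed
  next
    case False
    then have ry: "rk y = 0" and S': "rk x * deg y > 0" using S r by (auto simp: S_def)
    show ?thesis
    proof (cases "rk x > 0")
      case r: True
      then have "deg y > 0" using S' by (simp add: zero_less_mult_iff)
      then show ?thesis using torsion_positive(1)[OF x r] *[OF y ry] by blast
    next
      case False
      then have "deg (comb y (-2) y) > 0" "rk (comb x (-2) x) > 0" using S' by (auto simp: neg zero_less_mult_iff)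
      then have "0 \<le> chi (comb x (-2) x) (comb y (-2) y)"
        using torsion_positive(1)[OF root_neg[OF x]] *[OF y ry] by blast
      then show ?thesis by (simp add: chi_comb_left chi_comb_right)
    qed
  qed
qed

text \<open>
  The assumptions are those on \<open>stability\<close> and on roots of one line; everything else holds for all weights of genus at most \<open>1\<close>.
\<close>

lemma charged_latticeI:
  assumes "\<And>x y. root x \<Longrightarrow> root y \<Longrightarrow> S x y > 0 \<Longrightarrow> 0 \<le> chi x y"
    and "\<And>w x y. root w \<Longrightarrow> root x \<Longrightarrow> root y \<Longrightarrow> acyclic_at chi S w x y"
    and "\<And>w k i j b. root w \<Longrightarrow> root k \<Longrightarrow> root i \<Longrightarrow> root j \<Longrightarrow> hereditary_at chi S w k i j b"
    and "\<And>w k i j b. root w \<Longrightarrow> root k \<Longrightarrow> root i \<Longrightarrow> root j \<Longrightarrow> hereditary_at (\<lambda>x y. chi y x) S w k i j b"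
  shows "charged_lattice K comb chi rk deg 1"
proof
  have R: "(\<lambda>x. x \<in> K \<and> chi x x = 1) = root" by (simp add: root_def fun_eq_iff)
  have S': "(\<lambda>x y. rk x * deg y - rk y * deg x) = S" by (simp add: S_def fun_eq_iff)
  show "rays_acyclic (\<lambda>x. x \<in> K \<and> chi x x = 1) chi (\<lambda>x y. rk x * deg y - rk y * deg x)"
    "rays_hereditary (\<lambda>x. x \<in> K \<and> chi x x = 1) chi (\<lambda>x y. rk x * deg y - rk y * deg x)"
    "rays_hereditary (\<lambda>x. x \<in> K \<and> chi x x = 1) (\<lambda>x y. chi y x) (\<lambda>x y. rk x * deg y - rk y * deg x)"
    unfolding R S' rays_acyclic_def rays_hereditary_def using assms(2-4) by blast+
  show "x \<in> K \<Longrightarrow> y \<in> K \<Longrightarrow> chi x x = 1 \<Longrightarrow> chi y y = 1 \<Longrightarrow>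
       rk x * deg y - rk y * deg x > 0 \<Longrightarrow> 0 \<le> chi x y" for x y
    using assms(1)[of x y] by (simp add: root_def S_def)
  show "x \<in> K \<Longrightarrow> chi x x = 1 \<Longrightarrow> rk x \<noteq> 0 \<or> deg x \<noteq> 0" for x
    using charge_nonzero by (simp add: root_def)
qed (simp_all add: comb_K chi_comb_left chi_comb_right deg_comb chi_nonneg)

text \<open>
  Such a map need not respect the positive half-plane, but the assumptions on stability and on lines only involve \<open>chi\<close> and \<open>S\<close>.
\<close>

definition isom :: "(kclass \<Rightarrow> kclass) \<Rightarrow> bool" where
  "isom g \<longleftrightarrow> (\<forall>x\<in>K. g x \<in> K) \<and> (\<forall>x\<in>K. \<forall>y\<in>K. chi (g x) (g y) = chi x y \<and> S (g x) (g y) = S x y)"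

lemma isom_id: "isom (\<lambda>x. x)" by (simp add: isom_def)

lemma isom_comp: "isom f \<Longrightarrow> isom g \<Longrightarrow> isom (\<lambda>x. f (g x))" by (simp add: isom_def)

lemma isom_root: "isom g \<Longrightarrow> root x \<Longrightarrow> root (g x)" by (simp add: isom_def root_def)

lemma charged_lattice_if_transitive:
  assumes trans: "\<And>x. x \<in> K \<Longrightarrow> \<exists>g. isom g \<and> rk (g x) = 0"
  shows "charged_lattice K comb chi rk deg 1"
proof (rule charged_latticeI)
  have g: "\<exists>g. rk (g x) = 0 \<and> (\<forall>y. root y \<longrightarrow> root (g y)) \<and>
     (\<forall>y z. root y \<longrightarrow> root z \<longrightarrow> chi (g y) (g z) = chi y z \<and> S (g y) (g z) = S y z)" if rx: "root x" for x
  proof -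
    obtain g where g: "isom g" "rk (g x) = 0" using trans[of x] rx by (auto simp: root_def)
    show ?thesis
    proof (intro exI[of _ g] conjI allI impI)
      show "rk (g x) = 0" by (rule g(2))
      show "root (g y)" if "root y" for y using isom_root[OF g(1) that] .
      show "chi (g y) (g z) = chi y z" "S (g y) (g z) = S y z" if "root y" "root z" for y z
        using g(1) that by (simp_all add: isom_def root_def)
    qed
  qed
  show "0 \<le> chi x y" if r: "root x" "root y" and s: "S x y > 0" for x y
  proof -
    obtain g where g: "rk (g x) = 0" "\<And>y. root y \<Longrightarrow> root (g y)"
      "\<And>y z. root y \<Longrightarrow> root z \<Longrightarrow> chi (g y) (g z) = chi y z \<and> S (g y) (g z) = S y z"
      using g[OF r(1)] by blast
    show ?thesis using stability_rank_0[of "g x" "g y"] g r s by simp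
  qed
  show "acyclic_at chi S w x y" if r: "root w" "root x" "root y" for w x y
  proof -
    obtain g where g: "rk (g x) = 0" "\<And>y. root y \<Longrightarrow> root (g y)"
      "\<And>y z. root y \<Longrightarrow> root z \<Longrightarrow> chi (g y) (g z) = chi y z \<and> S (g y) (g z) = S y z"
      using g[OF r(2)] by blast
    have "acyclic_at chi S (g w) (g x) (g y)"
      by (rule rank_0_acyclic[OF g(2)[OF r(1)] g(2)[OF r(2)] g(2)[OF r(3)] g(1)])
    then show ?thesis unfolding acyclic_at_def separates_def using g(3) r by simp
  qed
  fix w k i j b assume r: "root w" "root k" "root i" "root j"
  obtain g where g: "rk (g k) = 0" "\<And>y. root y \<Longrightarrow> root (g y)"
      "\<And>y z. root y \<Longrightarrow> root z \<Longrightarrow> chi (g y) (g z) = chi y z \<and> S (g y) (g z) = S y z"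
    using g[OF r(2)] by blast
  note R = g(2)[OF r(1)] g(2)[OF r(2)] g(2)[OF r(3)] g(2)[OF r(4)] g(1)
  have e: "chi (g y) (g z) = chi y z" "S (g y) (g z) = S y z" if "y \<in> {w, k, i, j}" "z \<in> {w, k, i, j}" for y z
    using g(3)[of y z] that r by auto
  have "hereditary_at chi S (g w) (g k) (g i) (g j) b" by (rule rank_0_hereditary[OF R])
  then show "hereditary_at chi S w k i j b"
    unfolding hereditary_at_def separates_def by (simp add: e)
  have "hereditary_at (\<lambda>x y. chi y x) S (g w) (g k) (g i) (g j) b" by (rule rank_0_hereditary_op[OF R])
  then show "hereditary_at (\<lambda>x y. chi y x) S w k i j b"
    unfolding hereditary_at_def separates_def by (simp add: e)
qed

text \<open>
  On lines of nonzero rank there is nothing to be controlled. Two roots of positive rank and equal slope with \<open>chi u v = 0\<close> and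
  \<open>chi v u > 0\<close> cannot exist: the norm of \<open>v - u\<close> is \<open>1\<close> or \<open>0\<close>. In the first case it is a root of the same slope, up to sign of
  positive rank, and \<open>lo\<close> gives the wrong sign for its form with \<open>u\<close> or \<open>v\<close>. In the second case its rank, its multiplicities
  and its degree vanish, which contradicts \<open>chi u (v - u) = - 1\<close>.
\<close>

lemma charged_lattice_if_domestic:
  assumes pd: "\<And>x. x \<in> K \<Longrightarrow> rk x \<noteq> 0 \<Longrightarrow> 0 < chi x x"
    and lo: "\<And>x y. root x \<Longrightarrow> root y \<Longrightarrow> rk x > 0 \<Longrightarrow> rk y > 0 \<Longrightarrow> S x y \<ge> 0 \<Longrightarrow> 0 \<le> chi x y"
    and up: "\<And>x y. root x \<Longrightarrow> root y \<Longrightarrow> rk x > 0 \<Longrightarrow> rk y > 0 \<Longrightarrow> S x y > 0 \<Longrightarrow> chi y x \<le> 0"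
  shows "charged_lattice K comb chi rk deg 1"
proof (rule charged_latticeI)
  \<comment> \<open>Stability is known for roots of positive rank; negating roots covers the other signs.\<close>
  let ?n = "\<lambda>x. comb x (-2) x"
  have rn: "rk (?n x) = - rk x" for x by simp
  have Sn: "S (?n x) y = - S x y" "S x (?n y) = - S x y" for x y by (simp_all add: S_def deg_comb algebra_simps)
  have cn: "chi (?n x) y = - chi x y" "chi x (?n y) = - chi x y" for x y by (simp_all add: chi_comb_left chi_comb_right)
  note rneg = root_neg
  show "0 \<le> chi x y" if x: "root x" and y: "root y" and s: "S x y > 0" for x y
  proof -
    consider "rk x = 0 \<or> rk y = 0" | "rk x > 0" "rk y > 0" | "rk x > 0" "rk y < 0" | "rk x < 0" "rk y > 0" | "rk x < 0" "rk y < 0"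
      by linarith
    then show ?thesis
    proof cases
      case 1
      then show ?thesis using stability_rank_0[OF x y] s by blast
    next
      case 2
      then show ?thesis using lo[OF x y] s by simp
    next
      case 3
      have "S (?n y) x = S x y" using Sn(1)[of y x] by (simp add: S_def)
      then show ?thesis using up[OF rneg[OF y] x] 3 s cn(2)[of x y] rn by simp
    next
      case 4
      have "S y (?n x) = S x y" using Sn(2)[of y x] by (simp add: S_def)
      then show ?thesis using up[OF y rneg[OF x]] 4 s cn(1)[of x y] rn by simp
    next
      case 5
      then show ?thesis using lo[OF rneg[OF x] rneg[OF y]] s cn Sn rn by simp
    qed
  qed
  have par: "S w x * rk y = S w y * rk x" if "S x y = 0" for w x y
  proof -
    have "S w x * rk y - S w y * rk x = - S x y * rk w" by (simp add: S_def algebra_simps)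
    then show ?thesis using that by simp
  qed
  have sgn: "S w x * S w y > 0 \<Longrightarrow> rk x * rk y > 0" "S w x * S w y < 0 \<Longrightarrow> rk x * rk y < 0"
    if "S x y = 0" "rk x \<noteq> 0" "root y" for w x y
  proof -
    have ry: "rk y \<noteq> 0" using that charge_nonzero[of y] by (auto simp: S_def)
    have e: "(S w x * S w y) * (rk x * rk y) = (S w y * rk x)\<^sup>2"
      using par[OF that(1), of w] by (simp add: power2_eq_square mult_ac)
    have "S w x * S w y \<noteq> 0 \<Longrightarrow> (S w x * S w y) * (rk x * rk y) > 0" unfolding e using that ry by simp
    then have "S w x * S w y \<noteq> 0 \<Longrightarrow> 0 < S w x * S w y \<and> 0 < rk x * rk y \<or> S w x * S w y < 0 \<and> rk x * rk y < 0"
      using zero_less_mult_iff[of "S w x * S w y" "rk x * rk y"] by blast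
    then show "S w x * S w y > 0 \<Longrightarrow> rk x * rk y > 0" "S w x * S w y < 0 \<Longrightarrow> rk x * rk y < 0"
      by linarith+
  qed
  show "acyclic_at chi S w x y" if w: "root w" and x: "root x" and y: "root y" for w x y
  proof (cases "rk x = 0")
    case False
    show ?thesis unfolding acyclic_at_def
    proof (intro impI)
      assume h: "S x y = 0" "S w x * S w y > 0" "chi x y < 0"
      have "rk x * rk y > 0" using sgn(1)[OF h(1) False y h(2)] .
      then consider "rk x > 0" "rk y > 0" | "rk x < 0" "rk y < 0" by (auto simp: zero_less_mult_iff)
      then show False
      proof cases
        case 1
        then show False using lo[OF x y] h by simp
      next
        case 2
        then show False using lo[OF rneg[OF x] rneg[OF y]] h cn Sn rn by simp
      qed
    qed
  qed (rule rank_0_acyclic[OF w x y])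
  have no_hom: False if u: "root u" "rk u > 0" and v: "root v" "rk v > 0" and s: "S u v = 0"
    and h: "chi u v = 0" "chi v u > 0" for u v
  proof -
    define z where "z = comb v (-1) u"
    have uu: "chi u u = 1" "chi v v = 1" "u \<in> K" "v \<in> K" using u v by (auto simp: root_def)
    have z: "z \<in> K" "chi z z = 2 - chi v u" "rk z = rk v - rk u" "S u z = 0" "S z v = 0"
      "chi u z = -1" "chi z v = 1"
      using uu h s by (auto simp: z_def comb_K chi_comb_left chi_comb_right S_def deg_comb algebra_simps)
    consider "chi v u = 1" | "chi v u = 2" using h chi_nonneg[OF z(1)] z(2) by linarith
    then show False
    proof cases
      case 1
      then have rz: "root z" using z by (simp add: root_def)
      consider "rk z > 0" | "rk z < 0" | "rk z = 0" by linarith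
      then show False
      proof cases
        case 1
        then show False using lo[OF u(1) rz u(2)] z by simp
      next
        case 2
        then show False using lo[OF rneg[OF rz] v(1)] v(2) z cn Sn rn by simp
      next
        case 3
        then show False using charge_nonzero[OF rz] z(4) u(2) by (simp add: S_def)
      qed
    next
      case 2
      then have rz: "rk z = 0" using z pd[OF z(1)] by fastforce
      then have "(\<Sum>i<t. \<Sum>j<p!i. (mu z i j)\<^sup>2) = 0" using norm_formula[OF z(1)] z(2) 2 by simp
      then have m: "mu z i j = 0" if "i < t" "j < p!i" for i j
        using that by (simp add: sum_nonneg_eq_0_iff sum_nonneg)
      have dz: "deg z = int N * dg z" "chi u z = rk u * dg z"
        using rz m by (auto simp: deg_def chi_def)
      have "deg z = 0" using z(4) rz u(2) by (simp add: S_def)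
      then show False using dz z(6) N_pos by simp
    qed
  qed
  fix w k i j b assume w: "root w" and k: "root k" and i: "root i" and j: "root j"
  have no: False if "rk k \<noteq> 0" "S k i = 0" "S w k * S w i < 0"
    "chi k i = 0 \<and> chi i k < 0 \<or> chi i k = 0 \<and> chi k i < 0"
  proof -
    have Sik: "S i k = 0" using that(2) by (simp add: S_def)
    have "rk k * rk i < 0" using sgn(2)[OF that(2,1) i that(3)] .
    then consider "rk k > 0" "rk i < 0" | "rk k < 0" "rk i > 0" by (auto simp: mult_less_0_iff)
    then show False
    proof cases
      case 1
      then show False
        using no_hom[OF k _ rneg[OF i]] no_hom[OF rneg[OF i] _ k] that cn Sn rn Sik by auto
    next
      case 2
      then show False
        using no_hom[OF i _ rneg[OF k]] no_hom[OF rneg[OF k] _ i] that cn Sn rn Sik by auto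
    qed
  qed
  show "hereditary_at chi S w k i j b"
  proof (cases "rk k = 0")
    case False
    show ?thesis
    proof (rule ccontr)
      assume "\<not> ?thesis"
      then have "S k i = 0" "S k j = 0" "S w k * S w i < 0" "chi k i = 0" "chi i k = - b" "0 < b"
        unfolding hereditary_at_def by blast+
      then show False using no[OF False] by simp
    qed
  qed (rule rank_0_hereditary[OF w k i j])
  show "hereditary_at (\<lambda>x y. chi y x) S w k i j b"
  proof (cases "rk k = 0")
    case False
    show ?thesis
    proof (rule ccontr)
      assume "\<not> ?thesis"
      then have "S k i = 0" "S k j = 0" "S w k * S w i < 0" "chi i k = 0" "chi k i = - b" "0 < b"
        unfolding hereditary_at_def by blast+
      then show False using no[OF False] by simp
    qed
  qed (rule rank_0_hereditary_op[OF w k i j])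
qed

end

section \<open>Tubular mutations\<close>

lemma sum_rotate:
  fixes f :: "nat \<Rightarrow> int"
  assumes "0 < n" shows "(\<Sum>j<n. f (Suc j mod n)) = (\<Sum>j<n. f j)"
proof -
  obtain m where n: "n = Suc m" using assms by (cases n) auto
  have "(\<Sum>j<m. f (Suc j mod Suc m)) = (\<Sum>j<m. f (Suc j))" by (intro sum.cong) auto
  then show ?thesis unfolding n by (simp add: sum.lessThan_Suc_shift[of f m] del: sum.lessThan_Suc) (simp)
qed

lemma triangle_rotate:
  fixes f g :: "nat \<Rightarrow> int"
  assumes "0 < n"
  shows "(\<Sum>j<n. \<Sum>l<j. f (Suc l mod n) * g (Suc j mod n))
    = (\<Sum>j<n. \<Sum>l<j. f l * g j) + (\<Sum>l<n. f l) * g 0 - f 0 * (\<Sum>j<n. g j)"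
proof -
  obtain m where n: "n = Suc m" using assms by (cases n) auto
  have "(\<Sum>j<n. \<Sum>l<j. f (Suc l mod n) * g (Suc j mod n))
     = (\<Sum>j<m. \<Sum>l<j. f (Suc l) * g (Suc j)) + (\<Sum>l<m. f (Suc l)) * g 0"
  proof -
    have "(\<Sum>j<m. \<Sum>l<j. f (Suc l mod n) * g (Suc j mod n)) = (\<Sum>j<m. \<Sum>l<j. f (Suc l) * g (Suc j))"
      unfolding n by (intro sum.cong) auto
    moreover have "(\<Sum>l<m. f (Suc l mod n) * g (Suc m mod n)) = (\<Sum>l<m. f (Suc l) * g 0)"
      unfolding n by (intro sum.cong) auto
    ultimately show ?thesis unfolding n by (simp add: sum_distrib_right)
  qed
  moreover have "(\<Sum>j<n. \<Sum>l<j. f l * g j) = (\<Sum>j<m. f 0 * g (Suc j) + (\<Sum>l<j. f (Suc l) * g (Suc j)))"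
    unfolding n sum.lessThan_Suc_shift by simp
  moreover have "(\<Sum>l<n. f l) = f 0 + (\<Sum>l<m. f (Suc l))" "(\<Sum>l<n. g l) = g 0 + (\<Sum>l<m. g (Suc l))"
    unfolding n sum.lessThan_Suc_shift by simp_all
  ultimately show ?thesis
    by (simp add: sum.distrib sum_distrib_left algebra_simps)
qed

lemma weighted_sum_rotate:
  fixes f :: "nat \<Rightarrow> int"
  assumes "0 < n"
  shows "(\<Sum>j<n. int j * f (Suc j mod n)) = (\<Sum>j<n. int j * f j) - (\<Sum>j<n. f j) + int n * f 0"
proof -
  obtain m where n: "n = Suc m" using assms by (cases n) auto
  have "(\<Sum>j<m. int j * f (Suc j mod Suc m)) = (\<Sum>j<m. int (Suc j) * f (Suc j) - f (Suc j))"
    by (intro sum.cong) (auto simp: algebra_simps)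
  moreover have "(\<Sum>j<n. int j * f j) = (\<Sum>j<m. int (Suc j) * f (Suc j))" "(\<Sum>j<n. f j) = f 0 + (\<Sum>j<m. f (Suc j))"
    unfolding n sum.lessThan_Suc_shift by simp_all
  ultimately show ?thesis unfolding n by (simp add: sum_subtractf) (simp add: algebra_simps)
qed

lemma sum_mod_divisor:
  fixes f :: "nat \<Rightarrow> int"
  assumes "p dvd n" "0 < p"
  shows "(\<Sum>j<n. f (j mod p)) = int (n div p) * (\<Sum>a<p. f a)"
proof -
  obtain k where n: "n = k * p" using assms(1) by (metis dvd_div_mult_self)
  have "(\<Sum>j<k * p. f (j mod p)) = (\<Sum>m<k. \<Sum>j\<in>{m * p..<m * p + p}. f (j mod p))"
    by (rule sum.nat_group[symmetric])
  also have "\<dots> = (\<Sum>m<k. \<Sum>a<p. f a)"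
  proof (rule sum.cong[OF refl])
    fix m
    have "(\<Sum>j\<in>{0 + m * p..<p + m * p}. f (j mod p)) = (\<Sum>a\<in>{0..<p}. f ((a + m * p) mod p))"
      by (rule sum.shift_bounds_nat_ivl)
    also have "\<dots> = (\<Sum>a<p. f a)" by (auto simp: lessThan_atLeast0 intro!: sum.cong)
    finally show "(\<Sum>j\<in>{m * p..<m * p + p}. f (j mod p)) = (\<Sum>a<p. f a)" by (simp add: add.commute)
  qed
  finally show ?thesis using n assms(2) by simp
qed

lemma sum_partial_sums:
  fixes f :: "nat \<Rightarrow> int"
  shows "(\<Sum>a<n. \<Sum>l<Suc a. f l) = int n * (\<Sum>l<n. f l) - (\<Sum>l<n. int l * f l)"
  by (induction n) (simp_all add: algebra_simps)

context weights
begin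

text \<open>
  The dualizing element is $\vec\omega = (t-2)\vec c - \sum \vec x_i$, so $\tau^j \mathcal{O} = \mathcal{O}(j\vec\omega)$ has
  flag position $j \bmod p_i$ at the $i$-th point, and the remaining multiples of $\vec c$ give its degree.
\<close>

definition orbit_degree :: "nat \<Rightarrow> int" where
  "orbit_degree j = (int t - 2) * int j - (\<Sum>i<t. int (j div p!i))"

definition tau_O :: "nat \<Rightarrow> kclass" where
  "tau_O j = (1, orbit_degree j, \<lambda>i l. if l = j mod p!i then 1 else 0)"

lemma tau_O_simps: "rk (tau_O j) = 1" "tau_O j \<in> K"
  using p_pos by (simp_all add: tau_O_def K_def)

lemma psum_tau_O: "i < t \<Longrightarrow> n \<le> p!i \<Longrightarrow> psum (tau_O j) i n = of_bool (j mod p!i < n)"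
  by (simp add: psum_def tau_O_def)

lemma chi_tau_O:
  assumes y: "y \<in> K"
  shows "chi (tau_O j) y = rk y + dg y - rk y * orbit_degree j - (\<Sum>i<t. rk y - psum y i (Suc (j mod p!i)))"
    and "chi y (tau_O j) = rk y + rk y * orbit_degree j - dg y - (\<Sum>i<t. psum y i (j mod p!i))"
proof -
  have "(\<Sum>l<p!i. \<Sum>l'<l. mu (tau_O j) i l' * mu y i l) = rk y - psum y i (Suc (j mod p!i))" if "i < t" for i
  proof -
    have "(\<Sum>l<n. \<Sum>l'<l. mu (tau_O j) i l' * mu y i l) = (if j mod p!i < n then psum y i n - psum y i (Suc (j mod p!i)) else 0)" for n
      by (induction n) (auto simp: tau_O_def psum_def less_Suc_eq sum_distrib_right[symmetric])
    from this[of "p!i"] show ?thesis using p_pos[OF that] psum_total[OF y that] by simp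
  qed
  then show "chi (tau_O j) y = rk y + dg y - rk y * orbit_degree j - (\<Sum>i<t. rk y - psum y i (Suc (j mod p!i)))"
    by (simp add: chi_def tau_O_def)
  have "(\<Sum>l<p!i. \<Sum>l'<l. mu y i l' * mu (tau_O j) i l) = psum y i (j mod p!i)" if "i < t" for i
  proof -
    have "(\<Sum>l<p!i. \<Sum>l'<l. mu y i l' * mu (tau_O j) i l) = (\<Sum>l<p!i. if l = j mod p!i then psum y i l else 0)"
      by (intro sum.cong) (auto simp: tau_O_def psum_def)
    then show ?thesis using p_pos[OF that] by simp
  qed
  then show "chi y (tau_O j) = rk y + rk y * orbit_degree j - dg y - (\<Sum>i<t. psum y i (j mod p!i))"
    by (simp add: chi_def tau_O_def algebra_simps)
qed

end

text \<open>
  Genus \<open>1\<close>. In this case one of the weights is the least common multiple \<open>N\<close> of all, and the orbit of the structure sheaf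
  has length \<open>N\<close>. The assumption \<open>gram\<close> says that its members have the Euler form of the simple objects of a tube of rank \<open>N\<close>.
\<close>

locale tubular_weights = semistable_weights +
  fixes i0
  assumes kappa_eq: "(int t - 2) * int N = (\<Sum>i<t. int (N div p!i))"
    and i0: "i0 < t" "p!i0 = N"
    and gram: "i < N \<Longrightarrow> j < N \<Longrightarrow> chi (tau_O i) (tau_O j) = of_bool (i = j) - of_bool (j = Suc i mod N)"
    and orbit_degree_sum: "(\<Sum>j<N. orbit_degree j) = int N"
begin

text \<open>
  The effect of the twist by $\vec x_{i_0}$, which rotates the flag at the point of maximal weight.
\<close>

definition shift :: "kclass \<Rightarrow> kclass" where
  "shift x = (rk x, dg x + mu x i0 0, \<lambda>i j. if i = i0 then mu x i (Suc j mod N) else mu x i j)"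

lemma shift_simps:
  "rk (shift x) = rk x" "x \<in> K \<Longrightarrow> shift x \<in> K" "x \<in> K \<Longrightarrow> deg (shift x) = deg x + rk x"
proof -
  show "rk (shift x) = rk x" by (simp add: shift_def)
  assume x: "x \<in> K"
  show "shift x \<in> K"
    unfolding K_def
  proof (intro CollectI allI impI)
    fix i assume "i < t"
    then show "(\<Sum>j<p!i. mu (shift x) i j) = rk (shift x)"
      using x i0 sum_rotate[OF N_pos, of "mu x i0"] by (cases "i = i0") (auto simp: K_def shift_def)
  qed
  let ?f = "\<lambda>x i. \<Sum>j<p!i. int (N div p!i * j) * mu x i j"
  have s: "(\<Sum>i<t. ?f y i) = ?f y i0 + (\<Sum>i\<in>{..<t}-{i0}. ?f y i)" for y
    using i0 by (intro sum.remove) auto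
  have r: "(\<Sum>i\<in>{..<t}-{i0}. ?f (shift x) i) = (\<Sum>i\<in>{..<t}-{i0}. ?f x i)"
    by (intro sum.cong) (auto simp: shift_def)
  have K_i0: "(\<Sum>l<N. mu x i0 l) = rk x" using x i0 by (auto simp: K_def)
  have "?f (shift x) i0 = (\<Sum>j<N. int j * mu x i0 (Suc j mod N))"
    using N_pos by (simp add: i0 shift_def)
  then have "?f (shift x) i0 = ?f x i0 - rk x + int N * mu x i0 0"
    using weighted_sum_rotate[OF N_pos, of "mu x i0"] K_i0 N_pos by (simp add: i0)
  then show "deg (shift x) = deg x + rk x"
    unfolding deg_def s r by (simp add: shift_def algebra_simps)
qed

lemma chi_shift:
  assumes "x \<in> K" "y \<in> K" shows "chi (shift x) (shift y) = chi x y"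
proof -
  let ?f = "\<lambda>x y i. \<Sum>j<p!i. \<Sum>l<j. mu x i l * mu y i j"
  have s: "(\<Sum>i<t. ?f x y i) = ?f x y i0 + (\<Sum>i\<in>{..<t}-{i0}. ?f x y i)" for x y
    using i0 by (intro sum.remove) auto
  have r: "(\<Sum>i\<in>{..<t}-{i0}. ?f (shift x) (shift y) i) = (\<Sum>i\<in>{..<t}-{i0}. ?f x y i)"
    by (intro sum.cong) (auto simp: shift_def)
  have sums: "(\<Sum>l<N. mu x i0 l) = rk x" "(\<Sum>l<N. mu y i0 l) = rk y"
    using assms i0 by (auto simp: K_def)
  have "?f (shift x) (shift y) i0 = ?f x y i0 + rk x * mu y i0 0 - mu x i0 0 * rk y"
    using triangle_rotate[OF N_pos, of "mu x i0" "mu y i0"] by (simp add: i0 shift_def sums)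
  then show ?thesis unfolding chi_def s r by (simp add: shift_def algebra_simps)
qed

lemma isomI:
  assumes "\<And>x. x \<in> K \<Longrightarrow> g x \<in> K" "\<And>x y. x \<in> K \<Longrightarrow> y \<in> K \<Longrightarrow> chi (g x) (g y) = chi x y"
    "\<And>x y. x \<in> K \<Longrightarrow> y \<in> K \<Longrightarrow> S (g x) (g y) = S x y"
  shows "isom g"
  using assms by (simp add: isom_def)

lemma isom_shift: "isom shift"
  by (rule isomI) (simp_all add: shift_simps chi_shift S_def algebra_simps)

definition twist :: "int \<Rightarrow> kclass \<Rightarrow> kclass" where "twist n x = (rk x, dg x + n * rk x, mu x)"

lemma twist_simps: "rk (twist n x) = rk x" "deg (twist n x) = deg x + int N * n * rk x"
  by (simp_all add: twist_def deg_def algebra_simps)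

lemma isom_twist: "isom (twist n)"
  by (rule isomI) (simp_all add: S_def twist_simps, simp_all add: twist_def K_def chi_def algebra_simps)

lemma shear: "\<exists>g. isom g \<and> (\<forall>x\<in>K. rk (g x) = rk x \<and> deg (g x) = deg x + n * rk x)"
proof -
  have *: "\<exists>g. isom g \<and> (\<forall>x\<in>K. rk (g x) = rk x \<and> deg (g x) = deg x + int m * rk x)" for m
  proof (induction m)
    case 0
    then show ?case using isom_id by force
  next
    case (Suc m)
    then obtain g where g: "isom g" "\<forall>x\<in>K. rk (g x) = rk x \<and> deg (g x) = deg x + int m * rk x" by blast
    have "isom (\<lambda>x. shift (g x))" by (rule isom_comp[OF isom_shift g(1)])
    moreover have "\<forall>x\<in>K. rk (shift (g x)) = rk x \<and> deg (shift (g x)) = deg x + int (Suc m) * rk x"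
      using g by (simp add: shift_simps isom_def algebra_simps)
    ultimately show ?case by blast
  qed
  \<comment> \<open>Division with remainder: the twist by a multiple of the canonical element contributes multiples of N, the shift the rest.\<close>
  obtain g where g: "isom g" "\<forall>x\<in>K. rk (g x) = rk x \<and> deg (g x) = deg x + (n mod int N) * rk x"
    using *[of "nat (n mod int N)"] N_pos by auto
  have "isom (\<lambda>x. twist (n div int N) (g x))" by (rule isom_comp[OF isom_twist g(1)])
  moreover have "\<forall>x\<in>K. rk (twist (n div int N) (g x)) = rk x \<and> deg (twist (n div int N) (g x)) = deg x + n * rk x"
  proof
    fix x assume "x \<in> K"
    then have "deg (twist (n div int N) (g x)) = deg x + (n mod int N) * rk x + (int N * (n div int N)) * rk x"
      using g(2) by (simp add: twist_simps)
    then have "deg (twist (n div int N) (g x)) = deg x + (n mod int N + int N * (n div int N)) * rk x"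
      by (simp only: distrib_right add.assoc)
    then show "rk (twist (n div int N) (g x)) = rk x \<and> deg (twist (n div int N) (g x)) = deg x + n * rk x"
      unfolding mod_mult_div_eq using g(2) \<open>x \<in> K\<close> by (simp add: twist_simps(1))
  qed
  ultimately show ?thesis by blast
qed

lemma orbit_degree_N: "orbit_degree N = 0"
  by (simp add: orbit_degree_def kappa_eq)

text \<open>
  Serre duality.
\<close>

lemma serre_tau_O:
  assumes y: "y \<in> K" and j: "j < N"
  shows "chi y (tau_O (Suc j mod N)) = - chi (tau_O j) y"
proof -
  let ?j = "Suc j mod N"
  let ?c = "\<lambda>i. of_bool (p!i dvd Suc j) :: int"
  have "orbit_degree ?j = orbit_degree (Suc j)"
    using orbit_degree_N j by (cases "Suc j = N") (auto simp: orbit_degree_def)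
  also have "int (Suc j div p!i) = int (j div p!i) + ?c i" if "i < t" for i
    using p_pos[OF that] by (simp add: div_Suc dvd_eq_mod_eq_0)
  then have "orbit_degree (Suc j) = orbit_degree j + (int t - 2) - (\<Sum>i<t. ?c i)"
    by (simp add: orbit_degree_def sum.distrib algebra_simps)
  finally have od: "orbit_degree ?j = orbit_degree j + (int t - 2) - (\<Sum>i<t. ?c i)" .
  have "psum y i (?j mod p!i) = psum y i (Suc (j mod p!i)) - rk y * ?c i" if "i < t" for i
  proof -
    have e: "?j mod p!i = Suc j mod p!i" using dvd_N[OF that] by (simp add: mod_mod_cancel)
    show ?thesis
    proof (cases "p!i dvd Suc j")
      case True
      then have "Suc (j mod p!i) = p!i" by (metis dvd_eq_mod_eq_0 mod_Suc nat.distinct(1))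
      then show ?thesis using True e psum_total[OF y that] by (simp add: psum_def dvd_eq_mod_eq_0)
    next
      case False
      then have "Suc j mod p!i = Suc (j mod p!i)" by (metis dvd_eq_mod_eq_0 mod_Suc)
      then show ?thesis using False e by simp
    qed
  qed
  then have "(\<Sum>i<t. psum y i (?j mod p!i)) = (\<Sum>i<t. psum y i (Suc (j mod p!i))) - rk y * (\<Sum>i<t. ?c i)"
    by (simp add: sum_subtractf sum_distrib_left)
  then show ?thesis
    unfolding chi_tau_O[OF y] od by (simp add: sum_subtractf algebra_simps)
qed

text \<open>
  The Riemann--Roch formula: averaging the Euler form over the orbit removes the contributions of the individual flag positions.
\<close>

lemma sum_chi_tau_O:
  assumes y: "y \<in> K"
  shows "(\<Sum>j<N. chi (tau_O j) y) = deg y"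
proof -
  have "(\<Sum>j<N. psum y i (Suc (j mod p!i))) = int N * rk y - (\<Sum>l<p!i. int (N div p!i * l) * mu y i l)" if i: "i < t" for i
  proof -
    have "(\<Sum>j<N. psum y i (Suc (j mod p!i))) = int (N div p!i) * (\<Sum>a<p!i. psum y i (Suc a))"
      using sum_mod_divisor[OF dvd_N[OF i] p_pos[OF i], of "\<lambda>a. psum y i (Suc a)"] by simp
    also have "(\<Sum>a<p!i. psum y i (Suc a)) = int (p!i) * rk y - (\<Sum>l<p!i. int l * mu y i l)"
      using sum_partial_sums[of "mu y i" "p!i"] psum_total[OF y i] by (simp add: psum_def)
    also have "int (N div p!i) * \<dots> = (int (N div p!i) * int (p!i)) * rk y - int (N div p!i) * (\<Sum>l<p!i. int l * mu y i l)"
      by (simp add: algebra_simps)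
    also have "int (N div p!i) * int (p!i) = int N" using dvd_N[OF i] by (metis dvd_div_mult_self of_nat_mult)
    finally show ?thesis by (simp add: sum_distrib_left mult.assoc)
  qed
  then have "(\<Sum>i<t. \<Sum>j<N. psum y i (Suc (j mod p!i))) = int t * (int N * rk y) - (\<Sum>i<t. \<Sum>l<p!i. int (N div p!i * l) * mu y i l)"
    by (simp add: sum_subtractf)
  then have "(\<Sum>j<N. \<Sum>i<t. psum y i (Suc (j mod p!i))) = int t * (int N * rk y) - (\<Sum>i<t. \<Sum>l<p!i. int (N div p!i * l) * mu y i l)"
    by (subst sum.swap)
  then have "(\<Sum>j<N. chi (tau_O j) y) = int N * rk y + int N * dg y - rk y * (\<Sum>j<N. orbit_degree j)
      - (\<Sum>i<t. \<Sum>l<p!i. int (N div p!i * l) * mu y i l)"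
    unfolding chi_tau_O(1)[OF y]
    by (simp add: sum_subtractf sum.distrib sum_distrib_left[symmetric] algebra_simps)
  then show ?thesis by (simp add: orbit_degree_sum deg_def)
qed

text \<open>
  The class of the cone of the universal map from the first \<open>n\<close> members of the orbit to \<open>y\<close>. For the whole orbit this is the
  tubular mutation; by \<open>sum_chi_tau_O\<close> it replaces the rank by rank minus degree and keeps the degree.
\<close>

primrec reduce :: "nat \<Rightarrow> kclass \<Rightarrow> kclass" where
  "reduce 0 y = y"
| "reduce (Suc n) y = comb (reduce n y) (- chi (tau_O n) y) (tau_O n)"

lemma reduce_simps:
  "y \<in> K \<Longrightarrow> reduce n y \<in> K"
  "rk (reduce n y) = rk y - (\<Sum>j<n. chi (tau_O j) y)"
  "chi (reduce n y) z = chi y z - (\<Sum>j<n. chi (tau_O j) y * chi (tau_O j) z)"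
  "chi z (reduce n y) = chi z y - (\<Sum>j<n. chi (tau_O j) y * chi z (tau_O j))"
  by (induction n) (simp_all add: comb_K tau_O_simps chi_comb_left chi_comb_right)

lemma deg_tau_O: "deg (tau_O j) = 0"
proof -
  have "(\<Sum>l<p!i. int (N div p!i * l) * mu (tau_O j) i l) = int (N div p!i * (j mod p!i))" if "i < t" for i
  proof -
    have "(\<Sum>l<p!i. int (N div p!i * l) * mu (tau_O j) i l) = (\<Sum>l<p!i. if l = j mod p!i then int (N div p!i * l) else 0)"
      by (intro sum.cong) (auto simp: tau_O_def)
    then show ?thesis using p_pos[OF that] by simp
  qed
  then have "deg (tau_O j) = int N * orbit_degree j - (\<Sum>i<t. int (N div p!i * (j mod p!i)))"
    by (simp add: deg_def tau_O_def)
  also have "\<dots> = (int t - 2) * int N * int j - (\<Sum>i<t. int N * int (j div p!i) + int (N div p!i * (j mod p!i)))"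
    by (simp add: orbit_degree_def sum.distrib sum_distrib_left algebra_simps)
  also have "(\<Sum>i<t. int N * int (j div p!i) + int (N div p!i * (j mod p!i))) = (\<Sum>i<t. int (N div p!i) * int j)"
  proof (rule sum.cong[OF refl])
    fix i assume "i \<in> {..<t}"
    then have "N = N div p!i * p!i" using dvd_N by simp
    then have "N * (j div p!i) + N div p!i * (j mod p!i) = N div p!i * (p!i * (j div p!i) + j mod p!i)"
      by (metis add_mult_distrib2 mult.assoc)
    also have "\<dots> = N div p!i * j" by simp
    finally show "int N * int (j div p!i) + int (N div p!i * (j mod p!i)) = int (N div p!i) * int j"
      by (metis of_nat_add of_nat_mult)
  qed
  also have "\<dots> = (int t - 2) * int N * int j" by (simp add: kappa_eq sum_distrib_right)
  finally show ?thesis by simp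
qed

lemma deg_reduce: "deg (reduce n y) = deg y"
  by (induction n) (simp_all add: deg_comb deg_tau_O)

lemma isom_reduce: "isom (reduce N)"
proof (rule isomI)
  fix y z assume y: "y \<in> K" and z: "z \<in> K"
  let ?a = "\<lambda>j. chi (tau_O j) y" and ?b = "\<lambda>j. chi (tau_O j) z"
  have "chi (tau_O j) (reduce N z) = ?b (Suc j mod N)" if j: "j < N" for j
  proof -
    have "chi (tau_O j) (reduce N z) = ?b j - (\<Sum>l<N. ?b l * (of_bool (j = l) - of_bool (l = Suc j mod N)))"
      using j by (simp add: reduce_simps(4) gram)
    also have "(\<Sum>l<N. ?b l * (of_bool (j = l) - of_bool (l = Suc j mod N)))
      = (\<Sum>l<N. (if l = j then ?b l else 0) - (if l = Suc j mod N then ?b l else 0))"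
      by (intro sum.cong) (auto simp: of_bool_def)
    also have "\<dots> = ?b j - ?b (Suc j mod N)"
      using j N_pos by (simp add: sum_subtractf)
    finally show ?thesis by simp
  qed
  then have "chi (reduce N y) (reduce N z) = chi y (reduce N z) - (\<Sum>j<N. ?a j * ?b (Suc j mod N))"
    by (simp add: reduce_simps(3))
  also have "chi y (reduce N z) = chi y z - (\<Sum>j<N. ?b j * chi y (tau_O j))" by (rule reduce_simps(4))
  also have "(\<Sum>j<N. ?b j * chi y (tau_O j)) = (\<Sum>j<N. ?b (Suc j mod N) * chi y (tau_O (Suc j mod N)))"
    by (rule sum_rotate[OF N_pos, symmetric])
  also have "\<dots> = - (\<Sum>j<N. ?a j * ?b (Suc j mod N))"
    using serre_tau_O[OF y] by (simp add: sum_negf[symmetric] mult.commute)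
  finally show "chi (reduce N y) (reduce N z) = chi y z" by simp
  show "S (reduce N y) (reduce N z) = S y z"
    using sum_chi_tau_O[OF y] sum_chi_tau_O[OF z] by (simp add: S_def reduce_simps deg_reduce algebra_simps)
qed (simp add: reduce_simps)

text \<open>
  The Euclidean algorithm: twists change the degree by arbitrary multiples of the rank, so it can be brought
  between \<open>1\<close> and the rank, up to sign. Then the tubular mutation decreases the absolute value of the rank.
\<close>

lemma transitive: "x \<in> K \<Longrightarrow> \<exists>g. isom g \<and> rk (g x) = 0"
proof (induction "nat \<bar>rk x\<bar>" arbitrary: x rule: less_induct)
  case less
  show ?case
  proof (cases "rk x = 0")
    case True
    then show ?thesis using isom_id by blast
  next
    case False
    let ?s = "sgn (rk x)" and ?m = "\<bar>rk x\<bar>"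
    \<comment> \<open>The offset 1 puts the degree into the range from 1 to m rather than from 0 to m - 1.\<close>
    let ?e = "?s * deg x - 1"
    obtain f where f: "isom f" "rk (f x) = rk x" "deg (f x) = deg x + (- (?e div ?m)) * rk x"
      using shear less.prems by blast
    have m: "?m > 0" using False by simp
    have s: "?s * rk x = ?m" "?s * ?s = 1" using False by (auto simp: sgn_if)
    have "?s * deg (f x) = ?s * deg x - (?e div ?m) * ?m"
      unfolding f(3) by (simp add: algebra_simps s(1)[symmetric])
    also have "\<dots> = ?e mod ?m + 1" by (simp add: minus_div_mult_eq_mod[symmetric])
    finally have d: "0 < ?s * deg (f x)" "?s * deg (f x) \<le> ?m"
      using pos_mod_bound[OF m, of ?e] pos_mod_sign[OF m, of ?e] by linarith+
    let ?y = "reduce N (f x)"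
    have fK: "f x \<in> K" using f less.prems by (simp add: isom_def)
    have "rk ?y = rk x - deg (f x)"
      using sum_chi_tau_O[OF fK] f by (simp add: reduce_simps)
    then have "?s * rk ?y = ?m - ?s * deg (f x)" by (simp add: right_diff_distrib s)
    then have "\<bar>?s * rk ?y\<bar> < ?m" using d by linarith
    then have "\<bar>rk ?y\<bar> < ?m" using False by (simp add: abs_mult)
    then have "nat \<bar>rk ?y\<bar> < nat ?m" by linarith
    then obtain g where g: "isom g" "rk (g ?y) = 0"
      using less.hyps reduce_simps(1)[OF fK] by blast
    then have "isom (\<lambda>x. g (reduce N (f x)))"
      using isom_comp[OF g(1) isom_comp[OF isom_reduce f(1)]] by simp
    then show ?thesis using g by (intro exI[of _ "\<lambda>x. g (reduce N (f x))"]) simp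
  qed
qed

lemma charged: "charged_lattice K comb chi rk deg 1"
  by (rule charged_lattice_if_transitive[OF transitive])

end

section \<open>The tubular weight sequences\<close>

text \<open>
  The other entries of the row sum to at least \<open>r + 1\<close>; the Cauchy--Schwarz inequality bounds the sum of their squares from below.
\<close>

lemma row_negative_entry:
  fixes m :: "nat \<Rightarrow> int"
  assumes j: "j < n" and neg: "m j < 0" and r: "(\<Sum>j<n. m j) = r" "r > 0"
  shows "(int n - 1) + (r + 1)\<^sup>2 \<le> (int n - 1) * (\<Sum>j<n. (m j)\<^sup>2)"
proof -
  let ?m = "m(j := 0)"
  have n: "n \<ge> 1" using j by simp
  have s: "(\<Sum>l<n. m l) = m j + (\<Sum>l\<in>{..<n}-{j}. m l)" "(\<Sum>l<n. (m l)\<^sup>2) = (m j)\<^sup>2 + (\<Sum>l\<in>{..<n}-{j}. (m l)\<^sup>2)"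
    using j by (intro sum.remove; simp)+
  have c: "(\<Sum>l\<in>{..<n}-{j}. m l)\<^sup>2 \<le> int (card ({..<n}-{j})) * (\<Sum>l\<in>{..<n}-{j}. (m l)\<^sup>2)"
  proof -
    obtain f where f: "bij_betw f {..<card ({..<n}-{j})} ({..<n}-{j})"
      using ex_bij_betw_nat_finite[of "{..<n}-{j}"] by (auto simp: lessThan_atLeast0)
    show ?thesis
      using sum_squares_mean[of "m \<circ> f" "card ({..<n}-{j})"] sum.reindex_bij_betw[OF f, of m] sum.reindex_bij_betw[OF f, of "\<lambda>l. (m l)\<^sup>2"]
      by simp
  qed
  have "card ({..<n}-{j}) = n - 1" using j by simp
  then have c': "(r - m j)\<^sup>2 \<le> (int n - 1) * ((\<Sum>l<n. (m l)\<^sup>2) - (m j)\<^sup>2)"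
    using c s r n by (simp add: of_nat_diff algebra_simps)
  have "(r + 1)\<^sup>2 \<le> (r - m j)\<^sup>2" using neg r(2) by (intro power_mono) auto
  moreover have "1 \<le> (m j)\<^sup>2" using neg by (metis int_one_le_iff_zero_less less_irrefl zero_less_power2)
  then have "(int n - 1) * 1 \<le> (int n - 1) * (m j)\<^sup>2" using n by (intro mult_left_mono) auto
  ultimately show ?thesis using c' by (simp add: algebra_simps)
qed

lemma sum_squares_1:
  fixes m :: "nat \<Rightarrow> int"
  assumes s: "(\<Sum>j<n. (m j)\<^sup>2) = 1" and z: "(\<Sum>j<n. m j) = 1"
  shows "\<exists>a<n. \<forall>j<n. m j = (if j = a then 1 else 0)"
proof -
  have l: "\<bar>m j\<bar> \<le> 1" if "j < n" for j
    using member_le_sum_squares[OF that, of m] s by (intro square_le_3_abs_le_1) simp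
  have c: "card {j. j < n \<and> m j = 1} = 1" "card {j. j < n \<and> m j = -1} = 0"
    using sign_sequence_sums[of n m, OF l] s z by linarith+
  obtain a where a: "{j. j < n \<and> m j = 1} = {a}" by (rule card_1_singletonE[OF c(1)])
  have am: "j < n \<and> m j = 1 \<longleftrightarrow> j = a" for j using a by blast
  have b: "{j. j < n \<and> m j = -1} = {}" using c(2) by (simp add: card_eq_0_iff)
  show ?thesis
  proof (intro exI[of _ a] conjI allI impI)
    show "a < n" using am[of a] by blast
    fix j assume j: "j < n"
    have "m j \<noteq> -1" using b j by blast
    then have "m j = 1 \<or> m j = 0" using l[OF j] by linarith
    then show "m j = (if j = a then 1 else 0)" using am[of j] j by auto
  qed
qed

lemma sum_squares_2:
  fixes m :: "nat \<Rightarrow> int"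
  assumes s: "(\<Sum>j<n. (m j)\<^sup>2) = 2" and z: "(\<Sum>j<n. m j) = 2"
  shows "\<exists>a<n. \<exists>b<n. a \<noteq> b \<and> (\<forall>j<n. m j = (if j = a then 1 else 0) + (if j = b then 1 else 0))"
proof -
  have l: "\<bar>m j\<bar> \<le> 1" if "j < n" for j
    using member_le_sum_squares[OF that, of m] s by (intro square_le_3_abs_le_1) simp
  have c: "card {j. j < n \<and> m j = 1} = 2" "card {j. j < n \<and> m j = -1} = 0"
    using sign_sequence_sums[of n m, OF l] s z by linarith+
  obtain a b where ab: "{j. j < n \<and> m j = 1} = {a, b}" "a \<noteq> b" using c(1) unfolding card_2_iff by blast
  have am: "j < n \<and> m j = 1 \<longleftrightarrow> j = a \<or> j = b" for j using ab by blast
  have b: "{j. j < n \<and> m j = -1} = {}" using c(2) by (simp add: card_eq_0_iff)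
  have "m j = (if j = a then 1 else 0) + (if j = b then 1 else 0)" if j: "j < n" for j
  proof -
    have "m j \<noteq> -1" using b j by blast
    then have "m j = 1 \<or> m j = 0" using l[OF j] by linarith
    then show ?thesis using am[of j] j ab(2) by auto
  qed
  moreover have "a < n" "b < n" using am[of a] am[of b] by blast+
  ultimately show ?thesis using ab(2) by blast
qed

context weights
begin

lemma root_norm:
  assumes "root x" shows "(\<Sum>i<t. \<Sum>j<p!i. (mu x i j)\<^sup>2) = 2 + (int t - 2) * (rk x)\<^sup>2"
  using norm_formula[of x] assms by (simp add: root_def algebra_simps)

text \<open>
  The norm formula leaves so little room above the Cauchy--Schwarz bounds that a negative multiplicity forces the rank to be
  small compared with the weight.
\<close>

lemma tubular_negative_mult:
  assumes kappa: "(int t - 2) * int N = (\<Sum>i<t. int (N div p!i))"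
    and x: "root x" "rk x > 0" and i: "i < t" and j: "j < p!i" and neg: "mu x i j < 0"
  shows "(rk x)\<^sup>2 + 2 * int (p!i) * rk x + 2 * int (p!i) \<le> (int (p!i))\<^sup>2"
proof -
  let ?n = "int (p!i)" and ?r = "rk x"
  let ?q = "\<lambda>i. \<Sum>j<p!i. (mu x i j)\<^sup>2"
  have row: "(\<Sum>j<p!i. mu x i j) = ?r" if "i < t" for i using x that by (simp add: root_def K_def)
  have div: "int (N div p!i) * int (p!i) = int N" if "i < t" for i
    using dvd_N[OF that] by (metis dvd_div_mult_self of_nat_mult)
  have "int (N div p!i') * ?r\<^sup>2 \<le> int N * ?q i'" if "i' < t" for i'
  proof -
    have "?r\<^sup>2 \<le> int (p!i') * ?q i'" using sum_squares_mean[of "mu x i'" "p!i'"] row[OF that] by simp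
    then have "int (N div p!i') * ?r\<^sup>2 \<le> int (N div p!i') * (int (p!i') * ?q i')" by (intro mult_left_mono) auto
    then show ?thesis using div[OF that] by (simp add: mult.assoc[symmetric])
  qed
  then have "(\<Sum>i'\<in>{..<t}-{i}. int (N div p!i') * ?r\<^sup>2) \<le> (\<Sum>i'\<in>{..<t}-{i}. int N * ?q i')"
    by (intro sum_mono) auto
  moreover have "(\<Sum>i'<t. int (N div p!i') * ?r\<^sup>2) = int (N div p!i) * ?r\<^sup>2 + (\<Sum>i'\<in>{..<t}-{i}. int (N div p!i') * ?r\<^sup>2)"
    "(\<Sum>i'<t. int N * ?q i') = int N * ?q i + (\<Sum>i'\<in>{..<t}-{i}. int N * ?q i')"
    using i by (intro sum.remove; simp)+
  moreover have "(\<Sum>i'<t. int (N div p!i') * ?r\<^sup>2) = (int t - 2) * int N * ?r\<^sup>2"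
    by (simp add: kappa sum_distrib_right)
  moreover have "(\<Sum>i'<t. int N * ?q i') = int N * (2 + (int t - 2) * ?r\<^sup>2)"
    using root_norm[OF x(1)] by (simp add: sum_distrib_left[symmetric])
  ultimately have "int N * ?q i \<le> int N * 2 + int (N div p!i) * ?r\<^sup>2" by (simp add: algebra_simps)
  then have "int (N div p!i) * (?n * ?q i) \<le> int (N div p!i) * (?n * 2 + ?r\<^sup>2)"
  proof -
    have "int (N div p!i) * (?n * z) = int N * z" for z
      by (subst div[OF i, symmetric]) (simp add: mult.assoc)
    then show ?thesis
      using \<open>int N * ?q i \<le> int N * 2 + int (N div p!i) * ?r\<^sup>2\<close> by (simp only: distrib_left)
  qed
  moreover have "int (N div p!i) > 0" using dvd_N[OF i] N_pos p_pos[OF i]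
    by (simp add: dvd_imp_le div_greater_zero_iff)
  ultimately have u: "?n * ?q i \<le> 2 * ?n + ?r\<^sup>2" by (simp add: mult.commute)
  have "(?n - 1) + (?r + 1)\<^sup>2 \<le> (?n - 1) * ?q i"
    by (rule row_negative_entry[OF j neg row[OF i] x(2)])
  then have "?n * ((?n - 1) + (?r + 1)\<^sup>2) \<le> ?n * ((?n - 1) * ?q i)" by (intro mult_left_mono) auto
  also have "\<dots> = (?n - 1) * (?n * ?q i)" by (simp add: algebra_simps)
  also have "\<dots> \<le> (?n - 1) * (2 * ?n + ?r\<^sup>2)" using j by (intro mult_left_mono u) auto
  finally show ?thesis by (simp add: power2_eq_square algebra_simps)
qed

lemma tubular_mult_nonneg:
  assumes kappa: "(int t - 2) * int N = (\<Sum>i<t. int (N div p!i))"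
    and x: "root x" "rk x > 0" and i: "i < t" and j: "j < p!i" and small: "p!i \<le> 4 \<or> (p!i = 6 \<and> rk x \<ge> 2)"
  shows "0 \<le> mu x i j"
proof (rule ccontr)
  assume "\<not> 0 \<le> mu x i j"
  then have le: "(rk x)\<^sup>2 + 2 * int (p!i) * rk x + 2 * int (p!i) \<le> (int (p!i))\<^sup>2"
    using tubular_negative_mult[OF kappa x i j] by simp
  have r: "(rk x)\<^sup>2 \<ge> rk x" using x(2) by (simp add: power2_eq_square mult_le_cancel_left1)
  have "p!i = 1 \<or> p!i = 2 \<or> p!i = 3 \<or> p!i = 4 \<or> (p!i = 6 \<and> rk x \<ge> 2)" using small j p_pos[OF i] by linarith
  then show False using le r x(2) by (elim disjE) auto
qed

lemma gram_tau_O: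
  "chi (tau_O i) (tau_O j) = 1 + orbit_degree j - orbit_degree i - (\<Sum>b<t. of_bool (i mod p!b < j mod p!b))"
proof -
  have "1 - psum (tau_O j) b (Suc (i mod p!b)) = of_bool (i mod p!b < j mod p!b)" if "b < t" for b
    using that p_pos[OF that] by (subst psum_tau_O) (auto simp: Suc_le_eq less_Suc_eq_le)
  then show ?thesis
    unfolding chi_tau_O(1)[OF tau_O_simps(2)] by (simp add: tau_O_simps) (simp add: tau_O_def)
qed

end

lemma lessThan_numeral_cases:
  "(i::nat) < 2 \<longleftrightarrow> i = 0 \<or> i = 1" "i < 3 \<longleftrightarrow> i = 0 \<or> i = 1 \<or> i = 2"
  "i < 4 \<longleftrightarrow> i = 0 \<or> i = 1 \<or> i = 2 \<or> i = 3"
  "i < 6 \<longleftrightarrow> i = 0 \<or> i = 1 \<or> i = 2 \<or> i = 3 \<or> i = 4 \<or> i = 5"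
  by auto

lemma weightsI:
  assumes "\<forall>q\<in>set p. 0 < q \<and> q dvd N" "0 < N" shows "weights p N"
  using assms by unfold_locales auto

text \<open>
  It remains to evaluate the Gram matrix of the orbit, and to show that multiplicities are nonnegative. The bound of
  \<open>tubular_negative_mult\<close> suffices for this except for weight \<open>6\<close> and rank \<open>1\<close>, where the sums of squares of the two other
  rows are also at least \<open>1\<close>.
\<close>

lemma tubular_2222: "charged_lattice (weights.K [2,2,2,2]) comb (weights.chi [2,2,2,2]) rk (weights.deg [2,2,2,2] 2) 1"
proof -
  interpret weights "[2,2,2,2]" 2 by (rule weightsI) auto
  have kap: "(int t - 2) * int 2 = (\<Sum>i<t. int (2 div [2,2,2,2]!i))" by (simp add: lessThan_Suc)
  interpret tubular_weights "[2,2,2,2]" 2 0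
  proof
    show "0 \<le> mu x i j" if "root x" "rk x > 0" "i < t" "j < [2,2,2,2]!i" for x i j
      by (rule tubular_mult_nonneg[OF kap that]) (use that(3) in \<open>auto simp: less_Suc_eq\<close>)
    show "chi (tau_O i) (tau_O j) = of_bool (i = j) - of_bool (j = Suc i mod 2)" if "i < 2" "j < 2" for i j
      using that unfolding lessThan_numeral_cases gram_tau_O orbit_degree_def
      by (elim disjE; simp add: lessThan_Suc)
  qed (use kap in \<open>simp_all add: orbit_degree_def lessThan_Suc lessThan_nat_numeral\<close>)
  show ?thesis by (rule charged)
qed

lemma tubular_333: "charged_lattice (weights.K [3,3,3]) comb (weights.chi [3,3,3]) rk (weights.deg [3,3,3] 3) 1"
proof -
  interpret weights "[3,3,3]" 3 by (rule weightsI) auto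
  have kap: "(int t - 2) * int 3 = (\<Sum>i<t. int (3 div [3,3,3]!i))" by (simp add: lessThan_Suc)
  interpret tubular_weights "[3,3,3]" 3 0
  proof
    show "0 \<le> mu x i j" if "root x" "rk x > 0" "i < t" "j < [3,3,3]!i" for x i j
      by (rule tubular_mult_nonneg[OF kap that]) (use that(3) in \<open>auto simp: less_Suc_eq\<close>)
    show "chi (tau_O i) (tau_O j) = of_bool (i = j) - of_bool (j = Suc i mod 3)" if "i < 3" "j < 3" for i j
      using that unfolding lessThan_numeral_cases gram_tau_O orbit_degree_def
      by (elim disjE; simp add: lessThan_Suc)
  qed (use kap in \<open>simp_all add: orbit_degree_def lessThan_Suc lessThan_nat_numeral\<close>)
  show ?thesis by (rule charged)
qed

lemma tubular_244: "charged_lattice (weights.K [2,4,4]) comb (weights.chi [2,4,4]) rk (weights.deg [2,4,4] 4) 1"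
proof -
  interpret weights "[2,4,4]" 4 by (rule weightsI) auto
  have kap: "(int t - 2) * int 4 = (\<Sum>i<t. int (4 div [2,4,4]!i))" by (simp add: lessThan_Suc)
  interpret tubular_weights "[2,4,4]" 4 1
  proof
    show "0 \<le> mu x i j" if "root x" "rk x > 0" "i < t" "j < [2,4,4]!i" for x i j
      by (rule tubular_mult_nonneg[OF kap that]) (use that(3) in \<open>auto simp: less_Suc_eq\<close>)
    show "chi (tau_O i) (tau_O j) = of_bool (i = j) - of_bool (j = Suc i mod 4)" if "i < 4" "j < 4" for i j
      using that unfolding lessThan_numeral_cases gram_tau_O orbit_degree_def
      by (elim disjE; simp add: lessThan_Suc)
  qed (use kap in \<open>simp_all add: orbit_degree_def lessThan_Suc lessThan_nat_numeral\<close>)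
  show ?thesis by (rule charged)
qed

lemma tubular_236: "charged_lattice (weights.K [2,3,6]) comb (weights.chi [2,3,6]) rk (weights.deg [2,3,6] 6) 1"
proof -
  interpret weights "[2,3,6]" 6 by (rule weightsI) auto
  have kap: "(int t - 2) * int 6 = (\<Sum>i<t. int (6 div [2,3,6]!i))" by (simp add: lessThan_Suc)
  interpret tubular_weights "[2,3,6]" 6 2
  proof
    show "0 \<le> mu x i j" if x: "root x" "rk x > 0" "i < t" "j < [2,3,6]!i" for x i j
    proof (cases "rk x \<ge> 2 \<or> i \<noteq> 2")
      case True
      then show ?thesis
        by (intro tubular_mult_nonneg[OF kap x]) (use x(3) in \<open>auto simp: less_Suc_eq\<close>)
    next
      case False
      then have r: "rk x = 1" "i = 2" using x(2) by auto
      let ?q = "\<lambda>i. \<Sum>j<[2,3,6]!i. (mu x i j)\<^sup>2"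
      have row: "(\<Sum>j<[2,3,6]!i. mu x i j) = 1" if "i < 3" for i
        using x(1) that r by (simp add: root_def K_def)
      have q: "1 \<le> ?q i" if "i < 3" for i
        using abs_sum_le_sum_squares[of "mu x i" "[2,3,6]!i"] row[OF that] by simp
      have "?q 0 + ?q 1 + ?q 2 = 3" using root_norm[OF x(1)] r by (simp add: numeral_2_eq_2)
      moreover have "1 \<le> ?q 0" "1 \<le> ?q 1" using q[of 0] q[of 1] by simp_all
      ultimately have q2: "?q 2 \<le> 1" by linarith
      show ?thesis
      proof (rule ccontr)
        assume "\<not> ?thesis"
        then have "(int 6 - 1) + (1 + 1)\<^sup>2 \<le> (int 6 - 1) * (\<Sum>j<6. (mu x 2 j)\<^sup>2)"
          using row_negative_entry[of j 6 "mu x 2" 1] row[of 2] x(4) r by simp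
        then show False using q2 by simp
      qed
    qed
    show "chi (tau_O i) (tau_O j) = of_bool (i = j) - of_bool (j = Suc i mod 6)" if "i < 6" "j < 6" for i j
      using that unfolding lessThan_numeral_cases gram_tau_O orbit_degree_def
      by (elim disjE; simp add: lessThan_Suc)
  qed (use kap in \<open>simp_all add: orbit_degree_def lessThan_Suc lessThan_nat_numeral\<close>)
  show ?thesis by (rule charged)
qed

section \<open>The domestic weight sequences\<close>

lemma triangle_delta:
  fixes f :: "nat \<Rightarrow> int"
  assumes "\<And>j. j < n \<Longrightarrow> g j = (if j = c then (1::int) else 0)" "c < n"
  shows "(\<Sum>j<n. \<Sum>l<j. f l * g j) = (\<Sum>l<c. f l)"
proof -
  have "(\<Sum>j<n. \<Sum>l<j. f l * g j) = (\<Sum>j<n. if j = c then (\<Sum>l<j. f l) else 0)"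
    by (intro sum.cong) (auto simp: assms(1))
  then show ?thesis using assms(2) by simp
qed

lemma triangle_delta2:
  fixes f :: "nat \<Rightarrow> int"
  assumes "\<And>j. j < n \<Longrightarrow> g j = (if j = c then (1::int) else 0) + (if j = e then 1 else 0)" "c < n" "e < n"
  shows "(\<Sum>j<n. \<Sum>l<j. f l * g j) = (\<Sum>l<c. f l) + (\<Sum>l<e. f l)"
proof -
  have "(\<Sum>j<n. \<Sum>l<j. f l * g j) = (\<Sum>j<n. (if j = c then (\<Sum>l<j. f l) else 0) + (if j = e then (\<Sum>l<j. f l) else 0))"
    by (intro sum.cong) (auto simp: assms(1) distrib_left sum.distrib)
  then show ?thesis using assms(2,3) by (simp add: sum.distrib)
qed

lemma sum_delta_weighted:
  assumes "\<And>j. j < n \<Longrightarrow> g j = (if j = c then (1::int) else 0)" "c < n"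
  shows "(\<Sum>j<n. int (k * j) * g j) = int (k * c)" "m \<le> n \<Longrightarrow> (\<Sum>j<m. g j) = of_bool (c < m)"
proof -
  have "(\<Sum>j<n. int (k * j) * g j) = (\<Sum>j<n. if j = c then int (k * j) else 0)"
    by (intro sum.cong) (auto simp: assms(1))
  then show "(\<Sum>j<n. int (k * j) * g j) = int (k * c)" using assms(2) by simp
  assume "m \<le> n"
  then have "(\<Sum>j<m. g j) = (\<Sum>j<m. if j = c then 1 else 0)" by (intro sum.cong) (auto simp: assms(1))
  then show "(\<Sum>j<m. g j) = of_bool (c < m)" by simp
qed

lemma sum_delta2_weighted:
  assumes "\<And>j. j < n \<Longrightarrow> g j = (if j = c then (1::int) else 0) + (if j = e then 1 else 0)" "c < n" "e < n"
  shows "(\<Sum>j<n. int (k * j) * g j) = int (k * c) + int (k * e)" "m \<le> n \<Longrightarrow> (\<Sum>j<m. g j) = of_bool (c < m) + of_bool (e < m)"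
proof -
  have "(\<Sum>j<n. int (k * j) * g j) = (\<Sum>j<n. (if j = c then int (k * j) else 0) + (if j = e then int (k * j) else 0))"
    by (intro sum.cong) (auto simp: assms(1))
  then show "(\<Sum>j<n. int (k * j) * g j) = int (k * c) + int (k * e)" using assms(2,3) by (simp add: sum.distrib)
  assume "m \<le> n"
  then have "(\<Sum>j<m. g j) = (\<Sum>j<m. (if j = c then 1 else 0) + (if j = e then 1 else 0))" by (intro sum.cong) (auto simp: assms(1))
  then show "(\<Sum>j<m. g j) = of_bool (c < m) + of_bool (e < m)" by (simp add: sum.distrib)
qed

text \<open>
  The norm formula allows only roots of rank \<open>1\<close> among those of positive rank, and each row of such a root is a unit vector: these are the classes
  of line bundles. Stability is a computation with two positions \<open>c < a\<close>, \<open>e < b\<close> and the difference \<open>D\<close> of the degrees.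
\<close>

lemma domestic_two:
  assumes ab: "0 < a" "0 < b"
  shows "charged_lattice (weights.K [a,b]) comb (weights.chi [a,b]) rk (weights.deg [a,b] (a * b)) 1"
proof -
  interpret weights "[a,b]" "a * b" by (rule weightsI) (use ab in auto)
  have rows: "i < t \<longleftrightarrow> i = 0 \<or> i = 1" for i by auto
  have line: "\<exists>c e. c < a \<and> e < b \<and> rk x = 1 \<and> (\<forall>j<a. mu x 0 j = (if j = c then 1 else 0)) \<and>
     (\<forall>j<b. mu x 1 j = (if j = e then 1 else 0))" if x: "root x" "rk x > 0" for x
  proof -
    have s: "(\<Sum>j<a. (mu x 0 j)\<^sup>2) + (\<Sum>j<b. (mu x 1 j)\<^sup>2) = 2" using root_norm[OF x(1)] by simp
    have r: "(\<Sum>j<a. mu x 0 j) = rk x" "(\<Sum>j<b. mu x 1 j) = rk x" using x(1) by (auto simp: root_def K_def)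
    have "rk x \<le> (\<Sum>j<a. (mu x 0 j)\<^sup>2)" "rk x \<le> (\<Sum>j<b. (mu x 1 j)\<^sup>2)"
      using abs_sum_le_sum_squares[of "mu x 0" a] abs_sum_le_sum_squares[of "mu x 1" b] r by simp_all
    then have e: "rk x = 1" "(\<Sum>j<a. (mu x 0 j)\<^sup>2) = 1" "(\<Sum>j<b. (mu x 1 j)\<^sup>2) = 1" using s x(2) by linarith+
    obtain c where "c < a" "\<forall>j<a. mu x 0 j = (if j = c then 1 else 0)"
      using sum_squares_1[OF e(2) trans[OF r(1) e(1)]] by blast
    moreover obtain f where "f < b" "\<forall>j<b. mu x 1 j = (if j = f then 1 else 0)"
      using sum_squares_1[OF e(3) trans[OF r(2) e(1)]] by blast
    ultimately show ?thesis using e(1) by (intro exI[of _ c] exI[of _ f]) simp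
  qed
  interpret semistable_weights "[a,b]" "a * b"
  proof
    show "0 \<le> mu x i j" if h: "root x" "rk x > 0" "i < t" "j < [a,b]!i" for x i j
    proof -
      obtain c e where "\<forall>j<a. mu x 0 j = (if j = c then 1 else 0)" "\<forall>j<b. mu x 1 j = (if j = e then 1 else 0)"
        using line[OF h(1,2)] by blast
      then have "0 \<le> mu x 0 j" if "j < a" for j using that by simp
      moreover have "0 \<le> mu x 1 j" if "j < b" for j
        using that \<open>\<forall>j<b. mu x 1 j = (if j = e then 1 else 0)\<close> by simp
      moreover have "i = 0 \<or> i = 1" using h(3) by auto
      ultimately show ?thesis using h(4) by (elim disjE) simp_all
    qed
    show "(int t - 2) * int (a * b) \<le> (\<Sum>i<t. int (a * b div [a, b] ! i))"
      by (simp add: sum_nonneg)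
  qed
  have forms: "chi x y = 1 + dg y - dg x - of_bool (c < c') - of_bool (e < e')"
      "deg x = int (a * b) * dg x - int (b * c) - int (a * e)"
    if "c < a" "e < b" "rk x = 1" "\<forall>j<a. mu x 0 j = (if j = c then 1 else 0)" "\<forall>j<b. mu x 1 j = (if j = e then 1 else 0)"
     and "c' < a" "e' < b" "rk y = 1" "\<forall>j<a. mu y 0 j = (if j = c' then 1 else 0)" "\<forall>j<b. mu y 1 j = (if j = e' then 1 else 0)"
   for x y c e c' e'
  proof -
    have "(\<Sum>j<a. \<Sum>l<j. mu x 0 l * mu y 0 j) = of_bool (c < c')" "(\<Sum>j<b. \<Sum>l<j. mu x 1 l * mu y 1 j) = of_bool (e < e')"
      using that triangle_delta[of a "mu y 0" c' "mu x 0"] triangle_delta[of b "mu y 1" e' "mu x 1"]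
        sum_delta_weighted(2)[of a "mu x 0" c c'] sum_delta_weighted(2)[of b "mu x 1" e e'] by simp_all
    then show "chi x y = 1 + dg y - dg x - of_bool (c < c') - of_bool (e < e')"
      using that by (simp add: chi_def)
    show "deg x = int (a * b) * dg x - int (b * c) - int (a * e)"
      using sum_delta_weighted(1)[of a "mu x 0" c b] sum_delta_weighted(1)[of b "mu x 1" e a] that ab by (simp add: deg_def)
  qed
  have arith: "(P + Q + int (a * b) * D \<ge> 0 \<longrightarrow> 0 \<le> 1 + D - of_bool (u < 0) - of_bool (v < 0)) \<and>
     (P + Q + int (a * b) * D > 0 \<longrightarrow> 1 - D - of_bool (u > 0) - of_bool (v > 0) \<le> 0)"
    if "u < int a" "v < int b" and PQ: "P = int b * u" "Q = int a * v" for u v P Q D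
  proof -
    have lt: "P < int (a * b)" "Q < int (a * b)"
      using that ab mult_strict_left_mono[of u "int a" "int b"] mult_strict_left_mono[of v "int b" "int a"]
      by (simp_all add: mult.commute)
    have sg: "u < 0 \<longrightarrow> P < 0" "v < 0 \<longrightarrow> Q < 0" "u \<le> 0 \<longrightarrow> P \<le> 0" "v \<le> 0 \<longrightarrow> Q \<le> 0"
      using ab by (simp_all add: PQ mult_less_0_iff mult_le_0_iff)
    have "D \<le> -2 \<or> D = -1 \<or> D = 0 \<or> D \<ge> 1" by linarith
    moreover have "D \<le> -2 \<Longrightarrow> int (a * b) * D \<le> int (a * b) * (-2)" by (intro mult_left_mono) auto
    ultimately show ?thesis using lt sg by (elim disjE) (auto simp: of_bool_def)
  qed
  show ?thesis
  proof (rule charged_lattice_if_domestic)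
    show "0 < chi x x" if "x \<in> K" "rk x \<noteq> 0" for x
    proof -
      have "(\<Sum>j<a. mu x 0 j) = rk x" using that(1) by (auto simp: K_def)
      then have "0 < (\<Sum>j<a. (mu x 0 j)\<^sup>2)" using abs_sum_le_sum_squares[of "mu x 0" a] that(2) by simp
      moreover have "0 \<le> (\<Sum>j<b. (mu x 1 j)\<^sup>2)" by (simp add: sum_nonneg)
      ultimately have "0 < 2 * chi x x" using norm_formula[OF that(1)] by simp
      then show ?thesis by simp
    qed
    fix x y assume x: "root x" "root y" "rk x > 0" "rk y > 0"
    obtain c e where ce: "c < a" "e < b" "rk x = 1" "\<forall>j<a. mu x 0 j = (if j = c then 1 else 0)" "\<forall>j<b. mu x 1 j = (if j = e then 1 else 0)"
      using line[OF x(1,3)] by blast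
    obtain c' e' where ce': "c' < a" "e' < b" "rk y = 1" "\<forall>j<a. mu y 0 j = (if j = c' then 1 else 0)" "\<forall>j<b. mu y 1 j = (if j = e' then 1 else 0)"
      using line[OF x(2,4)] by blast
    note f = forms[OF ce ce'] forms[OF ce' ce]
    have S: "S x y = int b * (int c - int c') + int a * (int e - int e') + int (a * b) * (dg y - dg x)"
      using ce(3) ce'(3) f(2,4) by (simp add: S_def algebra_simps)
    have "int c - int c' < int a" "int e - int e' < int b" using ce ce' by auto
    note A = arith[OF this refl refl, of "dg y - dg x"]
    show "0 \<le> chi x y" if "S x y \<ge> 0" using A that unfolding S f(1) by (auto simp: of_bool_def)
    show "chi y x \<le> 0" if "S x y > 0" using A that unfolding S f(3) by (auto simp: of_bool_def)
  qed
qed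

text \<open>
  By the norm formula the roots of positive rank are the classes of line bundles (\<open>line x a\<close>, with \<open>a\<close> the position in the
  third flag) and of bundles of rank \<open>2\<close> (\<open>plane x a b\<close>), both rows of weight \<open>2\<close> of which are \<open>(1, 1)\<close>. In each of
  the four cases \<open>S x y\<close> is, up to a positive factor, \<open>n G\<close> minus a difference of positions, where \<open>G\<close> is an integer
  determined by the remaining data, and only four ranges of \<open>G\<close> have to be distinguished.
\<close>

lemma domestic_22n:
  assumes n: "0 < n"
  shows "charged_lattice (weights.K [2,2,n]) comb (weights.chi [2,2,n]) rk (weights.deg [2,2,n] (2 * n)) 1"
proof -
  interpret weights "[2,2,n]" "2 * n" by (rule weightsI) (use n in auto)
  have K: "mu x 0 0 + mu x 0 1 = rk x" "mu x 1 0 + mu x 1 1 = rk x" "(\<Sum>j<n. mu x 2 j) = rk x" if "x \<in> K" for x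
    using that[unfolded K_def, THEN CollectD, rule_format, of 0] that[unfolded K_def, THEN CollectD, rule_format, of 1]
      that[unfolded K_def, THEN CollectD, rule_format, of 2] by (simp_all add: lessThan_nat_numeral)
  let ?q = "\<lambda>x. \<Sum>j<n. (mu x 2 j)\<^sup>2"
  have three: "(\<Sum>i<length [2,2,n]. f i) = f 0 + f 1 + f 2" for f :: "nat \<Rightarrow> int"
    by (simp add: numeral_2_eq_2)
  have two: "(\<Sum>j<2::nat. f j) = f 0 + f 1" for f :: "nat \<Rightarrow> int" by (simp add: numeral_2_eq_2)
  have chi_form: "chi x y = rk x * rk y + rk x * dg y - rk y * dg x - mu x 0 0 * mu y 0 1 - mu x 1 0 * mu y 1 1
      - (\<Sum>j<n. \<Sum>l<j. mu x 2 l * mu y 2 j)" for x y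
    unfolding chi_def three by (simp add: two)
  have deg_form: "deg x = 2 * int n * dg x - int n * mu x 0 1 - int n * mu x 1 1 - (\<Sum>j<n. int (2 * j) * mu x 2 j)" for x
    using n unfolding deg_def three by (simp add: two)
  have norm: "4 * chi x x = (mu x 0 0 - mu x 0 1)\<^sup>2 + (mu x 1 0 - mu x 1 1)\<^sup>2 + 2 * ?q x" if "x \<in> K" for x
  proof -
    have "2 * chi x x = ((mu x 0 0)\<^sup>2 + (mu x 0 1)\<^sup>2) + ((mu x 1 0)\<^sup>2 + (mu x 1 1)\<^sup>2) + ?q x - (rk x)\<^sup>2"
      using norm_formula[OF that] unfolding three by (simp add: two)
    moreover have "2 * (u\<^sup>2 + v\<^sup>2) = (u + v)\<^sup>2 + (u - v)\<^sup>2" for u v :: int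
      by (simp add: power2_eq_square algebra_simps)
    from this[of "mu x 0 0" "mu x 0 1"] this[of "mu x 1 0" "mu x 1 1"]
    have "2 * ((mu x 0 0)\<^sup>2 + (mu x 0 1)\<^sup>2) = (rk x)\<^sup>2 + (mu x 0 0 - mu x 0 1)\<^sup>2"
      "2 * ((mu x 1 0)\<^sup>2 + (mu x 1 1)\<^sup>2) = (rk x)\<^sup>2 + (mu x 1 0 - mu x 1 1)\<^sup>2"
      using K[OF that] by simp_all
    moreover have "2 * c = A + B + q - r \<Longrightarrow> 2 * A = r + s \<Longrightarrow> 2 * B = r + u \<Longrightarrow> 4 * c = s + u + 2 * q"
      for c A B q r s u :: int by linarith
    ultimately show ?thesis by blast
  qed
  define line where "line x a \<longleftrightarrow> rk x = 1 \<and> a < n \<and> (\<forall>j<n. mu x 2 j = (if j = a then 1 else 0)) \<and>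
     (mu x 0 1 = 0 \<or> mu x 0 1 = 1) \<and> (mu x 1 1 = 0 \<or> mu x 1 1 = 1) \<and> mu x 0 0 = 1 - mu x 0 1 \<and> mu x 1 0 = 1 - mu x 1 1" for x a
  define plane where "plane x a b \<longleftrightarrow> rk x = 2 \<and> a < n \<and> b < n \<and> (\<forall>j<n. mu x 2 j = (if j = a then 1 else 0) + (if j = b then 1 else 0)) \<and>
     mu x 0 1 = 1 \<and> mu x 1 1 = 1 \<and> mu x 0 0 = 1 \<and> mu x 1 0 = 1" for x a b
  have bundles: "(\<exists>a. line x a) \<or> (\<exists>a b. plane x a b)" if x: "root x" "rk x > 0" for x
  proof -
    have xK: "x \<in> K" using x by (simp add: root_def)
    let ?s = "mu x 0 0 - mu x 0 1" and ?u = "mu x 1 0 - mu x 1 1"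
    have e: "?s\<^sup>2 + ?u\<^sup>2 + 2 * ?q x = 4" using norm[OF xK] x by (simp add: root_def)
    have s: "?s = rk x - 2 * mu x 0 1" "?u = rk x - 2 * mu x 1 1" using K[OF xK] by linarith+
    have rq: "rk x \<le> ?q x" using abs_sum_le_sum_squares[of "mu x 2" n] K(3)[OF xK] by simp
    have nn: "0 \<le> ?s\<^sup>2" "0 \<le> ?u\<^sup>2" by simp_all
    have "rk x = 1 \<or> rk x = 2" using e rq nn x(2) by linarith
    then show ?thesis
    proof
      assume r: "rk x = 1"
      have "?s \<noteq> 0" "?u \<noteq> 0" using s r by presburger+
      then have "1 \<le> ?s\<^sup>2" "1 \<le> ?u\<^sup>2" by (metis int_one_le_iff_zero_less zero_less_power2)+
      then have f: "?q x = 1" "?s\<^sup>2 = 1" "?u\<^sup>2 = 1" using e rq r nn by linarith+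
      obtain a where "a < n" "\<forall>j<n. mu x 2 j = (if j = a then 1 else 0)"
        using sum_squares_1[OF f(1)] K(3)[OF xK] r by auto
      moreover have "?s = 1 \<or> ?s = -1" "?u = 1 \<or> ?u = -1" using f by (simp_all add: power2_eq_1_iff)
      then have "mu x 0 1 = 0 \<or> mu x 0 1 = 1" "mu x 1 1 = 0 \<or> mu x 1 1 = 1" using s r by auto
      ultimately have "line x a" unfolding line_def using r K[OF xK] by auto
      then show ?thesis by blast
    next
      assume r: "rk x = 2"
      have f: "?q x = 2" "?s\<^sup>2 = 0" "?u\<^sup>2 = 0" using e rq r nn by linarith+
      obtain a b where "a < n" "b < n" "\<forall>j<n. mu x 2 j = (if j = a then 1 else 0) + (if j = b then 1 else 0)"
        using sum_squares_2[OF f(1)] K(3)[OF xK] r by auto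
      moreover have "?s = 0" "?u = 0" using f by simp_all
      ultimately have "plane x a b" unfolding plane_def using r K[OF xK] by auto
      then show ?thesis by blast
    qed
  qed
  interpret semistable_weights "[2,2,n]" "2 * n"
  proof
    show "(int t - 2) * int (2 * n) \<le> (\<Sum>i<t. int (2 * n div [2, 2, n] ! i))"
      using n unfolding three by simp
    show "0 \<le> mu x i j" if h: "root x" "rk x > 0" "i < t" "j < [2,2,n]!i" for x i j
    proof -
      have nonneg: "0 \<le> mu x 0 0" "0 \<le> mu x 0 1" "0 \<le> mu x 1 0" "0 \<le> mu x 1 1" "\<And>j. j < n \<Longrightarrow> 0 \<le> mu x 2 j"
        using bundles[OF h(1,2)] by (auto simp: line_def plane_def)
      have "i = 0 \<or> i = 1 \<or> i = 2" using h(3) by auto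
      then show ?thesis
      proof (elim disjE)
        assume i: "i = 0"
        then have "j = 0 \<or> j = 1" using h(4) by auto
        then show ?thesis using nonneg i by auto
      next
        assume i: "i = 1"
        then have "j = 0 \<or> j = 1" using h(4) by auto
        then show ?thesis using nonneg i by auto
      next
        assume i: "i = 2"
        then show ?thesis using nonneg h(4) by simp
      qed
    qed
  qed
  have deg_line: "deg x = 2 * int n * dg x - int n * mu x 0 1 - int n * mu x 1 1 - 2 * int a" if "line x a" for x a
    using that sum_delta_weighted(1)[of n "mu x 2" a 2] by (simp add: deg_form line_def)
  have deg_plane: "deg x = 2 * int n * dg x - 2 * int n - 2 * int a - 2 * int b" if "plane x a b" for x a b
    using that sum_delta2_weighted(1)[of n "mu x 2" a b 2] by (simp add: deg_form plane_def)
  have psum_line: "m \<le> n \<Longrightarrow> (\<Sum>j<m. mu x 2 j) = of_bool (a < m)" if "line x a" for x a m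
    using that sum_delta_weighted(2)[of n "mu x 2" a m] by (simp add: line_def)
  have psum_plane: "m \<le> n \<Longrightarrow> (\<Sum>j<m. mu x 2 j) = of_bool (a < m) + of_bool (b < m)" if "plane x a b" for x a b m
    using that sum_delta2_weighted(2)[of n "mu x 2" a b m] by (simp add: plane_def)
  have to_line: "chi x y = rk x * 1 + rk x * dg y - dg x - mu x 0 0 * mu y 0 1 - mu x 1 0 * mu y 1 1 - (\<Sum>l<c. mu x 2 l)"
    if "line y c" for x y c
    using that triangle_delta[of n "mu y 2" c "mu x 2"] by (simp add: chi_form line_def)
  have to_plane: "chi x y = rk x * 2 + rk x * dg y - 2 * dg x - mu x 0 0 - mu x 1 0 - (\<Sum>l<c. mu x 2 l) - (\<Sum>l<e. mu x 2 l)"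
    if "plane y c e" for x y c e
    using that triangle_delta2[of n "mu y 2" c e "mu x 2"] by (simp add: chi_form plane_def)
  have steps: "D \<le> -2 \<Longrightarrow> int n * D \<le> - 2 * int n" "D \<ge> 1 \<Longrightarrow> int n * D \<ge> int n" for D
    using mult_left_mono[of D "-2" "int n"] mult_left_mono[of 1 D "int n"] by simp_all
  have cases4: "D \<le> -2 \<or> D = -1 \<or> D = 0 \<or> D \<ge> 1" for D :: int by linarith
  have LL: "(S x y \<ge> 0 \<longrightarrow> 0 \<le> chi x y) \<and> (S x y > 0 \<longrightarrow> chi y x \<le> 0)" if x: "line x a" and y: "line y c" for x y a c
  proof -
    define G where "G = 2 * (dg y - dg x) - (mu y 0 1 - mu x 0 1) - (mu y 1 1 - mu x 1 1)"
    have ac: "a < n" "c < n" "rk x = 1" "rk y = 1" using x y by (auto simp: line_def)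
    have S: "S x y = int n * G - 2 * (int c - int a)"
      unfolding S_def deg_line[OF x] deg_line[OF y] using ac by (simp add: G_def algebra_simps)
    have G: "S x y \<ge> 0 \<Longrightarrow> G \<ge> -1 \<and> (G \<le> 0 \<longrightarrow> c \<le> a)" "S x y > 0 \<Longrightarrow> G \<le> 0 \<longrightarrow> c < a"
      using cases4[of G] steps[of G] ac unfolding S by auto
    have e: "mu x 0 1 = 0 \<or> mu x 0 1 = 1" "mu x 1 1 = 0 \<or> mu x 1 1 = 1" "mu y 0 1 = 0 \<or> mu y 0 1 = 1" "mu y 1 1 = 0 \<or> mu y 1 1 = 1"
      and z: "mu x 0 0 = 1 - mu x 0 1" "mu x 1 0 = 1 - mu x 1 1" "mu y 0 0 = 1 - mu y 0 1" "mu y 1 0 = 1 - mu y 1 1"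
      using x y by (auto simp: line_def)
    have c1: "chi x y = 1 + (dg y - dg x) - (1 - mu x 0 1) * mu y 0 1 - (1 - mu x 1 1) * mu y 1 1 - of_bool (a < c)"
      using to_line[OF y, of x] psum_line[OF x, of c] ac z by simp
    have c2: "chi y x = 1 - (dg y - dg x) - (1 - mu y 0 1) * mu x 0 1 - (1 - mu y 1 1) * mu x 1 1 - of_bool (c < a)"
      using to_line[OF x, of y] psum_line[OF y, of a] ac z by simp
    have "S x y \<ge> 0 \<longrightarrow> 0 \<le> chi x y"
      using G(1) e unfolding c1 G_def by (elim disjE) (auto simp: of_bool_def)
    moreover have "S x y > 0 \<longrightarrow> chi y x \<le> 0"
      using G e unfolding c2 G_def by (elim disjE) (auto simp: of_bool_def)
    ultimately show ?thesis by blast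
  qed
  have LP: "(S x y \<ge> 0 \<longrightarrow> 0 \<le> chi x y) \<and> (S x y > 0 \<longrightarrow> chi y x \<le> 0)" if x: "line x a" and y: "plane y c e" for x y a c e
  proof -
    define G where "G = dg y - 2 * dg x - 1 + mu x 0 1 + mu x 1 1"
    have ac: "a < n" "c < n" "e < n" "rk x = 1" "rk y = 2" using x y by (auto simp: line_def plane_def)
    have S: "S x y = 2 * (int n * G - (int c + int e - 2 * int a))"
      unfolding S_def deg_line[OF x] deg_plane[OF y] using ac by (simp add: G_def algebra_simps)
    have c1: "chi x y = G + 1 - of_bool (a < c) - of_bool (a < e)"
      using to_plane[OF y, of x] psum_line[OF x, of c] psum_line[OF x, of e] ac x by (simp add: line_def G_def)
    have c2: "chi y x = 1 - G - of_bool (c < a) - of_bool (e < a)"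
      using to_line[OF x, of y] psum_plane[OF y, of a] ac y by (simp add: plane_def G_def)
    show ?thesis
      using cases4[of G] steps[of G] ac unfolding S c1 c2 by (elim disjE) (auto simp: of_bool_def)
  qed
  have PL: "(S x y \<ge> 0 \<longrightarrow> 0 \<le> chi x y) \<and> (S x y > 0 \<longrightarrow> chi y x \<le> 0)" if x: "plane x a b" and y: "line y c" for x y a b c
  proof -
    define G where "G = 2 * dg y - dg x + 1 - mu y 0 1 - mu y 1 1"
    have ac: "a < n" "b < n" "c < n" "rk x = 2" "rk y = 1" using x y by (auto simp: line_def plane_def)
    have S: "S x y = 2 * (int n * G - (2 * int c - int a - int b))"
      unfolding S_def deg_line[OF y] deg_plane[OF x] using ac by (simp add: G_def algebra_simps)
    have c1: "chi x y = G + 1 - of_bool (a < c) - of_bool (b < c)"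
      using to_line[OF y, of x] psum_plane[OF x, of c] ac x by (simp add: plane_def G_def)
    have c2: "chi y x = 1 - G - of_bool (c < a) - of_bool (c < b)"
      using to_plane[OF x, of y] psum_line[OF y, of a] psum_line[OF y, of b] ac y by (simp add: line_def G_def)
    show ?thesis
      using cases4[of G] steps[of G] ac unfolding S c1 c2 by (elim disjE) (auto simp: of_bool_def)
  qed
  have PP: "(S x y \<ge> 0 \<longrightarrow> 0 \<le> chi x y) \<and> (S x y > 0 \<longrightarrow> chi y x \<le> 0)" if x: "plane x a b" and y: "plane y c e" for x y a b c e
  proof -
    define G where "G = dg y - dg x"
    have ac: "a < n" "b < n" "c < n" "e < n" "rk x = 2" "rk y = 2" using x y by (auto simp: plane_def)
    have S: "S x y = 4 * (int n * G - (int c + int e - int a - int b))"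
      unfolding S_def deg_plane[OF y] deg_plane[OF x] using ac by (simp add: G_def algebra_simps)
    have c1: "chi x y = 2 + 2 * G - of_bool (a < c) - of_bool (b < c) - of_bool (a < e) - of_bool (b < e)"
      using to_plane[OF y, of x] psum_plane[OF x, of c] psum_plane[OF x, of e] ac x by (simp add: plane_def G_def)
    have c2: "chi y x = 2 - 2 * G - of_bool (c < a) - of_bool (c < b) - of_bool (e < a) - of_bool (e < b)"
      using to_plane[OF x, of y] psum_plane[OF y, of a] psum_plane[OF y, of b] ac y by (simp add: plane_def G_def)
    show ?thesis
      using cases4[of G] steps[of G] ac unfolding S c1 c2 by (elim disjE) (auto simp: of_bool_def)
  qed
  have all: "(S x y \<ge> 0 \<longrightarrow> 0 \<le> chi x y) \<and> (S x y > 0 \<longrightarrow> chi y x \<le> 0)"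
    if "root x" "root y" "rk x > 0" "rk y > 0" for x y
    using bundles[OF that(1,3)] bundles[OF that(2,4)] LL LP PL PP by blast
  show ?thesis
  proof (rule charged_lattice_if_domestic)
    show "0 < chi x x" if "x \<in> K" "rk x \<noteq> 0" for x
    proof -
      have "0 < ?q x" using abs_sum_le_sum_squares[of "mu x 2" n] K(3)[OF that(1)] that(2) by simp
      then have "0 < 4 * chi x x" unfolding norm[OF that(1)] by (simp add: add_nonneg_pos)
      then show ?thesis by simp
    qed
  qed (use all in auto)
qed

section \<open>The seed of $T_{sq}$\<close>

context charged_lattice
begin

text \<open>
  Every reachable quiver is given by a seed, and \<open>form_bound\<close> applies to it.
\<close>

lemma finite_mutation_type_if_seed:
  fixes Q :: "'v quiver"
  assumes Q: "is_quiver Q" and c: "seed (vertices Q) c"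
    and net: "\<And>i j. i \<in> vertices Q \<Longrightarrow> j \<in> vertices Q \<Longrightarrow> net Q i j = form (c i) (c j)"
  shows "finite_mutation_type Q"
proof -
  have seeds: "\<exists>d. seed (vertices Q) d \<and> (\<forall>i\<in>vertices Q. \<forall>j\<in>vertices Q. net R i j = form (d i) (d j))"
    if "reachable Q R" for R
    using that
  proof (induction rule: reachable_induct)
    case refl
    then show ?case using c net by blast
  next
    case (mutate R k)
    then obtain d where d: "seed (vertices Q) d" "\<forall>i\<in>vertices Q. \<forall>j\<in>vertices Q. net R i j = form (d i) (d j)"
      by blast
    have k: "k \<in> vertices Q" using mutate reachable_vertices by metis
    have R: "is_quiver R" by (rule reachable_is_quiver[OF mutate(1) Q])
    obtain d' where "seed (vertices Q) d'"
      "\<And>i j. i \<in> vertices Q \<Longrightarrow> j \<in> vertices Q \<Longrightarrow> form (d' i) (d' j) = (if i = k \<or> j = k then - form (d i) (d j)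
     else form (d i) (d j) + max 0 (form (d i) (d k)) * max 0 (form (d k) (d j))
        - max 0 (form (d j) (d k)) * max 0 (form (d k) (d i)))"
      using seed_mutation[OF d(1) k] by blast
    then show ?case using d(2) k by (intro exI[of _ d']) (simp add: net_mutate[OF R])
  qed
  have "arrows R i j \<le> 2" if R: "reachable Q R" for R i j
  proof (cases "arrows R i j = 0")
    case False
    have q: "is_quiver R" by (rule reachable_is_quiver[OF R Q])
    then have "i \<in> vertices Q" "j \<in> vertices Q"
      using False reachable_vertices[OF R] by (auto simp: is_quiver_def)
    then have "\<bar>net R i j\<bar> \<le> 2" using seeds[OF R] form_bound by metis
    then show ?thesis using arrows_net[OF q, of i j] by linarith
  qed simp
  then show ?thesis using finite_mutation_type_iff_bounded[OF Q] by blast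
qed

end

context weights
begin

text \<open>
  Classes of a simple-minded collection whose exchange form gives the arrows of the quiver of $T_{sq}$: the
  structure sheaf, the shift of the line bundle $\mathcal{O}(-\vec c)$ and the shifts of simple sheaves in the exceptional tubes. Indices
  of points start at \<open>1\<close> in the quiver and at \<open>0\<close> in \<open>kclass\<close>.
\<close>

fun simple_class :: "summand \<Rightarrow> kclass" where
  "simple_class Struct = (1, 0, \<lambda>i j. of_bool (j = 0))"
| "simple_class Struct_c = (-1, 1, \<lambda>i j. - of_bool (j = 0))"
| "simple_class (Tube i j) = (0, - of_bool (Suc j = p ! (i - 1)),
     \<lambda>i' l. if i' = i - 1 then of_bool (l = Suc j mod p ! (i - 1)) - of_bool (l = j) else 0)"

lemma summands: "Tube i j \<in> Tsq_summands (of_weights p) \<longleftrightarrow> 1 \<le> i \<and> i \<le> t \<and> 1 \<le> j \<and> j < p ! (i - 1)"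
  by (auto simp: Tsq_summands_def of_weights_def)

lemma struct_K: "simple_class Struct \<in> K" "simple_class Struct_c \<in> K"
  using p_pos by (auto simp: K_def of_bool_def sum_negf)

lemma struct_psum:
  "psum (simple_class Struct) i n = of_bool (0 < n)" "psum (simple_class Struct_c) i n = - of_bool (0 < n)"
  by (induction n) (auto simp: psum_def)

lemma struct_rk: "rk (simple_class Struct) = 1" "rk (simple_class Struct_c) = -1"
  by simp_all

lemma struct_deg: "deg (simple_class Struct) = 0" "deg (simple_class Struct_c) = int N"
proof -
  have z: "(\<Sum>i<t. \<Sum>j<p!i. int (N div p!i * j) * (c * of_bool (j = 0))) = 0" for c :: int
    by (intro sum.neutral ballI) (auto simp: of_bool_def)
  show "deg (simple_class Struct) = 0" "deg (simple_class Struct_c) = int N"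
    using z[of 1] z[of "-1"] by (simp_all add: deg_def)
qed

lemma struct_chi:
  "chi (simple_class Struct) (simple_class Struct) = 1" "chi (simple_class Struct_c) (simple_class Struct_c) = 1"
  "chi (simple_class Struct) (simple_class Struct_c) = 0" "chi (simple_class Struct_c) (simple_class Struct) = -2"
proof -
  have z: "(\<Sum>i<t. \<Sum>j<p!i. \<Sum>l<j. f i l * (c * of_bool (j = 0))) = 0" for f :: "nat \<Rightarrow> nat \<Rightarrow> int" and c :: int
    by (intro sum.neutral ballI) (auto simp: of_bool_def)
  show "chi (simple_class Struct) (simple_class Struct) = 1" "chi (simple_class Struct_c) (simple_class Struct_c) = 1"
    "chi (simple_class Struct) (simple_class Struct_c) = 0" "chi (simple_class Struct_c) (simple_class Struct) = -2"
    using z[of "\<lambda>i l. of_bool (l = 0)" 1] z[of "\<lambda>i l. of_bool (l = 0)" "-1"] z[of "\<lambda>i l. - of_bool (l = 0)" 1] z[of "\<lambda>i l. - of_bool (l = 0)" "-1"]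
    by (simp_all add: chi_def)
qed

lemma tube_torsion:
  assumes "Tube i j \<in> Tsq_summands (of_weights p)"
  shows "torsion (simple_class (Tube i j)) (i - 1) (Suc j mod p ! (i - 1)) j"
    "rk (simple_class (Tube i j)) = 0" "dg (simple_class (Tube i j)) = - of_bool (Suc j = p ! (i - 1))"
    "deg (simple_class (Tube i j)) = - int (N div p ! (i - 1))"
proof -
  let ?p = "p ! (i - 1)"
  have h: "1 \<le> j" "j < ?p" "i - 1 < t" using assms by (auto simp: summands)
  have "Suc j mod ?p \<noteq> j" "Suc j mod ?p < ?p" using h by (auto simp: mod_Suc)
  then show T: "torsion (simple_class (Tube i j)) (i - 1) (Suc j mod ?p) j"
    using h by (auto simp: torsion_def)
  show "rk (simple_class (Tube i j)) = 0" and d: "dg (simple_class (Tube i j)) = - of_bool (Suc j = ?p)" by simp_all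
  have "int ?p * dg (simple_class (Tube i j)) + int j - int (Suc j mod ?p) = -1"
    using h unfolding d by (cases "Suc j = ?p") auto
  then show "deg (simple_class (Tube i j)) = - int (N div ?p)"
    unfolding chi_torsion(3)[OF T torsion_K[OF T]] by simp
qed

declare simple_class.simps [simp del]

lemma tube_chi:
  assumes T: "Tube i j \<in> Tsq_summands (of_weights p)"
  shows "chi (simple_class Struct) (simple_class (Tube i j)) = 0"
    "chi (simple_class (Tube i j)) (simple_class Struct) = of_bool (Suc j = p ! (i - 1))"
    "chi (simple_class Struct_c) (simple_class (Tube i j)) = 0"
    "chi (simple_class (Tube i j)) (simple_class Struct_c) = - of_bool (Suc j = p ! (i - 1))"
    "Tube i' j' \<in> Tsq_summands (of_weights p) \<Longrightarrow> chi (simple_class (Tube i j)) (simple_class (Tube i' j')) =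
       of_bool (i = i' \<and> j = j') - of_bool (i = i' \<and> j' = Suc j)"
proof -
  let ?p = "p ! (i - 1)"
  have h: "1 \<le> i" "1 \<le> j" "j < ?p" "i - 1 < t" using T by (auto simp: summands)
  note X = tube_torsion[OF T]
  show "chi (simple_class Struct) (simple_class (Tube i j)) = 0"
    "chi (simple_class Struct_c) (simple_class (Tube i j)) = 0"
    unfolding chi_torsion(1)[OF X(1) struct_K(1)] chi_torsion(1)[OF X(1) struct_K(2)] struct_psum struct_rk X(3)
    using h by (auto simp: mod_Suc)
  show "chi (simple_class (Tube i j)) (simple_class Struct) = of_bool (Suc j = ?p)"
    "chi (simple_class (Tube i j)) (simple_class Struct_c) = - of_bool (Suc j = ?p)"
    unfolding chi_torsion(2)[OF X(1) struct_K(1)] chi_torsion(2)[OF X(1) struct_K(2)] struct_psum struct_rk X(3)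
    by simp_all
  assume T': "Tube i' j' \<in> Tsq_summands (of_weights p)"
  have h': "1 \<le> i'" "1 \<le> j'" "j' < p ! (i' - 1)" using T' by (auto simp: summands)
  note X' = tube_torsion[OF T']
  show "chi (simple_class (Tube i j)) (simple_class (Tube i' j')) =
       of_bool (i = i' \<and> j = j') - of_bool (i = i' \<and> j' = Suc j)"
  proof (cases "i = i'")
    case False
    then have "i - 1 \<noteq> i' - 1" using h h' by auto
    then show ?thesis using chi_torsion_other[OF X(1) X'(1)] False by simp
  next
    case True
    have s: "Suc j' mod ?p \<le> ?p" using h by (intro less_imp_le mod_less_divisor) simp
    have "chi (simple_class (Tube i j)) (simple_class (Tube i' j'))
      = psum (simple_class (Tube i j)) (i - 1) j' - psum (simple_class (Tube i j)) (i - 1) (Suc j' mod ?p)"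
      using chi_torsion(1)[OF X'(1) torsion_K[OF X(1)]] X(2) True by simp
    also have "\<dots> = of_bool (j = j') - of_bool (j' = Suc j)"
      using psum_torsion[OF X(1), of j'] psum_torsion[OF X(1) s] h h' True
      by (cases "Suc j = ?p"; cases "Suc j' = ?p") (auto simp: of_bool_def)
    finally show ?thesis using True by simp
  qed
qed

lemma finite_mutation_type_of_weights:
  assumes "charged_lattice K comb chi rk deg 1"
  shows "finite_mutation_type (Q_Tsq (of_weights p))"
proof -
  interpret L: charged_lattice K comb chi rk deg 1 by (rule assms)
  let ?I = "Tsq_summands (of_weights p)" and ?c = simple_class
  have S: "L.S x y = rk x * deg y - rk y * deg x" for x y by (simp add: L.S_def)
  have pos: "L.pos (?c Struct)" "\<not> L.pos (?c Struct_c)"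
    "\<And>i j. Tube i j \<in> ?I \<Longrightarrow> \<not> L.pos (?c (Tube i j))"
    using tube_torsion(2,4) struct_rk by (auto simp: L.pos_def)
  have S_c: "L.S (?c Struct) (?c Struct_c) = int N"
    "\<And>i j. Tube i j \<in> ?I \<Longrightarrow> L.S (?c Struct_c) (?c (Tube i j)) = int (N div p ! (i - 1))"
    "\<And>i j. Tube i j \<in> ?I \<Longrightarrow> L.S (?c (Tube i j)) (?c Struct_c) = - int (N div p ! (i - 1))"
    "\<And>i j i' j'. Tube i j \<in> ?I \<Longrightarrow> Tube i' j' \<in> ?I \<Longrightarrow> L.S (?c (Tube i j)) (?c (Tube i' j')) = 0"
    unfolding S using tube_torsion(2,4) struct_deg struct_rk by simp_all
  have npos: "0 < int (N div p ! (i - 1))" if "Tube i j \<in> ?I" for i j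
  proof -
    have i: "i - 1 < t" using that by (auto simp: summands)
    show ?thesis using dvd_N[OF i] N_pos p_pos[OF i] by (simp add: dvd_imp_le div_greater_zero_iff)
  qed
  have root: "L.root (?c v)" if "v \<in> ?I" for v
    using that struct_K struct_chi tube_chi(5) tube_torsion(1)[THEN torsion_K]
    by (cases v) (auto simp: L.root_def)
  have seed: "L.seed ?I ?c"
    unfolding L.seed_def
  proof (intro conjI ballI impI)
    show "L.root (?c v)" if "v \<in> ?I" for v by (rule root[OF that])
    fix v w assume vw: "v \<in> ?I" "w \<in> ?I" "v \<noteq> w"
    show "chi (?c v) (?c w) = 0" if "L.before (?c v) (?c w)"
      using that vw pos S_c npos struct_chi tube_chi
      by (cases v; cases w) (auto simp: L.before_def)
    show "chi (?c v) (?c w) \<le> 0" if "L.same_ray (?c v) (?c w)"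
      using that vw pos S_c npos struct_chi tube_chi
      by (cases v; cases w) (auto simp: L.same_ray_def)
  next
    show "\<exists>i\<in>?I. \<exists>j\<in>?I. L.S (?c i) (?c j) \<noteq> 0"
      using S_c(1) N_pos by (intro bexI[of _ Struct] bexI[of _ Struct_c]) (auto simp: Tsq_summands_def)
  qed
  have wt: "weight (of_weights p) i = p ! (i - 1)" for i by (simp add: of_weights_def)
  have mem: "1 \<le> j \<and> j < p ! (i - 1)" if "Tube i j \<in> ?I" for i j using that summands by blast
  have net: "net (Q_Tsq (of_weights p)) v w = L.form (?c v) (?c w)" if "v \<in> ?I" "w \<in> ?I" for v w
  proof (cases v; cases w)
    fix i j i' j' assume vw: "v = Tube i j" "w = Tube i' j'"
    show ?thesis
      using that tube_chi(5)[of i j i' j'] tube_chi(5)[of i' j' i j]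
      unfolding vw by (auto simp: net_def Q_Tsq_def L.form_def of_bool_def)
  next
    fix i j assume vw: "v = Tube i j" "w = Struct"
    show ?thesis using that(1) tube_chi(1,2)[of i j] unfolding vw
      using mem[OF that(1)[unfolded vw]] by (auto simp: net_def Q_Tsq_def L.form_def wt)
  next
    fix i j assume vw: "v = Struct" "w = Tube i j"
    show ?thesis using that(2) tube_chi(1,2)[of i j] unfolding vw
      using mem[OF that(2)[unfolded vw]] by (auto simp: net_def Q_Tsq_def L.form_def wt)
  next
    fix i j assume vw: "v = Tube i j" "w = Struct_c"
    show ?thesis using that(1) tube_chi(3,4)[of i j] unfolding vw
      using mem[OF that(1)[unfolded vw]] by (auto simp: net_def Q_Tsq_def L.form_def wt)
  next
    fix i j assume vw: "v = Struct_c" "w = Tube i j"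
    show ?thesis using that(2) tube_chi(3,4)[of i j] unfolding vw
      using mem[OF that(2)[unfolded vw]] by (auto simp: net_def Q_Tsq_def L.form_def wt)
  qed (use struct_chi in \<open>simp_all add: net_def Q_Tsq_def L.form_def\<close>)
  show ?thesis
    by (rule L.finite_mutation_type_if_seed[OF is_quiver_Q_Tsq]) (use seed net in \<open>simp_all add: Q_Tsq_def\<close>)
qed

end

section \<open>Dominated weight sequences and the genus\<close>

text \<open>
  An arm is embedded into a longer one so that the ends at \<open>Struct\<close> and \<open>Struct_c\<close> match; this is why the second index
  of a vertex is raised by the difference of the weights. Points of weight \<open>1\<close> have no vertices and need not be mapped.
\<close>

lemma finite_mutation_type_Q_Tsq_mono:
  assumes inj: "inj_on f {i \<in> {1..num_weights X}. 2 \<le> weight X i}"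
    and f: "\<And>i. i \<in> {1..num_weights X} \<Longrightarrow> 2 \<le> weight X i \<Longrightarrow> f i \<in> {1..num_weights Y} \<and> weight X i \<le> weight Y (f i)"
    and fin: "finite_mutation_type (Q_Tsq Y)"
  shows "finite_mutation_type (Q_Tsq X)"
proof -
  define h where "h v = (case v of Tube i j \<Rightarrow> Tube (f i) (j + (weight Y (f i) - weight X i)) | _ \<Rightarrow> v)" for v
  have h: "h Struct = Struct" "h Struct_c = Struct_c"
    "h (Tube i j) = Tube (f i) (j + (weight Y (f i) - weight X i))" for i j
    by (simp_all add: h_def)
  have T: "i \<in> {1..num_weights X}" "2 \<le> weight X i" "1 \<le> j" "j \<le> weight X i - 1"
    if "Tube i j \<in> Tsq_summands X" for i j
    using that by (auto simp: Tsq_summands_def)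
  have f': "f i \<in> {1..num_weights Y}" "weight X i \<le> weight Y (f i)" if "Tube i j \<in> Tsq_summands X" for i j
    using f T that by blast+
  have eq: "f i = f i' \<longleftrightarrow> i = i'" if "Tube i j \<in> Tsq_summands X" "Tube i' j' \<in> Tsq_summands X" for i j i' j'
    using inj_on_eq_iff[OF inj, of i i'] T that by blast
  have mem: "h v \<in> Tsq_summands Y" if "v \<in> Tsq_summands X" for v
  proof (cases v)
    case (Tube i j)
    then show ?thesis using f'[of i j] T[of i j] that by (auto simp: h Tsq_summands_def)
  qed (simp_all add: h Tsq_summands_def)
  have inj_h: "inj_on h (Tsq_summands X)"
  proof (rule inj_onI)
    fix v w assume "v \<in> Tsq_summands X" "w \<in> Tsq_summands X" "h v = h w"
    then show "v = w" by (cases v; cases w) (auto simp: h eq)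
  qed
  have arr: "Tsq_arrows Y (h v) (h w) = Tsq_arrows X v w" if v: "v \<in> Tsq_summands X" and w: "w \<in> Tsq_summands X" for v w
  proof (cases v; cases w)
    fix i j i' j' assume vw: "v = Tube i j" "w = Tube i' j'"
    show ?thesis using v w mem[OF v] mem[OF w] eq[of i j i' j'] by (auto simp: vw h)
  next
    fix i j assume vw: "v = Tube i j" "w = Struct"
    show ?thesis using v mem[OF v] f'[of i j] T[of i j] by (auto simp: vw h)
  next
    fix i j assume vw: "v = Struct_c" "w = Tube i j"
    show ?thesis using w mem[OF w] f'[of i j] T[of i j] by (auto simp: vw h)
  qed (simp_all add: h)
  have "full_embedding h (Q_Tsq X) (Q_Tsq Y)"
    using mem inj_h arr by (auto simp: full_embedding_def Q_Tsq_def)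
  from full_embedding_finite_mutation_type[OF is_quiver_Q_Tsq is_quiver_Q_Tsq this fin] show ?thesis .
qed

definition dominated :: "nat list \<Rightarrow> nat list \<Rightarrow> bool" where
  "dominated ws ps \<longleftrightarrow> length ws \<le> length ps \<and> (\<forall>n<length ws. ws ! n \<le> ps ! n)"

lemma finite_mutation_type_dominated:
  assumes "dominated ws ps" "finite_mutation_type (Q_Tsq (of_weights ps))"
  shows "finite_mutation_type (Q_Tsq (of_weights ws))"
  by (rule finite_mutation_type_Q_Tsq_mono[OF _ _ assms(2), of id])
    (use assms(1) in \<open>auto simp: dominated_def of_weights_def\<close>)

text \<open>
  The genus is at most \<open>1\<close> iff this is at most \<open>2\<close>; unlike the genus, it is monotone in the weights.
\<close>

definition defect :: "nat list \<Rightarrow> real" where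
  "defect ws = (\<Sum>w\<leftarrow>ws. 1 - 1 / real w)"

lemma defect_dominated:
  assumes d: "dominated ws ps" and pos: "\<forall>w\<in>set ws. 0 < w" "\<forall>w\<in>set ps. 0 < w"
  shows "defect ws \<le> defect ps"
proof -
  have e: "defect xs = (\<Sum>n<length xs. 1 - 1 / real (xs ! n))" for xs
    by (simp add: defect_def sum_list_sum_nth atLeast0LessThan)
  have p: "0 < ws ! n" if "n < length ws" for n using that pos(1) by simp
  have "defect ws \<le> (\<Sum>n<length ws. 1 - 1 / real (ps ! n))"
    unfolding e using d p by (intro sum_mono) (auto simp: dominated_def intro!: frac_le)
  also have "\<dots> \<le> defect ps"
    unfolding e
  proof (rule sum_mono2)
    fix n assume "n \<in> {..<length ps} - {..<length ws}"
    then have "0 < ps ! n" using pos(2) by simp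
    then show "0 \<le> 1 - 1 / real (ps ! n)" by simp
  qed (use d in \<open>auto simp: dominated_def\<close>)
  finally show ?thesis .
qed

definition reduced_weights :: "'k wpl \<Rightarrow> nat list" where
  "reduced_weights X = sort (filter (\<lambda>w. 2 \<le> w) (map (weight X) [1..<Suc (num_weights X)]))"

text \<open>
  Points of weight \<open>1\<close> affect neither the quiver nor the defect, and the order of the others is irrelevant. The list \<open>xs\<close> is a
  sorted enumeration of the points that count.
\<close>

lemma ex_reduced_indices:
  "\<exists>xs. distinct xs \<and> set xs = {i \<in> {1..num_weights X}. 2 \<le> weight X i} \<and> map (weight X) xs = reduced_weights X"
proof (intro exI conjI)
  let ?is = "filter (\<lambda>i. 2 \<le> weight X i) [1..<Suc (num_weights X)]"
  let ?xs = "sort_key (weight X) ?is"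
  show "distinct ?xs" by simp
  show "set ?xs = {i \<in> {1..num_weights X}. 2 \<le> weight X i}" by auto
  have "map (weight X) ?xs = sort (map (weight X) ?is)"
    by (rule properties_for_sort[symmetric]) (simp_all)
  then show "map (weight X) ?xs = reduced_weights X"
    by (simp add: reduced_weights_def filter_map o_def del: upt_Suc)
qed

lemma finite_mutation_type_reduced_weights:
  "finite_mutation_type (Q_Tsq X) \<longleftrightarrow> finite_mutation_type (Q_Tsq (of_weights (reduced_weights X)))"
proof -
  obtain xs where xs: "distinct xs" "set xs = {i \<in> {1..num_weights X}. 2 \<le> weight X i}"
    "map (weight X) xs = reduced_weights X" using ex_reduced_indices by blast
  let ?Y = "of_weights (reduced_weights X)"
  have Y: "num_weights ?Y = length xs" "\<And>n. n < length xs \<Longrightarrow> weight ?Y (Suc n) = weight X (xs ! n)"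
    unfolding xs(3)[symmetric] by (simp_all add: of_weights_def)
  let ?g = "\<lambda>i. xs ! (i - 1)"
  let ?f = "\<lambda>i. Suc (the_inv_into {..<length xs} (nth xs) i)"
  have bij: "bij_betw (nth xs) {..<length xs} (set xs)" using xs(1) by (rule bij_betw_nth) simp_all
  show ?thesis
  proof
    assume fin: "finite_mutation_type (Q_Tsq X)"
    show "finite_mutation_type (Q_Tsq ?Y)"
    proof (rule finite_mutation_type_Q_Tsq_mono[OF _ _ fin])
      show "inj_on ?g {i \<in> {1..num_weights ?Y}. 2 \<le> weight ?Y i}"
        using xs(1) by (auto simp: inj_on_def Y nth_eq_iff_index_eq)
      fix i assume "i \<in> {1..num_weights ?Y}"
      then obtain n where n: "i = Suc n" "n < length xs" unfolding Y(1) by (cases i) auto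
      then have "xs ! n \<in> set xs" by simp
      then show "?g i \<in> {1..num_weights X} \<and> weight ?Y i \<le> weight X (?g i)"
        using n Y(2) unfolding xs(2) by simp
    qed
  next
    assume fin: "finite_mutation_type (Q_Tsq ?Y)"
    have the: "the_inv_into {..<length xs} (nth xs) i < length xs" "xs ! the_inv_into {..<length xs} (nth xs) i = i"
      if "i \<in> set xs" for i
      using that bij the_inv_into_into[of "nth xs" "{..<length xs}" i] f_the_inv_into_f_bij_betw[OF bij]
      by (auto simp: bij_betw_def)
    show "finite_mutation_type (Q_Tsq X)"
    proof (rule finite_mutation_type_Q_Tsq_mono[OF _ _ fin])
      show "inj_on ?f {i \<in> {1..num_weights X}. 2 \<le> weight X i}"
        unfolding xs(2)[symmetric] by (intro inj_onI) (metis Suc_inject the(2))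
      fix i assume "i \<in> {1..num_weights X}" "2 \<le> weight X i"
      then have "i \<in> set xs" unfolding xs(2) by simp
      then show "?f i \<in> {1..num_weights ?Y} \<and> weight X i \<le> weight ?Y (?f i)"
        using the[of i] Y by (auto simp: Suc_le_eq)
    qed
  qed
qed

lemma genus_le_1_iff:
  assumes "weighted_projective_line X"
  shows "genus X \<le> 1 \<longleftrightarrow> defect (reduced_weights X) \<le> 2"
proof -
  let ?t = "num_weights X" and ?L = "real (weight_lcm X)" and ?d = "\<lambda>i. 1 - 1 / real (weight X i)"
  have pos: "0 < weight X i" if "i \<in> {1..?t}" for i
    using assms that by (auto simp: weighted_projective_line_def)
  have "weight_lcm X \<noteq> 0"
    unfolding weight_lcm_def using pos by (subst Lcm_0_iff) fastforce+
  then have L: "0 < ?L" by simp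
  obtain xs where xs: "distinct xs" "set xs = {i \<in> {1..?t}. 2 \<le> weight X i}"
    "map (weight X) xs = reduced_weights X" using ex_reduced_indices by blast
  have "defect (reduced_weights X) = (\<Sum>i\<leftarrow>xs. ?d i)"
    unfolding xs(3)[symmetric] defect_def by (simp add: o_def)
  also have "\<dots> = (\<Sum>i\<in>set xs. ?d i)" using xs(1) by (rule sum_list_distinct_conv_sum_set)
  also have "\<dots> = (\<Sum>i = 1..?t. ?d i)"
  proof (rule sum.mono_neutral_left)
    show "\<forall>i\<in>{1..?t} - set xs. ?d i = 0"
    proof
      fix i assume "i \<in> {1..?t} - set xs"
      then have "weight X i = 1" using pos[of i] by (auto simp: xs(2))
      then show "?d i = 0" by simp
    qed
  qed (auto simp: xs(2))
  finally have d: "defect (reduced_weights X) = real ?t - (\<Sum>i = 1..?t. 1 / real (weight X i))"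
    by (simp add: sum_subtractf)
  have "(\<Sum>i = 1..?t. ?L / real (weight X i)) = ?L * (\<Sum>i = 1..?t. 1 / real (weight X i))"
    by (simp add: sum_distrib_left)
  then have "genus X = 1 + ?L * ((defect (reduced_weights X) - 2) / 2)"
    by (simp add: genus_def d algebra_simps add_divide_distrib diff_divide_distrib)
  then show ?thesis using L by (simp add: mult_le_0_iff)
qed

text \<open>
  The two infinite families are domestic, the other four sequences are tubular. Domestic sequences such as $(2,3,5)$ are
  dominated by a tubular one.
\<close>

definition tame_weights :: "nat list set" where
  "tame_weights = {[a, b] | a b. 0 < a \<and> 0 < b} \<union> {[2, 2, n] | n. 0 < n} \<union>
     {[2, 3, 6], [2, 4, 4], [3, 3, 3], [2, 2, 2, 2]}"

definition minimal_wild_weights :: "nat list set" where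
  "minimal_wild_weights = {[2, 3, 7], [2, 4, 5], [3, 3, 4], [2, 2, 2, 3], [2, 2, 2, 2, 2]}"

lemma dominated_Nil: "dominated [] ps" "\<not> dominated (w # ws) []"
  by (simp_all add: dominated_def)

lemma dominated_Cons: "dominated (w # ws) (p # ps) \<longleftrightarrow> w \<le> p \<and> dominated ws ps"
  by (auto simp: dominated_def nth_Cons less_Suc_eq_0_disj split: nat.split)

lemma tame_or_wild:
  assumes "sorted ws" "\<forall>w\<in>set ws. 2 \<le> w"
  shows "(\<exists>ps\<in>tame_weights. dominated ws ps) \<or> (\<exists>ps\<in>minimal_wild_weights. dominated ps ws)"
proof -
  note D = dominated_Nil dominated_Cons
  have tame: ?thesis if "ps \<in> tame_weights" "dominated ws ps" for ps using that by blast
  have wild: ?thesis if "ps \<in> minimal_wild_weights" "dominated ps ws" for ps using that by blast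
  consider "ws = []" | a where "ws = [a]" | a b where "ws = [a, b]" | a b c where "ws = [a, b, c]"
    | a b c d where "ws = [a, b, c, d]" | a b c d e vs where "ws = a # b # c # d # e # vs"
  proof -
    have "ws = [] \<or> (\<exists>a. ws = [a]) \<or> (\<exists>a b. ws = [a, b]) \<or> (\<exists>a b c. ws = [a, b, c]) \<or>
        (\<exists>a b c d. ws = [a, b, c, d]) \<or> (\<exists>a b c d e vs. ws = a # b # c # d # e # vs)"
      by (cases ws; cases "tl ws"; cases "tl (tl ws)"; cases "tl (tl (tl ws))"; cases "tl (tl (tl (tl ws)))") auto
    then show thesis by (elim disjE exE) (erule that)+
  qed
  then show ?thesis
  proof cases
    case 1
    then show ?thesis by (intro tame[of "[1, 1]"]) (auto simp: tame_weights_def D)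
  next
    case (2 a)
    then show ?thesis using assms(2) by (intro tame[of "[a, 1]"]) (auto simp: tame_weights_def D)
  next
    case (3 a b)
    then show ?thesis using assms(2) by (intro tame[of "[a, b]"]) (auto simp: tame_weights_def D)
  next
    case (4 a b c)
    then have o: "2 \<le> a" "a \<le> b" "b \<le> c" using assms by auto
    consider "a = 2" "b = 2" | "a = 2" "b = 3" "c \<le> 6" | "a = 2" "b = 3" "7 \<le> c"
      | "a = 2" "b = 4" "c = 4" | "a = 2" "4 \<le> b" "5 \<le> c" | "a = 3" "b = 3" "c = 3" | "3 \<le> a" "4 \<le> c"
    proof -
      have "a = 2 \<and> b = 2 \<or> a = 2 \<and> b = 3 \<and> c \<le> 6 \<or> a = 2 \<and> b = 3 \<and> 7 \<le> c \<or> a = 2 \<and> b = 4 \<and> c = 4 \<or>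
          a = 2 \<and> 4 \<le> b \<and> 5 \<le> c \<or> a = 3 \<and> b = 3 \<and> c = 3 \<or> 3 \<le> a \<and> 4 \<le> c"
        using o by presburger
      then show thesis by (elim disjE conjE) (rule that; assumption)+
    qed
    then show ?thesis
    proof cases
      case 1
      then show ?thesis using o by (intro tame[of "[2, 2, c]"]) (auto simp: tame_weights_def D 4)
    next
      case 2
      then show ?thesis using o by (intro tame[of "[2, 3, 6]"]) (auto simp: tame_weights_def D 4)
    next
      case 3
      then show ?thesis using o by (intro wild[of "[2, 3, 7]"]) (auto simp: minimal_wild_weights_def D 4)
    next
      case 4
      then show ?thesis using o by (intro tame[of "[2, 4, 4]"]) (auto simp: tame_weights_def D \<open>ws = [a, b, c]\<close>)
    next
      case 5
      then show ?thesis using o by (intro wild[of "[2, 4, 5]"]) (auto simp: minimal_wild_weights_def D 4)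
    next
      case 6
      then show ?thesis using o by (intro tame[of "[3, 3, 3]"]) (auto simp: tame_weights_def D 4)
    next
      case 7
      then show ?thesis using o by (intro wild[of "[3, 3, 4]"]) (auto simp: minimal_wild_weights_def D 4)
    qed
  next
    case (5 a b c d)
    then have o: "2 \<le> a" "a \<le> b" "b \<le> c" "c \<le> d" using assms by auto
    show ?thesis
    proof (cases "d = 2")
      case True
      then show ?thesis using o by (intro tame[of "[2, 2, 2, 2]"]) (auto simp: tame_weights_def D 5)
    next
      case False
      then show ?thesis using o by (intro wild[of "[2, 2, 2, 3]"]) (auto simp: minimal_wild_weights_def D 5)
    qed
  next
    case (6 a b c d e vs)
    then show ?thesis using assms by (intro wild[of "[2, 2, 2, 2, 2]"]) (auto simp: minimal_wild_weights_def D)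
  qed
qed

lemma finite_mutation_type_tame:
  assumes "ps \<in> tame_weights"
  shows "finite_mutation_type (Q_Tsq (of_weights ps))"
proof -
  have *: "finite_mutation_type (Q_Tsq (of_weights ps))"
    if "charged_lattice (weights.K ps) comb (weights.chi ps) rk (weights.deg ps N) 1"
      "\<forall>q\<in>set ps. 0 < q \<and> q dvd N" "0 < N" for N
    using weights.finite_mutation_type_of_weights[OF weightsI[OF that(2,3)] that(1)] .
  consider a b where "ps = [a, b]" "0 < a" "0 < b" | n where "ps = [2, 2, n]" "0 < n"
    | "ps = [2, 3, 6]" | "ps = [2, 4, 4]" | "ps = [3, 3, 3]" | "ps = [2, 2, 2, 2]"
    using assms by (auto simp: tame_weights_def)
  then show ?thesis
  proof cases
    case (1 a b)
    then show ?thesis by (intro *[of "a * b"]) (simp_all add: domestic_two)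
  next
    case (2 n)
    then show ?thesis by (intro *[of "2 * n"]) (simp_all add: domestic_22n)
  next
    case 3
    then show ?thesis by (intro *[of 6]) (simp_all add: tubular_236)
  next
    case 4
    then show ?thesis by (intro *[of 4]) (simp_all add: tubular_244)
  next
    case 5
    then show ?thesis by (intro *[of 3]) (simp_all add: tubular_333)
  next
    case 6
    then show ?thesis by (intro *[of 2]) (simp_all add: tubular_2222)
  qed
qed

lemma infinite_minimal_wild:
  "ps \<in> minimal_wild_weights \<Longrightarrow> \<not> finite_mutation_type (Q_Tsq (of_weights ps))"
  unfolding minimal_wild_weights_def
  using wild_237 wild_245 wild_334 wild_2223 wild_22222 infinite_if_growth_certificate by blast

lemma defect_tame: "ps \<in> tame_weights \<Longrightarrow> defect ps \<le> 2"
proof -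
  have "0 \<le> 1 / real a + 1 / real b" for a b :: nat by simp
  then show "ps \<in> tame_weights \<Longrightarrow> defect ps \<le> 2"
    by (auto simp: tame_weights_def defect_def algebra_simps)
qed

lemma defect_minimal_wild: "ps \<in> minimal_wild_weights \<Longrightarrow> 2 < defect ps"
  by (auto simp: minimal_wild_weights_def defect_def)

text \<open>
  By monotonicity of the defect and of finite mutation type, both sides of the equivalence are decided by the extreme weight
  sequence to which \<open>tame_or_wild\<close> compares the weights.
\<close>

theorem proposition3p7:
  fixes X :: "('k :: alg_closed_field) wpl"
  assumes "weighted_projective_line X"
  shows "finite_mutation_type (Q_Tsq X) \<longleftrightarrow> domestic X \<or> tubular X"
proof -
  let ?ws = "reduced_weights X"
  have ws: "sorted ?ws" "\<forall>w\<in>set ?ws. 2 \<le> w" by (auto simp: reduced_weights_def)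
  have pos: "\<forall>w\<in>set ?ws. 0 < w" using ws(2) by force
  have "domestic X \<or> tubular X \<longleftrightarrow> defect ?ws \<le> 2"
    using genus_le_1_iff[OF assms] unfolding domestic_def tubular_def by linarith
  moreover have "finite_mutation_type (Q_Tsq (of_weights ?ws)) \<longleftrightarrow> defect ?ws \<le> 2"
    using tame_or_wild[OF ws]
  proof (elim disjE bexE)
    fix ps assume ps: "ps \<in> tame_weights" "dominated ?ws ps"
    have "\<forall>w\<in>set ps. 0 < w" using ps(1) by (auto simp: tame_weights_def)
    then have "defect ?ws \<le> 2" using defect_dominated[OF ps(2) pos] defect_tame[OF ps(1)] by simp
    then show ?thesis using finite_mutation_type_dominated[OF ps(2)] finite_mutation_type_tame[OF ps(1)] by simp
  next
    fix ps assume ps: "ps \<in> minimal_wild_weights" "dominated ps ?ws"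
    have "\<forall>w\<in>set ps. 0 < w" using ps(1) by (auto simp: minimal_wild_weights_def)
    then have "2 < defect ?ws" using defect_dominated[OF ps(2) _ pos] defect_minimal_wild[OF ps(1)] by simp
    then show ?thesis using finite_mutation_type_dominated[OF ps(2)] infinite_minimal_wild[OF ps(1)] by auto
  qed
  ultimately show ?thesis using finite_mutation_type_reduced_weights by blast
qed

end
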